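(* Let $(M,\mathcal T)$ be a closed pseudo 3-manifold with edge set $E$ satisfying $d_e\ge10$ for all $e\in E$. Then there exists a zero-curvature hyper-ideal metric $l\in\mathcal L(M,\mathcal T)$, which is unique in the class $\mathbb R^E_{>0}$ (that is, it is the only element of $\mathbb R^E_{>0}$ with vanishing generalized Ricci curvature $\widetilde K$). Moreover, $$l\in\big[(3\max_{e\in E}d_e)^{-1},\ \operatorname{arccosh}3\big]^E .$$ For any initial data in $\mathbb R^E_{>0}$, the extended Ricci flow $$\frac{d}{dt}l_e(t)=\widetilde K_e(l(t))\,l_e(t)\quad(e\in E,\ t\ge0),\qquad l(0)=l_0,$$ converges to $l$ exponentially fast.
   Context: Closed pseudo 3-manifold. Let $T_1,\dots,T_t$ be finitely many combinatorial tetrahedra with disjoint union $\mathscr T$. A closed pseudo 3-manifold $(M,\mathcal T)$ is the quotient of $\mathscr T$ by a family of affine isomorphisms pairing faces of the tetrahedra, such that each codimension-1 face is identified with another codimension-1 face. Its edge set $E$ is the set of equivalence classes of edges of $T_1,\dots,T_t$ under the gluing; $P_E$ is the projection from the edges of $\mathscr T$ to $E$. The valence of $e\in E$ is $d_e=|P_E^{-1}(e)|$. $\mathbb R^E_{>0}$ is the set of positive functions on $E$; for an interval $I\subset(0,\infty)$, $I^E=\{l\in\mathbb R^E_{>0}:l(e)\in I\ \forall e\in E\}$. Extended dihedral angles. For $l=(l_{12},l_{13},l_{14},l_{23},l_{24},l_{34})\in\mathbb R^6_{\ge0}$, with $l_{ij}=l_{ji}$, $c_{ij}=\cosh l_{ij}$,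 $s_{ij}=\sinh l_{ij}$ and $\{i,j,k,h\}=\{1,2,3,4\}$, set $$\phi_{ij}(l)=\frac{c_{ik}c_{ih}+c_{jk}c_{jh}+c_{ij}c_{ik}c_{jh}+c_{ij}c_{ih}c_{jk}-s_{ij}^2c_{kh}}{\sqrt{2c_{ij}c_{ik}c_{jk}+c_{ij}^2+c_{ik}^2+c_{jk}^2-1}\,\sqrt{2c_{ij}c_{ih}c_{jh}+c_{ij}^2+c_{ih}^2+c_{jh}^2-1}},$$ and let the extended dihedral angle at edge $\{i,j\}$ be $\alpha_{ij}(l)=\arccos\big(\max(-1,\min(\phi_{ij}(l),1))\big)$. Generalized Ricci curvature. Given $l\in\mathbb R^E_{>0}$, give each edge $\hat e$ of each tetrahedron $T_j$ the length $\hat l(\hat e)=l(P_E(\hat e))$, and let $\alpha(\hat e)$ be the extended dihedral angle at $\hat e$ in the tetrahedron $T_j$ containing it, computed from the six lengths of $T_j$. Then $\widetilde K_e(l)=2\pi-\sum_{\hat e\in P_E^{-1}(e)}\alpha(\hat e)$. Hyper-ideal metrics. A hyper-ideal tetrahedron is a compact convex polyhedron in $\mathbb H^3$ diffeomorphic to a truncated Euclidean tetrahedron whose four hexagonal faces are right-angled hyperbolic hexagons and whose four triangular faces are hyperbolic triangles meeting the hexagonal faces at angle $\pi/2$; its six edges are the intersections of pairs of hexagonal faces. $\mathcal L\subset\mathbb R^6_{>0}$ is the set of edge length vectors of hyper-ideal tetrahedra; by a known result of Luo and Yang, $\mathcal L=\{l\in\mathbb R^6_{\ge0}:\phi_{ij}(l)\in(-1,1)\text{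 for all }\{i,j\}\}$. $\mathcal L(M,\mathcal T)\subset\mathbb R^E_{>0}$, the set of hyper-ideal metrics, is the set of $l$ such that for every $T_j$ the six lengths given by $\hat l$ lie in $\mathcal L$; on it, extended dihedral angles are the actual dihedral angles and $\widetilde K=K$ is the Ricci curvature. A zero-curvature hyper-ideal metric is $l\in\mathcal L(M,\mathcal T)$ with $K_e(l)=0$ for all $e\in E$. Convergence. For every $l_0\in\mathbb R^E_{>0}$ the flow has a unique solution $l(t)\in\mathbb R^E_{>0}$ on $[0,\infty)$. Exponentially fast convergence of $l(t)$ to $l_\infty$ means $|l(t)-l_\infty|\le Ae^{-\lambda t}$ for all $t\ge0$ and some $A,\lambda>0$. *)

theory Defs
  imports "HOL-Analysis.Analysis"
begin

section \<open>Closed pseudo 3-manifolds\<close>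

text \<open>
  The vertices of every tetrahedron are the elements of the four-element type \<^typ>\<open>4\<close>.
  The pair \<open>(j, v)\<close> stands for the face of the tetrahedron \<open>j\<close> opposite to the vertex \<open>v\<close>.  That face
  is glued to the face \<^term>\<open>mate M (j, v)\<close>, and \<^term>\<open>glue M (j, v)\<close> is the action of the gluing map
  on vertices.  An affine isomorphism between triangles is determined by this action, and every
  bijection of the vertices is induced by an affine isomorphism.
\<close>

record 'a triangulation =
  tets :: "'a set"
  mate :: "'a \<times> 4 \<Rightarrow> 'a \<times> 4"
  glue :: "'a \<times> 4 \<Rightarrow> 4 \<Rightarrow> 4"

definition faces :: "('a, 'm) triangulation_scheme \<Rightarrow> ('a \<times> 4) set" where
  "faces M = tets M \<times> UNIV"

definition closed_pseudo_3_manifold :: "('a, 'm) triangulation_scheme \<Rightarrow> bool" where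
  "closed_pseudo_3_manifold M \<longleftrightarrow>
     finite (tets M) \<and>
     (\<forall>f\<in>faces M.
        mate M f \<in> faces M \<and> mate M f \<noteq> f \<and> mate M (mate M f) = f \<and>
        bij_betw (glue M f) (- {snd f}) (- {snd (mate M f)}) \<and>
        (\<forall>v\<in>- {snd f}. glue M (mate M f) (glue M f v) = v))"

text \<open>The edges of the disjoint union of the tetrahedra; an edge is the set of its two end points.\<close>

definition tet_edges :: "('a, 'm) triangulation_scheme \<Rightarrow> ('a \<times> 4 set) set" where
  "tet_edges M = tets M \<times> {s. card s = 2}"

definition edge_gluing :: "('a, 'm) triangulation_scheme \<Rightarrow> ('a \<times> 4 set) rel" where
  "edge_gluing M =
     {((j, s), (fst (mate M (j, v)), glue M (j, v) ` s)) | j s v. (j, s) \<in> tet_edges M \<and> v \<notin> s}"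

definition edge_equiv :: "('a, 'm) triangulation_scheme \<Rightarrow> ('a \<times> 4 set) rel" where
  "edge_equiv M = Restr ((edge_gluing M \<union> (edge_gluing M)\<inverse>)\<^sup>*) (tet_edges M)"

definition edges :: "('a, 'm) triangulation_scheme \<Rightarrow> ('a \<times> 4 set) set set" where
  "edges M = tet_edges M // edge_equiv M"

definition edge_proj :: "('a, 'm) triangulation_scheme \<Rightarrow> 'a \<times> 4 set \<Rightarrow> ('a \<times> 4 set) set" where
  "edge_proj M a = edge_equiv M `` {a}"

definition edge_fibre ::
  "('a, 'm) triangulation_scheme \<Rightarrow> ('a \<times> 4 set) set \<Rightarrow> ('a \<times> 4 set) set" where
  "edge_fibre M e = {a \<in> tet_edges M. edge_proj M a = e}"

definition valence :: "('a, 'm) triangulation_scheme \<Rightarrow> ('a \<times> 4 set) set \<Rightarrow> nat" where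
  "valence M e = card (edge_fibre M e)"

type_synonym 'a edge_function = "('a \<times> 4 set) set \<Rightarrow> real"

text \<open>
  Functions on the edge set are taken to be extensional (\<^term>\<open>undefined\<close> off \<^term>\<open>edges M\<close>), so
  that equality of functions is equality on \<^term>\<open>edges M\<close>.
\<close>

definition positive_functions :: "('a, 'm) triangulation_scheme \<Rightarrow> 'a edge_function set" where
  "positive_functions M = (edges M \<rightarrow>\<^sub>E {0<..})"

text \<open>
  Six numbers attached to the edges of a tetrahedron are a function on two-element vertex sets; the
  values at other sets are irrelevant.
\<close>

definition tet_lengths ::
  "('a, 'm) triangulation_scheme \<Rightarrow> 'a edge_function \<Rightarrow> 'a \<Rightarrow> 4 set \<Rightarrow> real" where
  "tet_lengths M l j s = l (edge_proj M (j, s))"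

section \<open>Extended dihedral angles and generalized Ricci curvature\<close>

definition phi :: "(4 set \<Rightarrow> real) \<Rightarrow> 4 \<Rightarrow> 4 \<Rightarrow> 4 \<Rightarrow> 4 \<Rightarrow> real" where
  "phi l i j k h =
     (let c = (\<lambda>p q. cosh (l {p, q})); s = (\<lambda>p q. sinh (l {p, q})) in
      (c i k * c i h + c j k * c j h + c i j * c i k * c j h + c i j * c i h * c j k
         - (s i j)\<^sup>2 * c k h)
      / (sqrt (2 * c i j * c i k * c j k + (c i j)\<^sup>2 + (c i k)\<^sup>2 + (c j k)\<^sup>2 - 1)
         * sqrt (2 * c i j * c i h * c j h + (c i j)\<^sup>2 + (c i h)\<^sup>2 + (c j h)\<^sup>2 - 1)))"

definition extended_angle :: "(4 set \<Rightarrow> real) \<Rightarrow> 4 set \<Rightarrow> real" where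
  "extended_angle l s =
     (THE a. \<exists>i j k h. distinct [i, j, k, h] \<and> s = {i, j} \<and>
        a = arccos (max (- 1) (min (phi l i j k h) 1)))"

lemma phi_swap:
  "phi l j i k h = phi l i j k h" "phi l i j h k = phi l i j k h"
proof -
  have c: "{j, i} = {i, j}" "{h, k} = {k, h}" by auto
  show "phi l j i k h = phi l i j k h"
    unfolding phi_def Let_def c by (simp add: algebra_simps)
  show "phi l i j h k = phi l i j k h"
    unfolding phi_def Let_def c by (simp add: algebra_simps)
qed

lemma distinct4_UNIV:
  fixes i j k h :: 4
  assumes "distinct [i, j, k, h]"
  shows "UNIV = {i, j, k, h}"
proof -
  have "card {i, j, k, h} = card (UNIV :: 4 set)"
    using assms by simp
  then show ?thesis
    by (metis card_subset_eq finite_class.finite_UNIV subset_UNIV)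
qed

lemma extended_angle_eq:
  assumes "distinct [i, j, k, h]"
  shows "extended_angle l {i, j} = arccos (max (- 1) (min (phi l i j k h) 1))"
  unfolding extended_angle_def
proof (rule the_equality)
  show "\<exists>i' j' k' h'. distinct [i', j', k', h'] \<and> {i, j} = {i', j'} \<and>
      arccos (max (- 1) (min (phi l i j k h) 1)) = arccos (max (- 1) (min (phi l i' j' k' h') 1))"
    using assms by blast
next
  fix a
  assume "\<exists>i' j' k' h'. distinct [i', j', k', h'] \<and> {i, j} = {i', j'} \<and>
      a = arccos (max (- 1) (min (phi l i' j' k' h') 1))"
  then obtain i' j' k' h' where d: "distinct [i', j', k', h']" and e: "{i, j} = {i', j'}"
    and a: "a = arccos (max (- 1) (min (phi l i' j' k' h') 1))" by blast
  have "{k', h'} = - {i', j'}" and "{k, h} = - {i, j}"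
    using distinct4_UNIV[OF d] distinct4_UNIV[OF assms] d assms by auto
  with e have "{k', h'} = {k, h}" by simp
  with e have "(i' = i \<and> j' = j \<or> i' = j \<and> j' = i) \<and> (k' = k \<and> h' = h \<or> k' = h \<and> h' = k)"
    unfolding doubleton_eq_iff by blast
  then have "phi l i' j' k' h' = phi l i j k h"
    by (auto simp: phi_swap)
  with a show "a = arccos (max (- 1) (min (phi l i j k h) 1))" by simp
qed

definition generalized_ricci ::
  "('a, 'm) triangulation_scheme \<Rightarrow> 'a edge_function \<Rightarrow> ('a \<times> 4 set) set \<Rightarrow> real" where
  "generalized_ricci M l e =
     2 * pi - (\<Sum>(j, s)\<in>edge_fibre M e. extended_angle (tet_lengths M l j) s)"

section \<open>Hyper-ideal tetrahedra\<close>

text \<open>Hyperbolic 3-space is the upper sheet of the hyperboloid in Minkowski space.\<close>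

definition mink :: "(real^3) \<times> real \<Rightarrow> (real^3) \<times> real \<Rightarrow> real" where
  "mink x y = fst x \<bullet> fst y - snd x * snd y"

definition hyperbolic_space :: "((real^3) \<times> real) set" where
  "hyperbolic_space = {x. mink x x = - 1 \<and> snd x > 0}"

definition hyp_dist :: "(real^3) \<times> real \<Rightarrow> (real^3) \<times> real \<Rightarrow> real" where
  "hyp_dist x y = arcosh (- mink x y)"

text \<open>
  A truncated tetrahedron has eight faces, indexed by \<^typ>\<open>4 + 4\<close>: \<open>Inl i\<close> is the hexagonal face
  opposite to the vertex \<open>i\<close>, and \<open>Inr i\<close> is the triangular face truncating the vertex \<open>i\<close>.  Face \<open>a\<close>
  lies on the hyperbolic plane with unit normal \<open>n a\<close> pointing out of the polyhedron.
\<close>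

type_synonym face_normals = "4 + 4 \<Rightarrow> (real^3) \<times> real"

definition hyp_polyhedron :: "face_normals \<Rightarrow> ((real^3) \<times> real) set" where
  "hyp_polyhedron n = {x \<in> hyperbolic_space. \<forall>a. mink x (n a) \<le> 0}"

definition hyp_face :: "face_normals \<Rightarrow> 4 + 4 \<Rightarrow> ((real^3) \<times> real) set" where
  "hyp_face n a = {x \<in> hyp_polyhedron n. mink x (n a) = 0}"

text \<open>
  The truncated tetrahedron is a simple polytope, with one vertex on the faces
  \<open>Inr i\<close>, \<open>Inl j\<close>, \<open>Inl k\<close> for each choice of distinct \<open>i, j, k\<close>.  The third condition below says
  that the polyhedron has this combinatorial type, which is what being diffeomorphic to a truncated
  tetrahedron (as a polyhedron, faces going to faces) means: a family of faces has a common point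
  iff it does so in the truncated tetrahedron.  The condition also forces the polyhedron to be
  three-dimensional and each \<open>n a\<close> to support a two-dimensional face.

  The last condition is the right angle between triangular and adjacent hexagonal faces.  The
  hexagons are then right-angled: in the plane of \<open>Inl j\<close>, the sides lying on \<open>Inl k\<close> and \<open>Inr i\<close> have
  normals \<open>n (Inl k) - c n (Inl j)\<close>, with \<open>c\<close> the product of the two vectors, and \<open>n (Inr i)\<close>; these
  are orthogonal.
\<close>

definition hyper_ideal_tetrahedron :: "face_normals \<Rightarrow> bool" where
  "hyper_ideal_tetrahedron n \<longleftrightarrow>
     (\<forall>a. mink (n a) (n a) = 1) \<and>
     compact (hyp_polyhedron n) \<and>
     (\<forall>S. (\<exists>x\<in>hyp_polyhedron n. \<forall>a\<in>S. x \<in> hyp_face n a) \<longleftrightarrow>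
          (\<exists>i j k. distinct [i, j, k] \<and> S \<subseteq> {Inr i, Inl j, Inl k})) \<and>
     (\<forall>i j. i \<noteq> j \<longrightarrow> mink (n (Inr i)) (n (Inl j)) = 0)"

text \<open>
  The edge of the tetrahedron joining the vertices in \<open>s\<close> is the intersection of the two hexagonal
  faces opposite to the other vertices.  It is a geodesic segment whose end points lie on the
  triangular faces at the two vertices in \<open>s\<close>, and its length is the distance of the end points.
\<close>

definition hyp_edge :: "face_normals \<Rightarrow> 4 set \<Rightarrow> ((real^3) \<times> real) set" where
  "hyp_edge n s = (\<Inter>k\<in>- s. hyp_face n (Inl k))"

definition has_edge_lengths :: "face_normals \<Rightarrow> (4 set \<Rightarrow> real) \<Rightarrow> bool" where
  "has_edge_lengths n l \<longleftrightarrow>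
     (\<forall>i j. i \<noteq> j \<longrightarrow>
        (\<forall>x \<in> hyp_edge n {i, j} \<inter> hyp_face n (Inr i).
         \<forall>y \<in> hyp_edge n {i, j} \<inter> hyp_face n (Inr j). hyp_dist x y = l {i, j}))"

definition hyper_ideal_lengths :: "(4 set \<Rightarrow> real) set" where
  "hyper_ideal_lengths = {l. \<exists>n. hyper_ideal_tetrahedron n \<and> has_edge_lengths n l}"

text \<open>
  The interior angle between two half-spaces with outward unit normals \<open>u\<close> and \<open>v\<close> is
  \<open>arccos (- mink u v)\<close>.  Edge lengths determine a hyper-ideal tetrahedron up to isometry, so the
  description below is definite for lengths in \<^const>\<open>hyper_ideal_lengths\<close>.
\<close>

definition dihedral_angle :: "(4 set \<Rightarrow> real) \<Rightarrow> 4 set \<Rightarrow> real" where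
  "dihedral_angle l s =
     (THE a. \<exists>n k h. hyper_ideal_tetrahedron n \<and> has_edge_lengths n l \<and> k \<noteq> h \<and> - s = {k, h} \<and>
        a = arccos (- mink (n (Inl k)) (n (Inl h))))"

definition hyper_ideal_metrics :: "('a, 'm) triangulation_scheme \<Rightarrow> 'a edge_function set" where
  "hyper_ideal_metrics M =
     {l \<in> positive_functions M. \<forall>j\<in>tets M. tet_lengths M l j \<in> hyper_ideal_lengths}"

definition ricci ::
  "('a, 'm) triangulation_scheme \<Rightarrow> 'a edge_function \<Rightarrow> ('a \<times> 4 set) set \<Rightarrow> real" where
  "ricci M l e = 2 * pi - (\<Sum>(j, s)\<in>edge_fibre M e. dihedral_angle (tet_lengths M l j) s)"

definition zero_curvature_metric :: "('a, 'm) triangulation_scheme \<Rightarrow> 'a edge_function \<Rightarrow> bool" where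
  "zero_curvature_metric M l \<longleftrightarrow> l \<in> hyper_ideal_metrics M \<and> (\<forall>e\<in>edges M. ricci M l e = 0)"

section \<open>The extended Ricci flow\<close>

text \<open>Solutions are considered for \<open>t \<ge> 0\<close> only; the values at negative times are irrelevant.\<close>

definition extended_ricci_flow ::
  "('a, 'm) triangulation_scheme \<Rightarrow> 'a edge_function \<Rightarrow> (real \<Rightarrow> 'a edge_function) \<Rightarrow> bool" where
  "extended_ricci_flow M l0 L \<longleftrightarrow>
     L 0 = l0 \<and>
     (\<forall>t\<ge>0. L t \<in> positive_functions M) \<and>
     (\<forall>t\<ge>0. \<forall>e\<in>edges M.
        ((\<lambda>u. L u e) has_real_derivative generalized_ricci M (L t) e * L t e) (at t within {0..}))"

definition converges_exponentially ::
  "('a, 'm) triangulation_scheme \<Rightarrow> (real \<Rightarrow> 'a edge_function) \<Rightarrow> 'a edge_function \<Rightarrow> bool" where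
  "converges_exponentially M L l \<longleftrightarrow>
     (\<exists>A>0. \<exists>lam>0. \<forall>t\<ge>0. L2_set (\<lambda>e. L t e - l e) (edges M) \<le> A * exp (- lam * t))"

end

theory Submission
  imports Defs
begin

text \<open>
  On hyper-ideal length vectors the Jacobian of the six dihedral angles with respect to the edge
  lengths is symmetric, nonsingular (infinitesimal rigidity) and positive definite at the regular
  tetrahedron.  As the set of such vectors is connected, it is positive definite everywhere.
  Outside this set the extended angles are locally constant with values in \<open>{0, \<pi>}\<close>, so
  the extended angles form a monotone map of the edge lengths on all of \<open>\<real>\<^sup>6\<^sub>>\<^sub>0\<close>, and \<open>- K\<close> is a monotone
  vector field.

  If all valences are at least 10, then \<open>K\<close> points inwards on the boundary of the cube
  \<open>[1 / (3 d), arcosh 2]\<^sup>E\<close>, \<open>d\<close> the largest valence: an angle at an edge of length \<open>arcosh 2\<close>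
  exceeds \<open>\<pi> / 5\<close> if no other edge is longer, and angles at short edges are small.  All tetrahedra with edge
  lengths in the cube are hyper-ideal, so \<open>- K\<close> is Lipschitz and strongly monotone there, and
  \<open>l \<mapsto> l + h K l\<close> is a contraction of the cube for small \<open>h\<close>; its fixed point \<open>x\<close> is the metric.
  Monotonicity gives uniqueness, and exponential convergence through the Lyapunov function
  \<open>\<Sum>\<^sub>e (l e - x e - x e ln (l e / x e))\<close>.
\<close>

section \<open>Gram matrices of hyper-ideal tetrahedra\<close>

text \<open>At the boundary of the hyper-ideal set the derivatives of the angles carry the factor
  \<open>1 / sqrt tdelta\<close>, so no Lipschitz bound is obtained up to there, and flow lines and
  segments may cross that boundary many times. Hence solutions come from Peano's theorem in the
  coordinates \<open>ln l\<close>, where the right-hand side is bounded, and monotonicity comes from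
  a positive derivative where it exists and a finite set of values elsewhere. Strictness is required
  at one end only: a segment that starts in the cube gains on its initial part and loses nothing
  afterwards, which is enough to compare the zero with any other point.

  Constants: an edge with cosine in \<open>[19/10, 2]\<close>, all adjacent cosines being at most 2,
  has an angle with cosine at most 4/5 < cos(\<pi>/5), and ten such angles exceed 2\<pi>. An edge of
  length \<open>t \<le> 1/15\<close> has an angle below \<open>3 \<pi> t\<close>; near the lower
  side \<open>t \<le> 2 / (3 d)\<close>, and \<open>d\<close> such angles sum to at most 2\<pi>.
  Ending the cube at arcosh 2 instead of arcosh 3 leaves it a hyper-ideal neighbourhood, since
  cosines up to 11/5 still give \<open>tdelta > 0\<close>.\<close>

text \<open>
  Below \<open>a, f\<close> are the hyperbolic cosines of the lengths of opposite edges \<open>{i, j}\<close>, \<open>{k, h}\<close> of a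
  tetrahedron, and \<open>b, c, d, e\<close> those of \<open>{i, k}\<close>, \<open>{i, h}\<close>, \<open>{j, k}\<close>, \<open>{j, h}\<close>.  Let \<open>G\<close> be the
  matrix with diagonal 1 and these numbers negated off the diagonal.  Then \<open>tdelta\<close> is \<open>- det G\<close>,
  and \<open>- tface\<close> and \<open>tnum\<close> are diagonal and off-diagonal cofactors of \<open>G\<close>.
\<close>

definition tnum :: "real \<Rightarrow> real \<Rightarrow> real \<Rightarrow> real \<Rightarrow> real \<Rightarrow> real \<Rightarrow> real" where
  "tnum a f b c d e = b * c + d * e + a * b * e + a * c * d - (a\<^sup>2 - 1) * f"

definition tface :: "real \<Rightarrow> real \<Rightarrow> real \<Rightarrow> real" where
  "tface x y z = 2 * x * y * z + x\<^sup>2 + y\<^sup>2 + z\<^sup>2 - 1"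

definition tdelta :: "real \<Rightarrow> real \<Rightarrow> real \<Rightarrow> real \<Rightarrow> real \<Rightarrow> real \<Rightarrow> real" where
  "tdelta a f b c d e =
     a\<^sup>2 + b\<^sup>2 + c\<^sup>2 + d\<^sup>2 + e\<^sup>2 + f\<^sup>2 - 1 + 2 * (a * b * d + a * c * e + b * c * f + d * e * f)
     + 2 * (a * f * b * e + b * e * c * d + c * d * a * f) - (a * f)\<^sup>2 - (b * e)\<^sup>2 - (c * d)\<^sup>2"

definition tphi :: "real \<Rightarrow> real \<Rightarrow> real \<Rightarrow> real \<Rightarrow> real \<Rightarrow> real \<Rightarrow> real" where
  "tphi a f b c d e = tnum a f b c d e / (sqrt (tface a b d) * sqrt (tface a c e))"

definition tang :: "real \<Rightarrow> real \<Rightarrow> real \<Rightarrow> real \<Rightarrow> real \<Rightarrow> real \<Rightarrow> real" where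
  "tang a f b c d e = arccos (max (- 1) (min (tphi a f b c d e) 1))"

lemma tface_swap: "tface y x z = tface x y z" "tface x z y = tface x y z"
  by (simp_all add: tface_def algebra_simps)

lemma tface_pos:
  assumes "x > 1" "y > 1" "z > 1"
  shows "tface x y z > 4"
proof -
  have "x * y * z > 1" using assms by (simp add: less_1_mult)
  moreover have "x\<^sup>2 > 1" "y\<^sup>2 > 1" "z\<^sup>2 > 1" using assms by auto
  ultimately show ?thesis by (simp add: tface_def)
qed

lemma tdelta_perm:
  "tdelta b e a c d f = tdelta a f b c d e"
  "tdelta c d a b e f = tdelta a f b c d e"
  "tdelta d c a e b f = tdelta a f b c d e"
  "tdelta e b a d c f = tdelta a f b c d e"
  "tdelta f a b d c e = tdelta a f b c d e"
  by (simp_all add: tdelta_def algebra_simps)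

text \<open>Jacobi's identity: the 2 by 2 minor of the adjugate of \<open>G\<close> at
  \<open>k, h\<close> is \<open>det G\<close> times the complementary minor
  \<open>1 - a\<^sup>2\<close>.\<close>

lemma tface_mult_minus_tnum:
  "tface a b d * tface a c e - (tnum a f b c d e)\<^sup>2 = tdelta a f b c d e * (a\<^sup>2 - 1)"
  unfolding tface_def tnum_def tdelta_def by algebra

lemma tnum_swap:
  "tnum a f c b e d = tnum a f b c d e"
  "tnum a f d e b c = tnum a f b c d e"
  by (simp_all add: tnum_def algebra_simps)

text \<open>With \<open>C\<close> the adjugate, column \<open>h\<close> of
  \<open>G C = det(G) I\<close> vanishes in the rows \<open>i\<close> and \<open>j\<close>;
  eliminating the cofactor at \<open>j, h\<close> from these two equations leaves this
  relation.\<close>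

lemma tnum_adjacent:
  "(c + a * e) * tface a b d - tnum a f b c d e * (a * d + b) = (a\<^sup>2 - 1) * tnum d c a e b f"
  unfolding tface_def tnum_def by algebra

text \<open>
  \<open>dnum\<close>, \<open>dface\<close> and \<open>ddelta\<close> are differentials, \<open>u, z, v, w, x, y\<close> being those of
  \<open>a, f, b, c, d, e\<close>.  Up to a positive factor \<open>erow\<close> is the differential of the dihedral angle.
\<close>

definition dnum :: "real \<Rightarrow> real \<Rightarrow> real \<Rightarrow> real \<Rightarrow> real \<Rightarrow> real \<Rightarrow>
    real \<Rightarrow> real \<Rightarrow> real \<Rightarrow> real \<Rightarrow> real \<Rightarrow> real \<Rightarrow> real" where
  "dnum a f b c d e u z v w x y = v * c + b * w + x * e + d * y + u * b * e + a * v * e + a * b * y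
     + u * c * d + a * w * d + a * c * x - 2 * a * u * f - (a\<^sup>2 - 1) * z"

definition dface :: "real \<Rightarrow> real \<Rightarrow> real \<Rightarrow> real \<Rightarrow> real \<Rightarrow> real \<Rightarrow> real" where
  "dface a b c u v w =
     2 * (u * b * c + a * v * c + a * b * w) + 2 * a * u + 2 * b * v + 2 * c * w"

definition erow :: "real \<Rightarrow> real \<Rightarrow> real \<Rightarrow> real \<Rightarrow> real \<Rightarrow> real \<Rightarrow>
    real \<Rightarrow> real \<Rightarrow> real \<Rightarrow> real \<Rightarrow> real \<Rightarrow> real \<Rightarrow> real" where
  "erow a f b c d e u z v w x y =
     (tnum a f b c d e / 2 * (dface a b d u v x / tface a b d + dface a c e u w y / tface a c e)
      - dnum a f b c d e u z v w x y) / (a\<^sup>2 - 1)"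

definition ediag :: "real \<Rightarrow> real \<Rightarrow> real \<Rightarrow> real \<Rightarrow> real \<Rightarrow> real \<Rightarrow> real" where
  "ediag a f b c d e =
     (tnum a f b c d e * ((b * d + a) / tface a b d + (c * e + a) / tface a c e)
      - (b * e + c * d - 2 * a * f)) / (a\<^sup>2 - 1)"

text \<open>This form exhibits the symmetry of the Jacobian. Opposite edges have coefficient 1. Two
  edges of a common face have the coefficient minus \<open>tnum\<close> at the third edge over
  \<open>tface\<close> of the face, which does not depend on their order.\<close>

lemma erow_eq:
  assumes "a > 1" "b > 1" "c > 1" "d > 1" "e > 1"
  shows "erow a f b c d e u z v w x y = ediag a f b c d e * u + z
     - (tnum d c a e b f * v + tnum b e a c d f * x) / tface a b d
     - (tnum e b a d c f * w + tnum c d a b e f * y) / tface a c e"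
proof -
  define P where "P = tface a b d"
  define R where "R = tface a c e"
  define n where "n = tnum a f b c d e"
  have a: "a\<^sup>2 - 1 > 0" using assms(1) by simp
  have P: "P > 0" "R > 0" using tface_pos assms unfolding P_def R_def by (smt (verit))+
  have 1: "(a\<^sup>2 - 1) * tnum d c a e b f = (c + a * e) * P - n * (a * d + b)"
    unfolding P_def n_def by (rule tnum_adjacent[symmetric])
  have 2: "(a\<^sup>2 - 1) * tnum e b a d c f = (b + a * d) * R - n * (a * e + c)"
    unfolding R_def n_def
    using tnum_adjacent[of b a d c e f] by (simp add: tnum_def algebra_simps)
  have 3: "(a\<^sup>2 - 1) * tnum b e a c d f = (e + a * c) * P - n * (a * b + d)"
    unfolding P_def n_def
    using tnum_adjacent[of e a c d b f] by (simp add: tnum_def tface_def algebra_simps)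
  have 4: "(a\<^sup>2 - 1) * tnum c d a b e f = (d + a * b) * R - n * (a * c + e)"
    unfolding R_def n_def
    using tnum_adjacent[of d a b e c f] by (simp add: tnum_def tface_def algebra_simps)
  have "(a\<^sup>2 - 1) * erow a f b c d e u z v w x y
      = n / 2 * (dface a b d u v x / P + dface a c e u w y / R) - dnum a f b c d e u z v w x y"
    using a unfolding erow_def P_def R_def n_def by simp
  also have "\<dots> = (a\<^sup>2 - 1) * ediag a f b c d e * u + (a\<^sup>2 - 1) * z
     - ((a\<^sup>2 - 1) * tnum d c a e b f * v + (a\<^sup>2 - 1) * tnum b e a c d f * x) / P
     - ((a\<^sup>2 - 1) * tnum e b a d c f * w + (a\<^sup>2 - 1) * tnum c d a b e f * y) / R"
  proof -
    have D: "(a\<^sup>2 - 1) * ediag a f b c d e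
        = n * ((b * d + a) / P + (c * e + a) / R) - (b * e + c * d - 2 * a * f)"
      using a unfolding ediag_def P_def R_def n_def by simp
    show ?thesis
      unfolding D 1 2 3 4 dface_def dnum_def using P
      by (simp add: algebra_simps add_divide_distrib diff_divide_distrib)
  qed
  also have "\<dots> = (a\<^sup>2 - 1) * (ediag a f b c d e * u + z
     - (tnum d c a e b f * v + tnum b e a c d f * x) / P
     - (tnum e b a d c f * w + tnum c d a b e f * y) / R)"
    by (simp add: algebra_simps add_divide_distrib diff_divide_distrib)
  finally show ?thesis using a unfolding P_def R_def by simp
qed

section \<open>Differential identities for the Gram matrix and its adjugate\<close>

definition ddelta :: "real \<Rightarrow> real \<Rightarrow> real \<Rightarrow> real \<Rightarrow> real \<Rightarrow> real \<Rightarrow>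
    real \<Rightarrow> real \<Rightarrow> real \<Rightarrow> real \<Rightarrow> real \<Rightarrow> real \<Rightarrow> real" where
  "ddelta a f b c d e u z v w x y = 2 * (u * tnum f a b d c e + z * tnum a f b c d e
     + v * tnum e b a d c f + y * tnum b e a c d f + w * tnum d c a e b f + x * tnum c d a b e f)"

text \<open>
  The diagonal entry at vertex 1 and the entry \<open>(1, 2)\<close> of \<open>G H G\<close>, where \<open>G\<close> is the Gram matrix and
  \<open>H\<close> is the symmetric matrix with diagonal \<open>p\<^sub>1, \<dots>, p\<^sub>4\<close> and off-diagonal entries
  \<open>- h\<^sub>1\<^sub>2, \<dots>, - h\<^sub>3\<^sub>4\<close>.
\<close>

definition gram_diag :: "real \<Rightarrow> real \<Rightarrow> real \<Rightarrow> real \<Rightarrow> real \<Rightarrow> real \<Rightarrow> real \<Rightarrow>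
    real \<Rightarrow> real \<Rightarrow> real \<Rightarrow> real \<Rightarrow> real \<Rightarrow> real \<Rightarrow> real" where
  "gram_diag a b c p1 p2 p3 p4 h12 h13 h14 h23 h24 h34 =
     p1 + a\<^sup>2 * p2 + b\<^sup>2 * p3 + c\<^sup>2 * p4 + 2 * (a * h12 + b * h13 + c * h14)
     - 2 * (a * b * h23 + a * c * h24 + b * c * h34)"

definition gram_off :: "real \<Rightarrow> real \<Rightarrow> real \<Rightarrow> real \<Rightarrow> real \<Rightarrow> real \<Rightarrow> real \<Rightarrow> real \<Rightarrow> real \<Rightarrow>
    real \<Rightarrow> real \<Rightarrow> real \<Rightarrow> real \<Rightarrow> real \<Rightarrow> real \<Rightarrow> real" where
  "gram_off a b c d e p1 p2 p3 p4 h12 h13 h14 h23 h24 h34 =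
     - a * p1 - a * p2 + b * d * p3 + c * e * p4 - (1 + a\<^sup>2) * h12 - (a * b - d) * h13
     - (a * c - e) * h14 - (a * d - b) * h23 - (a * e - c) * h24 - (b * e + c * d) * h34"

text \<open>Here \<open>H = - dC\<close>, with \<open>C\<close> the adjugate. Differentiating
  \<open>G C = det(G) I\<close> and multiplying by \<open>G\<close> gives
  \<open>G H G = det(G) dG - d(det G) G\<close>; on the diagonal \<open>dG\<close> vanishes.\<close>

lemma gram_diag_ddelta:
  "gram_diag a b c
      (dface d e f x y z) (dface b c f v w z)
      (dface a c e u w y) (dface a b d u v x)
      (dnum f a b d c e z u v x w y) (dnum e b a d c f y v u x w z)
      (dnum d c a e b f x w u y v z) (dnum c d a b e f w x u v y z)
      (dnum b e a c d f v y u w x z) (dnum a f b c d e u z v w x y)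
    = ddelta a f b c d e u z v w x y"
  "gram_diag a d e
      (dface b c f v w z) (dface d e f x y z)
      (dface a c e u w y) (dface a b d u v x)
      (dnum f a b d c e z u v x w y) (dnum c d a b e f w x u v y z)
      (dnum b e a c d f v y u w x z) (dnum e b a d c f y v u x w z)
      (dnum d c a e b f x w u y v z) (dnum a f b c d e u z v w x y)
    = ddelta a f b c d e u z v w x y"
  "gram_diag b d f
      (dface a c e u w y) (dface d e f x y z)
      (dface b c f v w z) (dface a b d u v x)
      (dnum e b a d c f y v u x w z) (dnum c d a b e f w x u v y z)
      (dnum a f b c d e u z v w x y) (dnum f a b d c e z u v x w y)
      (dnum d c a e b f x w u y v z) (dnum b e a c d f v y u w x z)
    = ddelta a f b c d e u z v w x y"
  "gram_diag c e f
      (dface a b d u v x) (dface d e f x y z)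
      (dface b c f v w z) (dface a c e u w y)
      (dnum d c a e b f x w u y v z) (dnum b e a c d f v y u w x z)
      (dnum a f b c d e u z v w x y) (dnum f a b d c e z u v x w y)
      (dnum e b a d c f y v u x w z) (dnum c d a b e f w x u v y z)
    = ddelta a f b c d e u z v w x y"
  unfolding dface_def dnum_def ddelta_def tnum_def tface_def gram_diag_def by - (algebra+)

text \<open>Here \<open>H = - (\<tau> C + C \<tau>) / 2\<close> with \<open>\<tau>\<close> the
  diagonal matrix of \<open>t1, t2, t3, t4\<close>, and \<open>G C = C G = det(G) I\<close> gives
  \<open>G H G = tdelta * (G \<tau> + \<tau> G) / 2\<close>.\<close>

lemma gram_diag_tdelta:
  "gram_diag a b c
      (t1 * tface d e f) (t2 * tface b c f)
      (t3 * tface a c e) (t4 * tface a b d)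
      (tnum f a b d c e / 2 * (t1 + t2)) (tnum e b a d c f / 2 * (t1 + t3))
      (tnum d c a e b f / 2 * (t1 + t4)) (tnum c d a b e f / 2 * (t2 + t3))
      (tnum b e a c d f / 2 * (t2 + t4)) (tnum a f b c d e / 2 * (t3 + t4))
    = tdelta a f b c d e * t1"
  "gram_diag a d e
      (t2 * tface b c f) (t1 * tface d e f)
      (t3 * tface a c e) (t4 * tface a b d)
      (tnum f a b d c e / 2 * (t1 + t2)) (tnum c d a b e f / 2 * (t2 + t3))
      (tnum b e a c d f / 2 * (t2 + t4)) (tnum e b a d c f / 2 * (t1 + t3))
      (tnum d c a e b f / 2 * (t1 + t4)) (tnum a f b c d e / 2 * (t3 + t4))
    = tdelta a f b c d e * t2"
  "gram_diag b d f
      (t3 * tface a c e) (t1 * tface d e f)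
      (t2 * tface b c f) (t4 * tface a b d)
      (tnum e b a d c f / 2 * (t1 + t3)) (tnum c d a b e f / 2 * (t2 + t3))
      (tnum a f b c d e / 2 * (t3 + t4)) (tnum f a b d c e / 2 * (t1 + t2))
      (tnum d c a e b f / 2 * (t1 + t4)) (tnum b e a c d f / 2 * (t2 + t4))
    = tdelta a f b c d e * t3"
  "gram_diag c e f
      (t4 * tface a b d) (t1 * tface d e f)
      (t2 * tface b c f) (t3 * tface a c e)
      (tnum d c a e b f / 2 * (t1 + t4)) (tnum b e a c d f / 2 * (t2 + t4))
      (tnum a f b c d e / 2 * (t3 + t4)) (tnum f a b d c e / 2 * (t1 + t2))
      (tnum e b a d c f / 2 * (t1 + t3)) (tnum c d a b e f / 2 * (t2 + t3))
    = tdelta a f b c d e * t4"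
  unfolding tdelta_def tnum_def tface_def gram_diag_def
  by (simp_all add: field_simps power2_eq_square)

text \<open>The entries off the diagonal of the identity behind \<open>gram_diag_ddelta\<close>: now
  \<open>det(G) dG\<close> survives, and each entry isolates one differential.\<close>

lemma gram_off_ddelta:
  "gram_off a b c d e
      (dface d e f x y z) (dface b c f v w z)
      (dface a c e u w y) (dface a b d u v x)
      (dnum f a b d c e z u v x w y) (dnum e b a d c f y v u x w z)
      (dnum d c a e b f x w u y v z) (dnum c d a b e f w x u v y z)
      (dnum b e a c d f v y u w x z) (dnum a f b c d e u z v w x y)
    = tdelta a f b c d e * u - ddelta a f b c d e u z v w x y * a"
  "gram_off b a c d f
      (dface d e f x y z) (dface a c e u w y)
      (dface b c f v w z) (dface a b d u v x)
      (dnum e b a d c f y v u x w z) (dnum f a b d c e z u v x w y)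
      (dnum d c a e b f x w u y v z) (dnum c d a b e f w x u v y z)
      (dnum a f b c d e u z v w x y) (dnum b e a c d f v y u w x z)
    = tdelta a f b c d e * v - ddelta a f b c d e u z v w x y * b"
  "gram_off c a b e f
      (dface d e f x y z) (dface a b d u v x)
      (dface b c f v w z) (dface a c e u w y)
      (dnum d c a e b f x w u y v z) (dnum f a b d c e z u v x w y)
      (dnum e b a d c f y v u x w z) (dnum b e a c d f v y u w x z)
      (dnum a f b c d e u z v w x y) (dnum c d a b e f w x u v y z)
    = tdelta a f b c d e * w - ddelta a f b c d e u z v w x y * c"
  "gram_off d a e b f
      (dface b c f v w z) (dface a c e u w y)
      (dface d e f x y z) (dface a b d u v x)
      (dnum c d a b e f w x u v y z) (dnum f a b d c e z u v x w y)
      (dnum b e a c d f v y u w x z) (dnum e b a d c f y v u x w z)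
      (dnum a f b c d e u z v w x y) (dnum d c a e b f x w u y v z)
    = tdelta a f b c d e * x - ddelta a f b c d e u z v w x y * d"
  "gram_off e a d c f
      (dface b c f v w z) (dface a b d u v x)
      (dface d e f x y z) (dface a c e u w y)
      (dnum b e a c d f v y u w x z) (dnum f a b d c e z u v x w y)
      (dnum c d a b e f w x u v y z) (dnum d c a e b f x w u y v z)
      (dnum a f b c d e u z v w x y) (dnum e b a d c f y v u x w z)
    = tdelta a f b c d e * y - ddelta a f b c d e u z v w x y * e"
  "gram_off f b d c e
      (dface a c e u w y) (dface a b d u v x)
      (dface d e f x y z) (dface b c f v w z)
      (dnum a f b c d e u z v w x y) (dnum e b a d c f y v u x w z)
      (dnum c d a b e f w x u v y z) (dnum d c a e b f x w u y v z)
      (dnum b e a c d f v y u w x z) (dnum f a b d c e z u v x w y)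
    = tdelta a f b c d e * z - ddelta a f b c d e u z v w x y * f"
  unfolding tdelta_def dface_def dnum_def ddelta_def tnum_def tface_def gram_off_def by - (algebra+)

lemma gram_off_tdelta:
  "gram_off a b c d e
      (t * tface d e f) (t * tface b c f)
      (t * tface a c e) (t * tface a b d)
      (t * tnum f a b d c e) (t * tnum e b a d c f)
      (t * tnum d c a e b f) (t * tnum c d a b e f)
      (t * tnum b e a c d f) (t * tnum a f b c d e)
    = - (tdelta a f b c d e * t) * a"
  "gram_off b a c d f
      (t * tface d e f) (t * tface a c e)
      (t * tface b c f) (t * tface a b d)
      (t * tnum e b a d c f) (t * tnum f a b d c e)
      (t * tnum d c a e b f) (t * tnum c d a b e f)
      (t * tnum a f b c d e) (t * tnum b e a c d f)
    = - (tdelta a f b c d e * t) * b"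
  "gram_off c a b e f
      (t * tface d e f) (t * tface a b d)
      (t * tface b c f) (t * tface a c e)
      (t * tnum d c a e b f) (t * tnum f a b d c e)
      (t * tnum e b a d c f) (t * tnum b e a c d f)
      (t * tnum a f b c d e) (t * tnum c d a b e f)
    = - (tdelta a f b c d e * t) * c"
  "gram_off d a e b f
      (t * tface b c f) (t * tface a c e)
      (t * tface d e f) (t * tface a b d)
      (t * tnum c d a b e f) (t * tnum f a b d c e)
      (t * tnum b e a c d f) (t * tnum e b a d c f)
      (t * tnum a f b c d e) (t * tnum d c a e b f)
    = - (tdelta a f b c d e * t) * d"
  "gram_off e a d c f
      (t * tface b c f) (t * tface a b d)
      (t * tface d e f) (t * tface a c e)
      (t * tnum b e a c d f) (t * tnum f a b d c e)
      (t * tnum c d a b e f) (t * tnum d c a e b f)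
      (t * tnum a f b c d e) (t * tnum e b a d c f)
    = - (tdelta a f b c d e * t) * e"
  "gram_off f b d c e
      (t * tface a c e) (t * tface a b d)
      (t * tface d e f) (t * tface b c f)
      (t * tnum a f b c d e) (t * tnum e b a d c f)
      (t * tnum c d a b e f) (t * tnum d c a e b f)
      (t * tnum b e a c d f) (t * tnum f a b d c e)
    = - (tdelta a f b c d e * t) * f"
  unfolding tdelta_def tnum_def tface_def gram_off_def by - (algebra+)

text \<open>The Gram matrix \<open>G\<close> and its adjugate \<open>C\<close> satisfy \<open>G dC G + det(G) dG = d(det G) G\<close>.  If no
  dihedral angle moves then \<open>dC = (\<tau> C + C \<tau>) / 2\<close> with \<open>\<tau>\<close> diagonal; the diagonal of the identity,
  where \<open>dG\<close> vanishes, makes \<open>\<tau>\<close> scalar, and then \<open>dG = 0\<close>.\<close>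

lemma infinitesimal_rigidity:
  fixes a b c d e f u v w x y z t1 t2 t3 t4 :: real
  assumes D: "tdelta a f b c d e \<noteq> 0"
    and f1: "dface d e f x y z = t1 * tface d e f"
    and f2: "dface b c f v w z = t2 * tface b c f"
    and f3: "dface a c e u w y = t3 * tface a c e"
    and f4: "dface a b d u v x = t4 * tface a b d"
    and e12: "dnum a f b c d e u z v w x y = tnum a f b c d e / 2 * (t3 + t4)"
    and e13: "dnum b e a c d f v y u w x z = tnum b e a c d f / 2 * (t2 + t4)"
    and e14: "dnum c d a b e f w x u v y z = tnum c d a b e f / 2 * (t2 + t3)"
    and e23: "dnum d c a e b f x w u y v z = tnum d c a e b f / 2 * (t1 + t4)"
    and e24: "dnum e b a d c f y v u x w z = tnum e b a d c f / 2 * (t1 + t3)"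
    and e34: "dnum f a b d c e z u v x w y = tnum f a b d c e / 2 * (t1 + t2)"
  shows "u = 0 \<and> v = 0 \<and> w = 0 \<and> x = 0 \<and> y = 0 \<and> z = 0"
proof -
  note diag = gram_diag_ddelta[where a=a and b=b and c=c and d=d and e=e and f=f
      and u=u and v=v and w=w and x=x and y=y and z=z,
      unfolded f1 f2 f3 f4 e12 e13 e14 e23 e24 e34 gram_diag_tdelta]
  then obtain t where t: "t1 = t" "t2 = t" "t3 = t" "t4 = t"
    and dd: "ddelta a f b c d e u z v w x y = tdelta a f b c d e * t"
    using D diag by (metis mult_cancel_left)
  note off = gram_off_ddelta[where a=a and b=b and c=c and d=d and e=e and f=f
      and u=u and v=v and w=w and x=x and y=y and z=z, unfolded f1 f2 f3 f4 e12 e13 e14 e23 e24 e34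
          t dd]
  have "tdelta a f b c d e * u = 0 \<and> tdelta a f b c d e * v = 0 \<and> tdelta a f b c d e * w = 0
    \<and> tdelta a f b c d e * x = 0 \<and> tdelta a f b c d e * y = 0 \<and> tdelta a f b c d e * z = 0"
    using off gram_off_tdelta[where a=a and b=b and c=c and d=d and e=e and f=f and t=t]
    by (simp add: mult.commute)
  then show ?thesis using D by simp
qed

section \<open>Positivity of the Jacobian of the dihedral angles\<close>

text \<open>At the first parameter where the form takes a nonpositive value on the unit sphere it is
  still semidefinite, by continuity from the left. A null vector of a semidefinite form lies in its
  kernel, against nondegeneracy.\<close>

lemma posdef_along_path:
  fixes q :: "real \<Rightarrow> 'v::euclidean_space \<Rightarrow> 'v"
  assumes cont: "continuous_on ({0..1} \<times> UNIV) (\<lambda>(s, y). q s y)"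
    and lin: "\<And>s. s \<in> {0..1} \<Longrightarrow> linear (q s)"
    and sym: "\<And>s y y'. s \<in> {0..1} \<Longrightarrow> y \<bullet> q s y' = y' \<bullet> q s y"
    and nondeg: "\<And>s y. s \<in> {0..1} \<Longrightarrow> q s y = 0 \<Longrightarrow> y = 0"
    and pos: "\<And>y. y \<noteq> 0 \<Longrightarrow> y \<bullet> q 0 y > 0"
    and "y \<noteq> 0"
  shows "y \<bullet> q 1 y > 0"
proof (rule ccontr)
  assume neg: "\<not> y \<bullet> q 1 y > 0"
  let ?h = "\<lambda>p. snd p \<bullet> q (fst p) (snd p)"
  let ?K = "{0..1::real} \<times> sphere (0::'v) 1"
  define Z where "Z = {p \<in> ?K. ?h p \<le> 0}"
  have ch: "continuous_on ({0..1} \<times> UNIV) ?h"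
    using cont by (intro continuous_intros) (simp add: case_prod_unfold)
  have hom: "(r *\<^sub>R y) \<bullet> q s (r *\<^sub>R y) = r\<^sup>2 * (y \<bullet> q s y)" if "s \<in> {0..1}" for r s y
    using linear_scale[OF lin[OF that]] by (simp add: power2_eq_square)
  have "closed Z"
  proof -
    have "continuous_on ?K ?h" by (rule continuous_on_subset[OF ch]) auto
    moreover have "closed ?K" by (intro closed_Times) auto
    ultimately have "closed (?K \<inter> ?h -` {..0})" by (intro continuous_closed_preimage) auto
    then show ?thesis unfolding Z_def by (simp add: vimage_def Int_def)
  qed
  then have "compact Z"
    using compact_Times[of "{0..1::real}" "sphere (0::'v) 1"] unfolding Z_def
    by (metis (no_types, lifting) compact_Icc compact_Int_closed compact_sphere inf.absorb_iff2
        inf_commute mem_Collect_eq subsetI)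
  moreover have "(1, y /\<^sub>R norm y) \<in> Z"
    using neg \<open>y \<noteq> 0\<close> hom[of 1 "inverse (norm y)" y] unfolding Z_def
    by (auto simp: mult_le_0_iff)
  moreover have "continuous_on Z fst" by (intro continuous_intros)
  ultimately obtain p where p: "p \<in> Z" and min: "\<And>p'. p' \<in> Z \<Longrightarrow> fst p \<le> fst p'"
    by (metis continuous_attains_inf empty_iff)
  obtain s y0 where [simp]: "p = (s, y0)" by fastforce
  have s: "s \<in> {0..1}" and y0: "norm y0 = 1" and le: "y0 \<bullet> q s y0 \<le> 0"
    using p by (auto simp: Z_def)
  have "s \<noteq> 0" using pos[of y0] y0 le by fastforce
  then have s0: "s > 0" using s by auto
  have unit: "y \<bullet> q s y \<ge> 0" if "norm y = 1" for y
  proof (rule tendsto_lowerbound)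
    have "((\<lambda>r. ?h (r, y)) \<longlongrightarrow> ?h (s, y)) (at s within {0..1})"
      by (rule continuous_on_tendsto_compose[OF ch, of "\<lambda>r. (r, y)"])
        (use s in \<open>auto intro!: tendsto_intros simp: eventually_at_filter\<close>)
    then have "((\<lambda>r. ?h (r, y)) \<longlongrightarrow> ?h (s, y)) (at s within {0..<s})"
      by (rule tendsto_within_subset) (use s in auto)
    then show "((\<lambda>r. y \<bullet> q r y) \<longlongrightarrow> y \<bullet> q s y) (at s within {0..<s})" by simp
    show "\<forall>\<^sub>F r in at s within {0..<s}. 0 \<le> y \<bullet> q r y"
      unfolding eventually_at_filter
      using min[of "(r, y)" for r] s that by (auto simp: Z_def not_less intro!: always_eventually)
        (metis atLeastLessThan_iff linorder_le_cases order.strict_trans1 less_le_not_le order_trans)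
    show "at s within {0..<s} \<noteq> bot"
      using s0 by (simp add: at_within_eq_bot_iff islimpt_Ico closure_def)
  qed
  have nonneg: "y \<bullet> q s y \<ge> 0" for y
  proof (cases "y = 0")
    case False
    have "y \<bullet> q s y = (norm y)\<^sup>2 * ((y /\<^sub>R norm y) \<bullet> q s (y /\<^sub>R norm y))"
      using hom[OF s, of "norm y" "y /\<^sub>R norm y"] False by simp
    then show ?thesis using unit[of "y /\<^sub>R norm y"] False by simp
  qed simp
  have zero: "y0 \<bullet> q s y0 = 0" using le nonneg[of y0] by simp
  define g where "g = q s y0"
  have "0 \<le> 2 * t * (g \<bullet> g) + t\<^sup>2 * (g \<bullet> q s g)" for t
  proof -
    have "(y0 + t *\<^sub>R g) \<bullet> q s (y0 + t *\<^sub>R g) = 2 * t * (g \<bullet> g) + t\<^sup>2 * (g \<bullet> q s g)"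
      using zero sym[OF s, of y0 g]
      by (simp add: linear_add[OF lin[OF s]] linear_scale[OF lin[OF s]] inner_add g_def
          power2_eq_square algebra_simps)
    then show ?thesis using nonneg by metis
  qed
  note * = this
  have "g \<bullet> g \<le> 0"
  proof (rule ccontr)
    assume gg: "\<not> g \<bullet> g \<le> 0"
    define B where "B = g \<bullet> q s g"
    \<comment> \<open>The quadratic polynomial has its minimum at
      \<open>- (g \<bullet> g) / B\<close>; the summand 1 keeps the denominator positive when
      \<open>B = 0\<close>, and the value at \<open>t\<close> is still negative.\<close>
    define t where "t = - (g \<bullet> g) / (B + 1)"
    have B: "B \<ge> 0" unfolding B_def by (rule nonneg)
    have "g \<bullet> g > 0" using gg by linarith
    then have "t < 0" using B unfolding t_def by (intro divide_neg_pos) auto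
    moreover have "t * B + 2 * (g \<bullet> g) = (g \<bullet> g) * (B + 2) / (B + 1)"
      using B by (simp add: t_def field_simps)
    then have "t * B > - (2 * (g \<bullet> g))"
      using \<open>g \<bullet> g > 0\<close> B by (smt (verit) divide_pos_pos mult_pos_pos)
    ultimately have "t * (2 * (g \<bullet> g) + t * B) < 0" by (simp add: mult_neg_pos)
    then show False using *[of t] by (simp add: B_def power2_eq_square algebra_simps)
  qed
  then have "g = 0" using inner_ge_zero[of g] inner_eq_zero_iff[of g] by linarith
  then show False using nondeg[OF s, of y0] y0 by (simp add: g_def)
qed

text \<open>Six-tuples are indexed by the edges 12, 13, 14, 23, 24, 34, in this order.\<close>

type_synonym six = "real \<times> real \<times> real \<times> real \<times> real \<times> real"

definition trows :: "six \<Rightarrow> six \<Rightarrow> six" where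
  "trows = (\<lambda>(a, b, c, d, e, f) (u, v, w, x, y, z).
     (erow a f b c d e u z v w x y, erow b e a c d f v y u w x z, erow c d a b e f w x u v y z,
      erow d c a e b f x w u y v z, erow e b a d c f y v u x w z, erow f a b d c e z u v x w y))"

text \<open>A set of cosines, not of lengths. One determinant stands for the six conditions on the
  cosines of the angles: \<open>abs_tphi_less_1_iff\<close> shows that each of them is equivalent to
  it.\<close>

definition hyperideal :: "six set" where
  "hyperideal = {(a, b, c, d, e, f). a > 1 \<and> b > 1 \<and> c > 1 \<and> d > 1 \<and> e > 1 \<and> f > 1 \<and>
     tdelta a f b c d e > 0}"

lemma linear_trows: "linear (trows C)"
proof -
  obtain a b c d e f where [simp]: "C = (a, b, c, d, e, f)" by (metis prod.exhaust)
  show ?thesis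
    by (rule linearI)
      (auto simp: trows_def erow_def dface_def dnum_def algebra_simps add_divide_distrib
          diff_divide_distrib)
qed

lemma trows_symmetric:
  assumes "C \<in> hyperideal"
  shows "Y \<bullet> trows C Z = Z \<bullet> trows C Y"
proof -
  obtain a b c d e f where [simp]: "C = (a, b, c, d, e, f)" by (metis prod.exhaust)
  obtain a1 a2 a3 a4 a5 a6 where [simp]: "Y = (a1, a2, a3, a4, a5, a6)" by (metis prod.exhaust)
  obtain b1 b2 b3 b4 b5 b6 where [simp]: "Z = (b1, b2, b3, b4, b5, b6)" by (metis prod.exhaust)
  have "a > 1" "b > 1" "c > 1" "d > 1" "e > 1" "f > 1"
    using assms by (auto simp: hyperideal_def)
  then show ?thesis
    by (simp add: trows_def erow_eq tface_swap tnum_swap algebra_simps add_divide_distrib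
        diff_divide_distrib)
qed

lemma dface_swap: "dface y x z v u w = dface x y z u v w" "dface x z y u w v = dface x y z u v w"
  by (simp_all add: dface_def algebra_simps)

text \<open>Take for \<open>t1, ..., t4\<close> the logarithmic differentials of the four
  \<open>tface\<close> terms. Then a vanishing row is precisely the hypothesis of
  \<open>infinitesimal_rigidity\<close> on the corresponding \<open>tnum\<close>.\<close>

lemma trows_eq_0:
  assumes "C \<in> hyperideal" and "trows C Y = 0"
  shows "Y = 0"
proof -
  obtain a b c d e f where [simp]: "C = (a, b, c, d, e, f)" by (metis prod.exhaust)
  obtain u v w x y z where [simp]: "Y = (u, v, w, x, y, z)" by (metis prod.exhaust)
  have C: "a > 1" "b > 1" "c > 1" "d > 1" "e > 1" "f > 1" and D: "tdelta a f b c d e > 0"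
    using assms(1) by (auto simp: hyperideal_def)
  have sq: "a\<^sup>2 \<noteq> 1" "b\<^sup>2 \<noteq> 1" "c\<^sup>2 \<noteq> 1" "d\<^sup>2 \<noteq> 1" "e\<^sup>2 \<noteq> 1" "f\<^sup>2 \<noteq> 1"
    using C by (simp_all add: power2_eq_1_iff)
  have P: "tface d e f > 0" "tface b c f > 0" "tface a c e > 0" "tface a b d > 0"
    using tface_pos C by (smt (verit))+
  have rows: "dnum a f b c d e u z v w x y = tnum a f b c d e / 2
      * (dface a b d u v x / tface a b d + dface a c e u w y / tface a c e)"
    if "erow a f b c d e u z v w x y = 0" "a\<^sup>2 \<noteq> 1" for a f b c d e u z v w x y
    using that by (simp add: erow_def)
  have "u = 0 \<and> v = 0 \<and> w = 0 \<and> x = 0 \<and> y = 0 \<and> z = 0"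
    by (rule infinitesimal_rigidity[of a f b c d e x y z "dface d e f x y z / tface d e f" v w
          "dface b c f v w z / tface b c f" u "dface a c e u w y / tface a c e"
          "dface a b d u v x / tface a b d"])
      (use assms(2) D P sq in \<open>simp_all add: rows trows_def zero_prod_def tface_swap dface_swap
          add.commute\<close>)
  then show ?thesis by (simp add: zero_prod_def)
qed

lemma continuous_on_erow [continuous_intros]:
  assumes "continuous_on S a" "continuous_on S b" "continuous_on S c" "continuous_on S d"
    "continuous_on S e" "continuous_on S f" "continuous_on S u" "continuous_on S v"
    "continuous_on S w" "continuous_on S x" "continuous_on S y" "continuous_on S z"
    and "\<And>p. p \<in> S \<Longrightarrow> a p > 1 \<and> b p > 1 \<and> c p > 1 \<and> d p > 1 \<and> e p > 1"
  shows "continuous_on S (\<lambda>p. erow (a p) (f p) (b p) (c p) (d p) (e p) (u p) (z p) (v p) (w p) (x p)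
      (y p))"
proof -
  have "tface (a p) (b p) (d p) \<noteq> 0" "tface (a p) (c p) (e p) \<noteq> 0" "(a p)\<^sup>2 \<noteq> 1" if "p \<in> S" for p
    using tface_pos[of "a p" "b p" "d p"] tface_pos[of "a p" "c p" "e p"] assms(13)[OF that]
    by (auto simp: power2_eq_1_iff)
  then show ?thesis
    unfolding erow_def tface_def tnum_def dface_def dnum_def
    by (intro continuous_intros assms(1-12)) auto
qed

lemma continuous_on_trows:
  "continuous_on (hyperideal \<times> UNIV) (\<lambda>(C, Y). trows C Y)"
  unfolding trows_def case_prod_unfold
  by (intro continuous_intros) (auto simp: hyperideal_def)

lemma segment_gt:
  fixes x y r t :: real
  assumes "r < x" "r < y" "t \<in> {0..1}"
  shows "r < (1 - t) * x + t * y"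
  using convex_bound_lt[of "- x" "- r" "- y" "1 - t" t] assms by simp

definition posdef_rows :: "six \<Rightarrow> bool" where
  "posdef_rows C \<longleftrightarrow> (\<forall>Y. Y \<noteq> 0 \<longrightarrow> Y \<bullet> trows C Y > 0)"

lemma posdef_rows_path:
  fixes \<gamma> :: "real \<Rightarrow> six"
  assumes "continuous_on {0..1} \<gamma>" and "\<And>s. s \<in> {0..1} \<Longrightarrow> \<gamma> s \<in> hyperideal"
    and "posdef_rows (\<gamma> 0)"
  shows "posdef_rows (\<gamma> 1)"
  unfolding posdef_rows_def
proof (intro allI impI)
  fix Y :: six assume "Y \<noteq> 0"
  show "0 < Y \<bullet> trows (\<gamma> 1) Y"
  proof (rule posdef_along_path[where q = "\<lambda>s. trows (\<gamma> s)"])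
    have "continuous_on ({0..1} \<times> UNIV) (\<lambda>p. (\<gamma> (fst p), snd p))"
      using assms(1) by (intro continuous_intros continuous_on_compose2[OF assms(1)]) auto
    then have "continuous_on ({0..1} \<times> UNIV) (\<lambda>p. (\<lambda>(C, Y). trows C Y) (\<gamma> (fst p), snd p))"
      by (rule continuous_on_compose2[OF continuous_on_trows]) (use assms(2) in auto)
    then show "continuous_on ({0..1} \<times> UNIV) (\<lambda>(s, y). trows (\<gamma> s) y)"
      by (simp add: case_prod_unfold)
    show "linear (trows (\<gamma> s))" for s by (rule linear_trows)
    show "Y \<bullet> trows (\<gamma> s) Z = Z \<bullet> trows (\<gamma> s) Y" if "s \<in> {0..1}" for s Y Z
      by (rule trows_symmetric[OF assms(2)[OF that]])
    show "Y = 0" if "s \<in> {0..1}" "trows (\<gamma> s) Y = 0" for s Y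
      using assms(2) that by (blast intro: trows_eq_0)
    show "Y \<bullet> trows (\<gamma> 0) Y > 0" if "Y \<noteq> 0" for Y
      using assms(3) that unfolding posdef_rows_def by blast
  qed fact
qed

text \<open>As a polynomial in \<open>a\<close>, \<open>tdelta\<close> is quadratic with leading
  coefficient \<open>- (f\<^sup>2 - 1)\<close>. For \<open>f > 1\<close> it is therefore concave,
  and a segment in the first coordinate with hyper-ideal ends stays hyper-ideal.\<close>

lemma tdelta_concave:
  "tdelta ((1 - t) * a + t * a') f b c d e
     = (1 - t) * tdelta a f b c d e + t * tdelta a' f b c d e + t * (1 - t) * (f\<^sup>2 - 1) * (a -
         a')\<^sup>2"
  unfolding tdelta_def by algebra

lemma posdef_rows_vertical:
  assumes "(a, b, c, d, e, f) \<in> hyperideal" "(a', b, c, d, e, f) \<in> hyperideal"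
    and "posdef_rows (a, b, c, d, e, f)"
  shows "posdef_rows (a', b, c, d, e, f)"
proof -
  let ?\<gamma> = "\<lambda>t. ((1 - t) * a + t * a', b, c, d, e, f)"
  have "posdef_rows (?\<gamma> 1)"
  proof (rule posdef_rows_path[of ?\<gamma>])
    fix t :: real assume t: "t \<in> {0..1}"
    have f: "f\<^sup>2 - 1 > 0" using assms(1) by (simp add: hyperideal_def)
    have "(1 - t) * tdelta a f b c d e + t * tdelta a' f b c d e > 0"
      using assms(1,2) by (intro segment_gt t) (auto simp: hyperideal_def)
    then have "tdelta ((1 - t) * a + t * a') f b c d e > 0"
      unfolding tdelta_concave using t f by (simp add: add_pos_nonneg)
    moreover have "(1 - t) * a + t * a' > 1"
      using assms(1,2) by (intro segment_gt t) (auto simp: hyperideal_def)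
    ultimately show "?\<gamma> t \<in> hyperideal"
      using assms(1) by (simp add: hyperideal_def)
  qed (use assms in \<open>auto intro!: continuous_intros\<close>)
  then show ?thesis by simp
qed

lemma posdef_rows_regular: "posdef_rows (2, 2, 2, 2, 2, 2)"
  unfolding posdef_rows_def
proof (intro allI impI)
  fix Y :: six assume "Y \<noteq> 0"
  obtain u v w x y z where [simp]: "Y = (u, v, w, x, y, z)" by (metis prod.exhaust)
  have "erow 2 2 2 2 2 2 u z v w x y = 8 / 3 * u + z - 2 / 3 * (v + w + x + y)" for u z v w x y
    by (simp add: erow_def dnum_def dface_def tface_def tnum_def field_simps)
  note row = this
  have "27 * (Y \<bullet> trows (2, 2, 2, 2, 2, 2) Y) = 72 * (u\<^sup>2 + v\<^sup>2 + w\<^sup>2 + x\<^sup>2 + y\<^sup>2 + z\<^sup>2)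
      + 54 * (u * z + v * y + w * x) - 36 * ((u + z) * (v + y) + (v + y) * (w + x) + (w + x) * (u +
          z))"
    by (simp add: trows_def row field_simps power2_eq_square)
  \<comment> \<open>The matrix of the form has eigenvalues 1, 5/3 and 5. The first summand splits
    off the least one, scaled by 27; the squares account for the rest.\<close>
  also have "\<dots> = 27 * (u\<^sup>2 + v\<^sup>2 + w\<^sup>2 + x\<^sup>2 + y\<^sup>2 + z\<^sup>2) + 9 * ((u - z)\<^sup>2 + (v - y)\<^sup>2 + (w - x)\<^sup>2)
      + 18 * ((u + z - v - y)\<^sup>2 + (v + y - w - x)\<^sup>2 + (w + x - u - z)\<^sup>2)"
    by (simp add: algebra_simps power2_eq_square)
  also have "\<dots> > 0"
  proof -
    have "u \<noteq> 0 \<or> v \<noteq> 0 \<or> w \<noteq> 0 \<or> x \<noteq> 0 \<or> y \<noteq> 0 \<or> z \<noteq> 0"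
      using \<open>Y \<noteq> 0\<close> by (auto simp: zero_prod_def)
    then have "u\<^sup>2 + v\<^sup>2 + w\<^sup>2 + x\<^sup>2 + y\<^sup>2 + z\<^sup>2 > 0"
      by (smt (verit) zero_le_power2 zero_less_power2)
    then show ?thesis by (smt (verit) zero_le_power2)
  qed
  finally show "0 < Y \<bullet> trows (2, 2, 2, 2, 2, 2) Y" by simp
qed

text \<open>For fixed \<open>b, c, d, e, f\<close> the admissible \<open>a\<close> form an interval whose upper end corresponds to a
  dihedral angle \<open>\<pi>\<close> at the opposite edge.  Keeping that angle constant and close to \<open>\<pi>\<close>, the other
  five parameters can be moved freely.\<close>

lemma posdef_rows_hyperideal:
  assumes "C \<in> hyperideal"
  shows "posdef_rows C"
proof -
  obtain a b c d e f where [simp]: "C = (a, b, c, d, e, f)" by (metis prod.exhaust)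
  have C: "a > 1" "b > 1" "c > 1" "d > 1" "e > 1" "f > 1" and D: "tdelta a f b c d e > 0"
    using assms by (auto simp: hyperideal_def)
  define l where "l x t = (1 - t) * 2 + t * x" for x t :: real
  have l0: "l x 0 = 2" and l1: "l x 1 = x" for x by (simp_all add: l_def)
  have l: "l x t > 1" if "x > 1" "t \<in> {0..1}" for x t
    unfolding l_def using that by (intro segment_gt) auto
  define F where "F = max 2 f"
  have lF: "l f t \<le> F" if "t \<in> {0..1}" for t
    unfolding l_def F_def using convex_bound_le[of 2 "max 2 f" f "1 - t" t] that by auto
  \<comment> \<open>\<open>- k\<close> is the cosine of the constant angle at the edge with cosine
    \<open>l f t\<close>. Both faces at that edge have \<open>tface\<close> at least
    \<open>(l f t)\<^sup>2 + 3\<close>, so this \<open>k\<close> gives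
    \<open>k * R t \<ge> (l f t)\<^sup>2 - 1\<close>, which together with \<open>N t > 0\<close>
    yields \<open>A t > 1\<close>.\<close>
  define k where "k = (F\<^sup>2 - 1) / (F\<^sup>2 + 3)"
  have F: "F \<ge> 2" by (simp add: F_def)
  then have "F\<^sup>2 > 1" by simp
  then have k: "0 < k" "k < 1" by (auto simp: k_def field_simps add_pos_nonneg)
  define N where "N = (\<lambda>t. l b t * l d t + l c t * l e t + l f t * (l b t * l e t) + l f t * (l d t
      * l c t))"
  define R where "R = (\<lambda>t. sqrt (tface (l b t) (l c t) (l f t) * tface (l d t) (l e t) (l f t)))"
  define A where "A = (\<lambda>t. (N t + k * R t) / ((l f t)\<^sup>2 - 1))"
  let ?\<gamma> = "\<lambda>t. (A t, l b t, l c t, l d t, l e t, l f t)"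
  have mem: "?\<gamma> t \<in> hyperideal" if t: "t \<in> {0..1}" for t
  proof -
    note L = l[OF C(2) t] l[OF C(3) t] l[OF C(4) t] l[OF C(5) t] l[OF C(6) t]
    have face: "tface x y (l f t) > (l f t)\<^sup>2 + 3" if "x > 1" "y > 1" for x y
    proof -
      have "x * y * l f t > 1" using that L(5) by (simp add: less_1_mult)
      moreover have "x\<^sup>2 > 1" "y\<^sup>2 > 1" using that by auto
      ultimately show ?thesis by (simp add: tface_def)
    qed
    have P: "tface (l b t) (l c t) (l f t) > (l f t)\<^sup>2 + 3" "tface (l d t) (l e t) (l f t) > (l f
        t)\<^sup>2 + 3"
      using face L by auto
    have f2: "(l f t)\<^sup>2 > 1" using L by simp
    have Rsq: "(R t)\<^sup>2 = tface (l b t) (l c t) (l f t) * tface (l d t) (l e t) (l f t)"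
      unfolding R_def using P f2 by simp
    have "R t \<ge> (l f t)\<^sup>2 + 3"
      unfolding R_def using P f2 by (intro real_le_rsqrt) (simp add: power2_eq_square mult_mono)
    moreover have "k * ((l f t)\<^sup>2 + 3) \<ge> (l f t)\<^sup>2 - 1"
    proof -
      have "(l f t)\<^sup>2 \<le> F\<^sup>2" using lF[OF t] L by (simp add: power_mono)
      then show ?thesis using \<open>F\<^sup>2 > 1\<close> by (simp add: k_def field_simps)
    qed
    ultimately have "k * R t \<ge> (l f t)\<^sup>2 - 1"
      using k by (smt (verit) mult_left_mono)
    moreover have "N t > 0" unfolding N_def using L by (intro add_pos_pos mult_pos_pos) auto
    ultimately have "A t > 1" unfolding A_def using f2 by (simp add: field_simps)
    have "tnum (l f t) (A t) (l b t) (l d t) (l c t) (l e t) = - k * R t"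
      unfolding tnum_def A_def using f2 by (simp add: N_def)
    then have "tdelta (l f t) (A t) (l b t) (l d t) (l c t) (l e t) * ((l f t)\<^sup>2 - 1) = (1 - k\<^sup>2) *
        (R t)\<^sup>2"
      using tface_mult_minus_tnum[of "l f t" "l b t" "l c t" "l d t" "l e t" "A t"] Rsq
      by (simp add: tface_swap power_mult_distrib algebra_simps)
    moreover have "(1 - k\<^sup>2) * (R t)\<^sup>2 > 0"
      using k P f2 unfolding Rsq by (intro mult_pos_pos) (auto simp: power_less_one_iff)
    ultimately have "tdelta (l f t) (A t) (l b t) (l d t) (l c t) (l e t) > 0"
      using f2 by (smt (verit) zero_less_mult_pos2)
    then show ?thesis
      using L \<open>A t > 1\<close> by (simp add: hyperideal_def tdelta_perm)
  qed
  have "continuous_on {0..1} ?\<gamma>"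
  proof -
    have "(l f t)\<^sup>2 - 1 \<noteq> 0" if "t \<in> {0..1}" for t
      using l[OF C(6) that] by (auto simp: power2_eq_1_iff)
    then show ?thesis
      unfolding A_def N_def R_def l_def tface_def by (intro continuous_intros) (auto simp: l_def)
  qed
  \<comment> \<open>At each end of the path only the first coordinate differs from the regular
    tetrahedron, respectively from \<open>C\<close>, so \<open>posdef_rows_vertical\<close> closes
    both gaps.\<close>
  moreover have "posdef_rows (?\<gamma> 0)"
    unfolding l0
    by (rule posdef_rows_vertical[OF _ _ posdef_rows_regular])
      (use mem[of 0] in \<open>auto simp: hyperideal_def l0 tdelta_def\<close>)
  ultimately have "posdef_rows (?\<gamma> 1)" by (intro posdef_rows_path[of ?\<gamma>] mem)
  then have "posdef_rows (A 1, b, c, d, e, f)" by (simp add: l1)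
  then show ?thesis
    using posdef_rows_vertical[of "A 1" b c d e f a] mem[of 1] assms by (simp add: l1)
qed

section \<open>Dihedral angles as functions of edge lengths\<close>

lemma one_minus_tphi_sq:
  assumes "a > 1" "b > 1" "c > 1" "d > 1" "e > 1"
  shows "1 - (tphi a f b c d e)\<^sup>2 = tdelta a f b c d e * (a\<^sup>2 - 1) / (tface a b d * tface a c e)"
proof -
  have P: "tface a b d > 0" "tface a c e > 0" using tface_pos assms by (smt (verit))+
  then have "1 - (tphi a f b c d e)\<^sup>2
      = (tface a b d * tface a c e - (tnum a f b c d e)\<^sup>2) / (tface a b d * tface a c e)"
    by (simp add: tphi_def power_divide power_mult_distrib diff_divide_distrib)
  then show ?thesis by (simp add: tface_mult_minus_tnum)
qed

lemma abs_tphi_less_1_iff: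
  assumes "a > 1" "b > 1" "c > 1" "d > 1" "e > 1"
  shows "\<bar>tphi a f b c d e\<bar> < 1 \<longleftrightarrow> tdelta a f b c d e > 0"
proof -
  have P: "tface a b d > 0" "tface a c e > 0" using tface_pos assms by (smt (verit))+
  have "\<bar>tphi a f b c d e\<bar> < 1 \<longleftrightarrow> 1 - (tphi a f b c d e)\<^sup>2 > 0"
    by (simp add: abs_square_less_1)
  also have "\<dots> \<longleftrightarrow> tdelta a f b c d e > 0"
  proof -
    have K: "(a\<^sup>2 - 1) / (tface a b d * tface a c e) > 0" using P assms(1) by simp
    show ?thesis
      unfolding one_minus_tphi_sq[OF assms] times_divide_eq_right[symmetric]
      using K by (metis zero_less_mult_iff not_less_iff_gr_or_eq)
  qed
  finally show ?thesis .
qed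

lemma tang_degenerate:
  assumes "a > 1" "b > 1" "c > 1" "d > 1" "e > 1" and "tdelta a f b c d e \<le> 0"
  shows "tang a f b c d e \<in> {0, pi}"
proof -
  have "\<not> \<bar>tphi a f b c d e\<bar> < 1" using abs_tphi_less_1_iff assms by (metis not_less)
  then consider "tphi a f b c d e \<ge> 1" | "tphi a f b c d e \<le> - 1" by linarith
  then show ?thesis
    by cases (simp_all add: tang_def max_def min_def)
qed

lemma DERIV_arccos_clamp:
  assumes "\<bar>x\<bar> < 1"
  shows "((\<lambda>x. arccos (max (- 1) (min x 1))) has_real_derivative - inverse (sqrt (1 - x\<^sup>2))) (at x)"
proof (rule has_field_derivative_transform_within_open)
  show "(arccos has_real_derivative - inverse (sqrt (1 - x\<^sup>2))) (at x)"
    using DERIV_arccos[of x] assms by (simp add: inverse_minus_eq)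
  show "x \<in> {-1<..<1}" using assms by auto
qed auto

text \<open>The normalisation of \<open>erow\<close> aims at this form. The factor
  \<open>1 / sqrt tdelta\<close> is common to all six angles, and
  \<open>sqrt (a\<^sup>2 - 1)\<close> is the hyperbolic sine of the edge length. In the lengths the
  Jacobian is thus a positive multiple of \<open>trows\<close> conjugated on both sides by the
  diagonal matrix of the sines, and it inherits positivity.\<close>

lemma DERIV_tang:
  assumes d: "(a has_real_derivative u) (at s within S)" "(f has_real_derivative z) (at s within S)"
    "(b has_real_derivative v) (at s within S)" "(c has_real_derivative w) (at s within S)"
    "(d has_real_derivative x) (at s within S)" "(e has_real_derivative y) (at s within S)"
    and g: "a s > 1" "b s > 1" "c s > 1" "d s > 1" "e s > 1"
    and D: "tdelta (a s) (f s) (b s) (c s) (d s) (e s) > 0"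
  shows "((\<lambda>s. tang (a s) (f s) (b s) (c s) (d s) (e s)) has_real_derivative
    sqrt ((a s)\<^sup>2 - 1) * erow (a s) (f s) (b s) (c s) (d s) (e s) u z v w x y
      / sqrt (tdelta (a s) (f s) (b s) (c s) (d s) (e s))) (at s within S)"
proof -
  define P where "P = tface (a s) (b s) (d s)"
  define R where "R = tface (a s) (c s) (e s)"
  define n where "n = tnum (a s) (f s) (b s) (c s) (d s) (e s)"
  define dP where "dP = dface (a s) (b s) (d s) u v x"
  define dR where "dR = dface (a s) (c s) (e s) u w y"
  define dn where "dn = dnum (a s) (f s) (b s) (c s) (d s) (e s) u z v w x y"
  define E where "E = erow (a s) (f s) (b s) (c s) (d s) (e s) u z v w x y"
  define D where "D = tdelta (a s) (f s) (b s) (c s) (d s) (e s)"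
  define p where "p = tphi (a s) (f s) (b s) (c s) (d s) (e s)"
  have P: "P > 0" "R > 0" unfolding P_def R_def using tface_pos g by (smt (verit))+
  have A: "(a s)\<^sup>2 - 1 > 0" using g by simp
  have D0: "D > 0" using D by (simp add: D_def)
  have 1: "((\<lambda>s. tface (a s) (b s) (d s)) has_real_derivative dP) (at s within S)"
    "((\<lambda>s. tface (a s) (c s) (e s)) has_real_derivative dR) (at s within S)"
    unfolding tface_def dP_def dR_def dface_def
    by (auto intro!: derivative_eq_intros d simp: algebra_simps)
  have 2: "((\<lambda>s. tnum (a s) (f s) (b s) (c s) (d s) (e s)) has_real_derivative dn) (at s within S)"
    unfolding tnum_def dn_def dnum_def
    by (auto intro!: derivative_eq_intros d simp: algebra_simps)
  have sq: "((\<lambda>s. sqrt (tface (a s) (b s) (d s))) has_real_derivative dP / (2 * sqrt P)) (at s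
      within S)"
    "((\<lambda>s. sqrt (tface (a s) (c s) (e s))) has_real_derivative dR / (2 * sqrt R)) (at s within S)"
    using P unfolding P_def R_def
    by (auto intro!: derivative_eq_intros 1 simp: field_simps)
  have 3: "((\<lambda>s. tphi (a s) (f s) (b s) (c s) (d s) (e s)) has_real_derivative
      (dn - n / 2 * (dP / P + dR / R)) / (sqrt P * sqrt R)) (at s within S)"
    unfolding tphi_def
  proof (rule DERIV_cong[OF DERIV_divide[OF 2 DERIV_mult[OF sq]]])
    have sP: "sqrt P > 0" "sqrt R > 0" "sqrt P * sqrt P = P" "sqrt R * sqrt R = R" using P by auto
    show "(dn * (sqrt (tface (a s) (b s) (d s)) * sqrt (tface (a s) (c s) (e s)))
        - tnum (a s) (f s) (b s) (c s) (d s) (e s)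
          * (dP / (2 * sqrt P) * sqrt (tface (a s) (c s) (e s))
             + dR / (2 * sqrt R) * sqrt (tface (a s) (b s) (d s))))
        / ((sqrt (tface (a s) (b s) (d s)) * sqrt (tface (a s) (c s) (e s)))
          * (sqrt (tface (a s) (b s) (d s)) * sqrt (tface (a s) (c s) (e s))))
        = (dn - n / 2 * (dP / P + dR / R)) / (sqrt P * sqrt R)"
      unfolding P_def[symmetric] R_def[symmetric] n_def[symmetric]
      apply (subst (2 4) sP(3,4)[symmetric])
      using sP by (simp add: field_simps)
  qed (use P in \<open>simp_all add: P_def R_def\<close>)
  have "\<bar>p\<bar> < 1" unfolding p_def using abs_tphi_less_1_iff[OF g] D by blast
  then have 4: "((\<lambda>s. tang (a s) (f s) (b s) (c s) (d s) (e s)) has_real_derivative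
      - inverse (sqrt (1 - p\<^sup>2)) * ((dn - n / 2 * (dP / P + dR / R)) / (sqrt P * sqrt R))) (at s
          within S)"
    unfolding tang_def p_def by (rule DERIV_chain2[OF DERIV_arccos_clamp 3])
  have eq1: "sqrt (1 - p\<^sup>2) = sqrt D * sqrt ((a s)\<^sup>2 - 1) / (sqrt P * sqrt R)"
    unfolding p_def one_minus_tphi_sq[OF g]
    by (simp add: D_def P_def R_def real_sqrt_mult real_sqrt_divide)
  have eq2: "dn - n / 2 * (dP / P + dR / R) = - ((a s)\<^sup>2 - 1) * E"
  proof -
    have "((a s)\<^sup>2 - 1) * E = n / 2 * (dP / P + dR / R) - dn"
      unfolding E_def erow_def using A by (simp add: dn_def n_def dP_def P_def dR_def R_def)
    then show ?thesis by (simp add: algebra_simps)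
  qed
  have "- inverse (sqrt (1 - p\<^sup>2)) * ((dn - n / 2 * (dP / P + dR / R)) / (sqrt P * sqrt R))
      = ((a s)\<^sup>2 - 1) / sqrt ((a s)\<^sup>2 - 1) * E / sqrt D"
    unfolding eq1 eq2 using P D0 A by (simp add: field_simps)
  also have "((a s)\<^sup>2 - 1) / sqrt ((a s)\<^sup>2 - 1) = sqrt ((a s)\<^sup>2 - 1)"
    using A real_div_sqrt by simp
  finally show ?thesis using 4 by (simp add: E_def D_def)
qed

lemma continuous_on_tang [continuous_intros]:
  assumes "continuous_on S a" "continuous_on S b" "continuous_on S c" "continuous_on S d"
    "continuous_on S e" "continuous_on S f"
    and "\<And>p. p \<in> S \<Longrightarrow> a p > 1 \<and> b p > 1 \<and> c p > 1 \<and> d p > 1 \<and> e p > 1"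
  shows "continuous_on S (\<lambda>p. tang (a p) (f p) (b p) (c p) (d p) (e p))"
proof -
  have "tface (a p) (b p) (d p) > 0" "tface (a p) (c p) (e p) > 0" if "p \<in> S" for p
    using tface_pos[of "a p" "b p" "d p"] tface_pos[of "a p" "c p" "e p"] assms(7)[OF that]
    by auto
  then have "continuous_on S (\<lambda>p. tphi (a p) (f p) (b p) (c p) (d p) (e p))"
    unfolding tphi_def tface_def tnum_def
    by (intro continuous_intros assms(1-6)) (force simp: tface_def)+
  then have "continuous_on S (\<lambda>p. max (- 1) (min (tphi (a p) (f p) (b p) (c p) (d p) (e p)) 1))"
    by (intro continuous_intros)
  then show ?thesis
    unfolding tang_def by (rule continuous_on_arccos) auto
qed

section \<open>The six dihedral angles as a map of the six edge lengths\<close>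

definition sixmap :: "(real \<Rightarrow> real) \<Rightarrow> six \<Rightarrow> six" where
  "sixmap g = (\<lambda>(a, b, c, d, e, f). (g a, g b, g c, g d, g e, g f))"

definition sixmult :: "six \<Rightarrow> six \<Rightarrow> six" where
  "sixmult = (\<lambda>(a, b, c, d, e, f) (u, v, w, x, y, z). (a * u, b * v, c * w, d * x, e * y, f * z))"

definition sixdelta :: "six \<Rightarrow> real" where
  "sixdelta = (\<lambda>(a, b, c, d, e, f). tdelta a f b c d e)"

definition sixpos :: "six set" where
  "sixpos = {0<..} \<times> {0<..} \<times> {0<..} \<times> {0<..} \<times> {0<..} \<times> {0<..}"

definition tangs :: "six \<Rightarrow> six" where
  "tangs = (\<lambda>(a, b, c, d, e, f). (tang a f b c d e, tang b e a c d f, tang c d a b e f,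
     tang d c a e b f, tang e b a d c f, tang f a b d c e))"

definition angles :: "six \<Rightarrow> six" where
  "angles l = tangs (sixmap cosh l)"

definition dangles :: "six \<Rightarrow> six \<Rightarrow> six" where
  "dangles l v = (1 / sqrt (sixdelta (sixmap cosh l))) *\<^sub>R
     sixmult (sixmap sinh l) (trows (sixmap cosh l) (sixmult (sixmap sinh l) v))"

lemma cosh_real_gt_1: "cosh x > 1" if "x > 0" for x :: real
  using cosh_real_strict_mono[of 0 x] that by simp

lemma sixpos_hyperideal:
  assumes "l \<in> sixpos" and "sixdelta (sixmap cosh l) > 0"
  shows "sixmap cosh l \<in> hyperideal"
  using assms by (auto simp: sixpos_def sixmap_def sixdelta_def hyperideal_def cosh_real_gt_1)

lemma convex_sixpos: "convex sixpos"
  unfolding sixpos_def by (intro convex_Times convex_real_interval)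

lemma continuous_on_angles: "continuous_on sixpos angles"
  unfolding angles_def tangs_def sixmap_def case_prod_unfold
  by (simp, intro continuous_intros) (auto simp: sixpos_def cosh_real_gt_1)

lemma angles_degenerate:
  assumes "l \<in> sixpos" and "sixdelta (sixmap cosh l) \<le> 0"
  shows "angles l \<in> {0, pi} \<times> {0, pi} \<times> {0, pi} \<times> {0, pi} \<times> {0, pi} \<times> {0, pi}"
proof -
  obtain a b c d e f where l: "l = (a, b, c, d, e, f)" by (metis prod.exhaust)
  have g: "cosh a > 1" "cosh b > 1" "cosh c > 1" "cosh d > 1" "cosh e > 1" "cosh f > 1"
    using assms(1) by (auto simp: sixpos_def l cosh_real_gt_1)
  have D: "tdelta (cosh a) (cosh f) (cosh b) (cosh c) (cosh d) (cosh e) \<le> 0"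
    using assms(2) by (simp add: sixdelta_def sixmap_def l)
  show ?thesis
    using tang_degenerate[OF g(1-5) D]
      tang_degenerate[OF g(2,1,3,4,6) D[folded tdelta_perm(1)[of "cosh b" "cosh e" "cosh a"]]]
      tang_degenerate[OF g(3,1,2,5,6) D[folded tdelta_perm(2)[of "cosh c" "cosh d" "cosh a"]]]
      tang_degenerate[OF g(4,1,5,2,6) D[folded tdelta_perm(3)[of "cosh d" "cosh c" "cosh a"]]]
      tang_degenerate[OF g(5,1,4,3,6) D[folded tdelta_perm(4)[of "cosh e" "cosh b" "cosh a"]]]
      tang_degenerate[OF g(6,2,4,3,5) D[folded tdelta_perm(5)[of "cosh f" "cosh a" "cosh b"]]]
    unfolding l angles_def tangs_def sixmap_def prod.case mem_Sigma_iff by (intro conjI)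
qed

lemma has_vector_derivative_angles:
  assumes "l + s *\<^sub>R v \<in> sixpos" and "sixdelta (sixmap cosh (l + s *\<^sub>R v)) > 0"
  shows "((\<lambda>s. angles (l + s *\<^sub>R v)) has_vector_derivative dangles (l + s *\<^sub>R v) v) (at s within S)"
proof -
  obtain a b c d e f where l: "l = (a, b, c, d, e, f)" by (metis prod.exhaust)
  obtain a' b' c' d' e' f' where v: "v = (a', b', c', d', e', f')" by (metis prod.exhaust)
  have cosh': "((\<lambda>s. cosh (x + s * x')) has_real_derivative sinh (x + s * x') * x') (at s within S)"
      for x x'
    by (auto intro!: derivative_eq_intros)
  have sinh: "sqrt ((cosh x)\<^sup>2 - 1) = sinh x" if "x > 0" for x :: real
    using that by (simp add: cosh_square_eq)
  have ang: "((\<lambda>s. tang (cosh (x1 + s * y1)) (cosh (x6 + s * y6)) (cosh (x2 + s * y2)) (cosh (x3 + s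
      * y3))
      (cosh (x4 + s * y4)) (cosh (x5 + s * y5))) has_vector_derivative
      1 / sqrt D * (sinh (x1 + s * y1) *
      erow (cosh (x1 + s * y1)) (cosh (x6 + s * y6)) (cosh (x2 + s * y2)) (cosh (x3 + s * y3))
        (cosh (x4 + s * y4)) (cosh (x5 + s * y5))
        (sinh (x1 + s * y1) * y1) (sinh (x6 + s * y6) * y6) (sinh (x2 + s * y2) * y2)
        (sinh (x3 + s * y3) * y3) (sinh (x4 + s * y4) * y4) (sinh (x5 + s * y5) * y5)))
      (at s within S)"
    if "x1 + s * y1 > 0" "x2 + s * y2 > 0" "x3 + s * y3 > 0" "x4 + s * y4 > 0" "x5 + s * y5 > 0"
      and D: "tdelta (cosh (x1 + s * y1)) (cosh (x6 + s * y6)) (cosh (x2 + s * y2)) (cosh (x3 + s *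
          y3))
        (cosh (x4 + s * y4)) (cosh (x5 + s * y5)) = D" "D > 0"
    for x1 y1 x2 y2 x3 y3 x4 y4 x5 y5 x6 y6 D
    using DERIV_tang[OF cosh'[of x1 y1] cosh'[of x6 y6] cosh'[of x2 y2] cosh'[of x3 y3] cosh'[of x4
        y4]
        cosh'[of x5 y5]] that(1-5) D
    by (simp add: cosh_real_gt_1 sinh has_real_derivative_iff_has_vector_derivative)
  define D where "D = tdelta (cosh (a + s * a')) (cosh (f + s * f')) (cosh (b + s * b'))
    (cosh (c + s * c')) (cosh (d + s * d')) (cosh (e + s * e'))"
  have pos: "a + s * a' > 0" "b + s * b' > 0" "c + s * c' > 0" "d + s * d' > 0" "e + s * e' > 0" "f
      + s * f' > 0"
    using assms(1) by (auto simp: sixpos_def l v)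
  have perm: "tdelta (cosh (b + s * b')) (cosh (e + s * e')) (cosh (a + s * a'))
      (cosh (c + s * c')) (cosh (d + s * d')) (cosh (f + s * f')) = D"
    "tdelta (cosh (c + s * c')) (cosh (d + s * d')) (cosh (a + s * a'))
      (cosh (b + s * b')) (cosh (e + s * e')) (cosh (f + s * f')) = D"
    "tdelta (cosh (d + s * d')) (cosh (c + s * c')) (cosh (a + s * a'))
      (cosh (e + s * e')) (cosh (b + s * b')) (cosh (f + s * f')) = D"
    "tdelta (cosh (e + s * e')) (cosh (b + s * b')) (cosh (a + s * a'))
      (cosh (d + s * d')) (cosh (c + s * c')) (cosh (f + s * f')) = D"
    "tdelta (cosh (f + s * f')) (cosh (a + s * a')) (cosh (b + s * b'))
      (cosh (d + s * d')) (cosh (c + s * c')) (cosh (e + s * e')) = D"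
    unfolding D_def by (rule tdelta_perm)+
  have D: "D > 0" using assms(2) by (simp add: D_def sixdelta_def sixmap_def l v)
  note der = ang[of a a' b b' c c' d d' e e' f f', OF pos(1-5) D_def[symmetric] D]
    ang[of b b' a a' c c' d d' f f' e e', OF pos(2,1,3,4,6) perm(1) D]
    ang[of c c' a a' b b' e e' f f' d d', OF pos(3,1,2,5,6) perm(2) D]
    ang[of d d' a a' e e' b b' f f' c c', OF pos(4,1,5,2,6) perm(3) D]
    ang[of e e' a a' d d' c c' f f' b b', OF pos(5,1,4,3,6) perm(4) D]
    ang[of f f' b b' d d' c c' e e' a a', OF pos(6,2,4,3,5) perm(5) D]
  have "(\<lambda>s. angles (l + s *\<^sub>R v)) = (\<lambda>s. (
      tang (cosh (a + s * a')) (cosh (f + s * f')) (cosh (b + s * b')) (cosh (c + s * c')) (cosh (d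
          + s * d')) (cosh (e + s * e')),
      tang (cosh (b + s * b')) (cosh (e + s * e')) (cosh (a + s * a')) (cosh (c + s * c')) (cosh (d
          + s * d')) (cosh (f + s * f')),
      tang (cosh (c + s * c')) (cosh (d + s * d')) (cosh (a + s * a')) (cosh (b + s * b')) (cosh (e
          + s * e')) (cosh (f + s * f')),
      tang (cosh (d + s * d')) (cosh (c + s * c')) (cosh (a + s * a')) (cosh (e + s * e')) (cosh (b
          + s * b')) (cosh (f + s * f')),
      tang (cosh (e + s * e')) (cosh (b + s * b')) (cosh (a + s * a')) (cosh (d + s * d')) (cosh (c
          + s * c')) (cosh (f + s * f')),
      tang (cosh (f + s * f')) (cosh (a + s * a')) (cosh (b + s * b')) (cosh (d + s * d')) (cosh (c
          + s * c')) (cosh (e + s * e'))))"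
    by (simp add: angles_def tangs_def sixmap_def l v)
  moreover have "sixdelta (sixmap cosh (l + s *\<^sub>R v)) = D"
    by (simp add: D_def sixdelta_def sixmap_def l v)
  ultimately show ?thesis
    unfolding dangles_def
    using has_vector_derivative_Pair[OF der(1) has_vector_derivative_Pair[OF der(2)
      has_vector_derivative_Pair[OF der(3) has_vector_derivative_Pair[OF der(4)
      has_vector_derivative_Pair[OF der(5,6)]]]]]
    by (simp add: trows_def sixmult_def sixmap_def l v)
qed

lemma inner_sixmult: "sixmult a b \<bullet> c = b \<bullet> sixmult a c"
  by (auto simp: sixmult_def split: prod.split)

lemma sixmult_eq_0:
  assumes "l \<in> sixpos" and "sixmult (sixmap sinh l) v = 0"
  shows "v = 0"
  using assms by (auto simp: sixmult_def sixmap_def sixpos_def zero_prod_def split: prod.splits)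

lemma inner_dangles_pos:
  assumes "l \<in> sixpos" and "sixdelta (sixmap cosh l) > 0" and "v \<noteq> 0"
  shows "v \<bullet> dangles l v > 0"
proof -
  let ?Y = "sixmult (sixmap sinh l) v"
  have "?Y \<noteq> 0" using sixmult_eq_0 assms by blast
  then have "?Y \<bullet> trows (sixmap cosh l) ?Y > 0"
    using posdef_rows_hyperideal[OF sixpos_hyperideal[OF assms(1,2)]] unfolding posdef_rows_def by
        blast
  then show ?thesis
    using assms(2) unfolding dangles_def by (simp add: inner_sixmult)
qed

lemma dangles_scaleR: "dangles l (r *\<^sub>R v) = r *\<^sub>R dangles l v"
proof -
  have 1: "sixmult a (r *\<^sub>R v) = r *\<^sub>R sixmult a v" for a v
    by (auto simp: sixmult_def split: prod.split)
  show ?thesis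
    unfolding dangles_def 1 linear_scale[OF linear_trows] by simp
qed

lemma continuous_on_dangles:
  "continuous_on ({l \<in> sixpos. sixdelta (sixmap cosh l) > 0} \<times> UNIV) (\<lambda>(l, v). dangles l v)"
proof -
  let ?S = "{l \<in> sixpos. sixdelta (sixmap cosh l) > 0} \<times> (UNIV :: six set)"
  have mult: "continuous_on S (\<lambda>p. sixmult (f p) (g p))" if "continuous_on S f" "continuous_on S g"
    for S :: "(six \<times> six) set" and f g
    unfolding sixmult_def case_prod_unfold using that by (intro continuous_intros)
  have "continuous_on ?S (\<lambda>p. sixmap cosh (fst p))" "continuous_on ?S (\<lambda>p. sixmap sinh (fst p))"
    unfolding sixmap_def case_prod_unfold by (intro continuous_intros)+
  note C = this
  have "continuous_on ?S (\<lambda>p. sixdelta (sixmap cosh (fst p)))"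
    unfolding sixdelta_def tdelta_def sixmap_def case_prod_unfold by (simp, intro continuous_intros)
  moreover have "continuous_on ?S (\<lambda>p. (\<lambda>(C, Y). trows C Y) (sixmap cosh (fst p), sixmult (sixmap
      sinh (fst p)) (snd p)))"
    by (rule continuous_on_compose2[OF continuous_on_trows])
      (use C in \<open>auto intro!: continuous_intros mult simp: sixpos_hyperideal\<close>)
  ultimately show ?thesis
    unfolding dangles_def case_prod_unfold using C by (intro continuous_intros mult) auto
qed

text \<open>Both estimates are homogeneous in \<open>v\<close>, so they reduce to extrema over the
  compact product of \<open>K\<close> with the unit sphere, where \<open>inner_dangles_pos\<close>
  makes the minimum positive.\<close>

lemma compact_dangles_bounds:
  assumes "compact K" and "K \<subseteq> {l \<in> sixpos. sixdelta (sixmap cosh l) > 0}"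
  shows "\<exists>m>0. \<exists>B>0. \<forall>l\<in>K. \<forall>v. m * (norm v)\<^sup>2 \<le> v \<bullet> dangles l v \<and> norm (dangles l v) \<le> B * norm v"
proof (cases "K = {}")
  case True
  then show ?thesis using zero_less_one by blast
next
  case False
  let ?T = "K \<times> sphere (0 :: six) 1"
  have T: "compact ?T" using assms(1) by (intro compact_Times) auto
  obtain i :: six where "i \<in> Basis" by (meson nonempty_Basis ex_in_conv)
  then have "?T \<noteq> {}" using False by (auto simp: intro!: exI[of _ i])
  note T = T this
  have c: "continuous_on ?T (\<lambda>p. dangles (fst p) (snd p))"
    using continuous_on_subset[OF continuous_on_dangles, of ?T] assms(2) by (auto simp:
        case_prod_unfold)
  have "\<exists>p\<in>?T. \<forall>q\<in>?T. snd p \<bullet> dangles (fst p) (snd p) \<le> snd q \<bullet> dangles (fst q) (snd q)"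
    by (rule continuous_attains_inf[OF T]) (intro continuous_intros c)
  then obtain p where p: "p \<in> ?T"
    "\<And>q. q \<in> ?T \<Longrightarrow> snd p \<bullet> dangles (fst p) (snd p) \<le> snd q \<bullet> dangles (fst q) (snd q)" by blast
  have "\<exists>r\<in>?T. \<forall>q\<in>?T. norm (dangles (fst q) (snd q)) \<le> norm (dangles (fst r) (snd r))"
    by (rule continuous_attains_sup[OF T]) (intro continuous_intros c)
  then obtain r where r: "\<And>q. q \<in> ?T \<Longrightarrow> norm (dangles (fst q) (snd q)) \<le> norm (dangles (fst r) (snd
      r))"
    by blast
  define m where "m = snd p \<bullet> dangles (fst p) (snd p)"
  define B where "B = norm (dangles (fst r) (snd r)) + 1"
  have zero: "dangles l 0 = 0" for l using dangles_scaleR[of l 0 0] by simp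
  have "m > 0" unfolding m_def using p(1) assms(2) by (intro inner_dangles_pos) auto
  moreover have "B > 0" by (simp add: B_def add_nonneg_pos)
  moreover have "v \<bullet> dangles l v \<ge> m * (norm v)\<^sup>2" if "l \<in> K" for l v
    proof (cases "v = 0")
      case False
      have "m \<le> (v /\<^sub>R norm v) \<bullet> dangles l (v /\<^sub>R norm v)"
        using p(2)[of "(l, v /\<^sub>R norm v)"] that False by (simp add: m_def)
      then show ?thesis
        using False by (simp add: dangles_scaleR divide_simps power2_eq_square)
    qed (simp add: zero)
  moreover have "norm (dangles l v) \<le> B * norm v" if "l \<in> K" for l v
    proof (cases "v = 0")
      case False
      have "norm (dangles l (v /\<^sub>R norm v)) \<le> B"
        using r[of "(l, v /\<^sub>R norm v)"] that False by (simp add: B_def)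
      then show ?thesis
        using False by (simp add: dangles_scaleR divide_simps)
    qed (simp add: zero)
  ultimately show ?thesis by blast
qed

text \<open>Take \<open>y\<close> between \<open>g b\<close> and \<open>g a\<close> outside the finite set of values off \<open>U\<close>; the last point
  where \<open>g\<close> is at least \<open>y\<close> lies in \<open>U\<close>, where \<open>g\<close> increases.\<close>

lemma nondecreasing_if_deriv_pos_off_finite_range:
  fixes g :: "real \<Rightarrow> real"
  assumes cont: "continuous_on {a..b} g" and fin: "finite (g ` ({a..b} - U))" and "a \<le> b"
    and der: "\<And>x. x \<in> U \<Longrightarrow> x \<in> {a..b} \<Longrightarrow> \<exists>d>0. (g has_real_derivative d) (at x within {a..b})"
  shows "g a \<le> g b"
proof (rule ccontr)
  assume "\<not> g a \<le> g b"
  then have "infinite {g b<..<g a}" by simp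
  then obtain y where "y \<in> {g b<..<g a}" and y3: "y \<notin> g ` ({a..b} - U)"
    using finite_subset[OF subsetI fin] by metis
  then have y: "g b < y" "y < g a" by auto
  define S where "S = {x \<in> {a..b}. y \<le> g x}"
  have S: "S = {a..b} \<inter> g -` {y..}" by (auto simp: S_def)
  have "closed S" unfolding S using cont by (intro continuous_closed_preimage) auto
  then have "compact ({a..b} \<inter> S)" by (intro compact_Int_closed) auto
  moreover have "{a..b} \<inter> S = S" by (auto simp: S_def)
  ultimately have "compact S" by simp
  moreover have "a \<in> S" using y \<open>a \<le> b\<close> by (simp add: S_def)
  ultimately have "\<exists>x\<in>S. \<forall>x'\<in>S. x' \<le> x" by (intro compact_attains_sup) auto
  then obtain x where x: "x \<in> S" "\<And>x'. x' \<in> S \<Longrightarrow> x' \<le> x" by blast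
  have "x < b" using x(1) y by (cases "x = b") (auto simp: S_def)
  have xab: "x \<in> {a..b}" and "y \<le> g x" using x(1) by (auto simp: S_def)
  have "g x = y"
  proof (rule ccontr)
    assume "g x \<noteq> y"
    then have "y < g x" using \<open>y \<le> g x\<close> by simp
    have "continuous_on {x..b} g" by (rule continuous_on_subset[OF cont]) (use xab in auto)
    then obtain x' where "x \<le> x'" "x' \<le> b" "g x' = y"
      using IVT2'[of g b y x] y(1) \<open>x < b\<close> \<open>y < g x\<close> by auto
    then show False using x(2)[of x'] xab \<open>g x \<noteq> y\<close> by (auto simp: S_def)
  qed
  then have "x \<in> U" using y3 xab by blast
  then obtain d where d: "d > 0" "(g has_real_derivative d) (at x within {a..b})" using der xab by
      blast
  then obtain e where e: "e > 0" "\<And>h. h > 0 \<Longrightarrow> x + h \<in> {a..b} \<Longrightarrow> h < e \<Longrightarrow> g x < g (x + h)"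
    using has_real_derivative_pos_inc_right[OF d(2,1)] by blast
  define h where "h = min (e / 2) (b - x)"
  have "h > 0" "h < e" "x + h \<in> {a..b}"
    using e(1) \<open>x < b\<close> xab by (auto simp: h_def min_def)
  then have "g x < g (x + h)" using e(2) by blast
  then show False using x(2)[of "x + h"] \<open>g x = y\<close> \<open>x + h \<in> {a..b}\<close> \<open>h > 0\<close> by (auto simp: S_def)
qed

text \<open>Along the segment the pairing of \<open>v = l' - l\<close> with the angles has positive
  derivative at hyper-ideal parameters, and takes at most 64 values at the others, each angle being
  0 or \<pi> there. This covers segments that cross the boundary infinitely often.\<close>

lemma angles_monotone:
  assumes "l \<in> sixpos" "l' \<in> sixpos"
  shows "(l' - l) \<bullet> angles l \<le> (l' - l) \<bullet> angles l'"
proof (cases "l = l'")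
  case False
  define v where "v = l' - l"
  have "v \<noteq> 0" using False by (simp add: v_def)
  define g where "g s = v \<bullet> angles (l + s *\<^sub>R v)" for s :: real
  define U where "U = {s. sixdelta (sixmap cosh (l + s *\<^sub>R v)) > 0}"
  have pos: "l + s *\<^sub>R v \<in> sixpos" if "s \<in> {0..1}" for s
    using convexD_alt[OF convex_sixpos assms, of s] that by (simp add: v_def algebra_simps)
  have "g 0 \<le> g 1"
  proof (rule nondecreasing_if_deriv_pos_off_finite_range[where g = g and U = U])
    show "continuous_on {0..1} g"
      unfolding g_def
    proof (intro continuous_on_inner continuous_on_const)
      show "continuous_on {0..1} (\<lambda>s. angles (l + s *\<^sub>R v))"
      proof (rule continuous_on_compose2[OF continuous_on_angles])
        show "continuous_on {0..1} (\<lambda>s. l + s *\<^sub>R v)" by (intro continuous_intros)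
        show "(\<lambda>s. l + s *\<^sub>R v) ` {0..1} \<subseteq> sixpos" by (rule image_subsetI) (rule pos)
      qed
    qed
    have "g ` ({0..1} - U) \<subseteq> (\<lambda>x. v \<bullet> x) ` ({0, pi} \<times> {0, pi} \<times> {0, pi} \<times> {0, pi} \<times> {0, pi} \<times> {0,
        pi})"
    proof (rule image_subsetI)
      fix s assume "s \<in> {0..1} - U"
      then have "angles (l + s *\<^sub>R v) \<in> {0, pi} \<times> {0, pi} \<times> {0, pi} \<times> {0, pi} \<times> {0, pi} \<times> {0, pi}"
        by (intro angles_degenerate pos) (simp_all add: U_def)
      then show "g s \<in> (\<lambda>x. v \<bullet> x) ` ({0, pi} \<times> {0, pi} \<times> {0, pi} \<times> {0, pi} \<times> {0, pi} \<times> {0, pi})"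
        unfolding g_def by (rule imageI)
    qed
    then show "finite (g ` ({0..1} - U))"
      by (rule finite_subset) (intro finite_imageI finite_cartesian_product, auto)
    fix s assume s: "s \<in> U" "s \<in> {0..1}"
    have "(g has_real_derivative v \<bullet> dangles (l + s *\<^sub>R v) v) (at s within {0..1})"
      unfolding g_def has_real_derivative_iff_has_vector_derivative
      by (rule bounded_linear.has_vector_derivative[OF bounded_linear_inner_right
          has_vector_derivative_angles])
        (use pos s in \<open>auto simp: U_def\<close>)
    moreover have "v \<bullet> dangles (l + s *\<^sub>R v) v > 0"
      using inner_dangles_pos pos s \<open>v \<noteq> 0\<close> by (auto simp: U_def)
    ultimately show "\<exists>d>0. (g has_real_derivative d) (at s within {0..1})" by blast
  qed simp
  then show ?thesis by (simp add: g_def v_def)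
qed simp

text \<open>On the initial part of the segment, of length at least \<open>r\<close>, the derivative is bounded below;
  along the rest monotonicity suffices.\<close>

lemma angles_strongly_monotone:
  assumes "compact K" and "K \<subseteq> {l \<in> sixpos. sixdelta (sixmap cosh l) > 0}"
    and "r > 0" and "R > 0"
  shows "\<exists>k>0. \<forall>l l'. cball l r \<inter> sixpos \<subseteq> K \<and> l \<in> sixpos \<and> l' \<in> sixpos \<and> norm (l' - l) \<le> R \<longrightarrow>
    k * (norm (l' - l))\<^sup>2 \<le> (l' - l) \<bullet> (angles l' - angles l)"
proof -
  obtain m where m: "m > 0" and mv: "\<And>l v. l \<in> K \<Longrightarrow> v \<bullet> dangles l v \<ge> m * (norm v)\<^sup>2"
    using compact_dangles_bounds[OF assms(1,2)] by blast
  \<comment> \<open>Since \<open>t * R \<le> r\<close>, the points with parameter at most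
    \<open>t\<close> stay within distance \<open>r\<close> of \<open>l\<close>, hence in
    \<open>K\<close>.\<close>
  define t where "t = min 1 (r / R)"
  have t: "0 < t" "t \<le> 1" "t * R \<le> r" using assms(3,4) by (auto simp: t_def min_def field_simps)
  show ?thesis
  proof (intro exI[of _ "m * t"] conjI allI impI)
    show "m * t > 0" using m t(1) by simp
    fix l l' :: six
    assume "cball l r \<inter> sixpos \<subseteq> K \<and> l \<in> sixpos \<and> l' \<in> sixpos \<and> norm (l' - l) \<le> R"
    then have l: "cball l r \<inter> sixpos \<subseteq> K" "l \<in> sixpos" "l' \<in> sixpos" "norm (l' - l) \<le> R"
      by blast+
    define v where "v = l' - l"
    define g where "g s = v \<bullet> angles (l + s *\<^sub>R v)" for s :: real
    have pos: "l + s *\<^sub>R v \<in> sixpos" if "s \<in> {0..1}" for s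
      using convexD_alt[OF convex_sixpos l(2,3), of s] that by (simp add: v_def algebra_simps)
    have K: "l + s *\<^sub>R v \<in> K" if "s \<in> {0..t}" for s
    proof -
      have "norm (s *\<^sub>R v) \<le> t * R" using that l(4) t by (simp add: v_def mult_mono)
      then have "l + s *\<^sub>R v \<in> cball l r" using t by (simp add: dist_norm)
      then show ?thesis using l(1) pos[of s] that t by auto
    qed
    have "\<exists>x. 0 < x \<and> x < t \<and> g t - g 0 = (t - 0) * (v \<bullet> dangles (l + x *\<^sub>R v) v)"
    proof (rule MVT2[OF t(1)])
      fix s assume "0 \<le> s" "s \<le> t"
      then have "l + s *\<^sub>R v \<in> K" using K by simp
      then show "(g has_real_derivative v \<bullet> dangles (l + s *\<^sub>R v) v) (at s)"
        unfolding g_def has_real_derivative_iff_has_vector_derivative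
        by (intro bounded_linear.has_vector_derivative[OF bounded_linear_inner_right
            has_vector_derivative_angles])
          (use assms(2) \<open>l + s *\<^sub>R v \<in> K\<close> in blast)+
    qed
    then obtain x where x: "0 < x" "x < t" "g t - g 0 = t * (v \<bullet> dangles (l + x *\<^sub>R v) v)" by auto
    have "m * (norm v)\<^sup>2 \<le> v \<bullet> dangles (l + x *\<^sub>R v) v" using x by (intro mv K) auto
    then have "g t - g 0 \<ge> t * (m * (norm v)\<^sup>2)" using t x(3) by (simp add: mult_left_mono)
    moreover have "g t \<le> g 1"
    proof -
      have "l' - (l + t *\<^sub>R v) = (1 - t) *\<^sub>R v" by (simp add: v_def algebra_simps)
      then have "(1 - t) * (v \<bullet> angles (l + t *\<^sub>R v)) \<le> (1 - t) * (v \<bullet> angles l')"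
        using angles_monotone[OF pos[of t] l(3)] t by simp
      then have "t = 1 \<or> g t \<le> v \<bullet> angles l'"
        using t by (cases "t = 1") (simp_all add: g_def mult_le_cancel_left_pos)
      then show ?thesis by (auto simp: g_def v_def)
    qed
    ultimately show "m * t * (norm (l' - l))\<^sup>2 \<le> (l' - l) \<bullet> (angles l' - angles l)"
      by (simp add: g_def v_def inner_diff_right algebra_simps)
  qed
qed

lemma angles_lipschitz:
  assumes "compact K" and "convex K" and "K \<subseteq> {l \<in> sixpos. sixdelta (sixmap cosh l) > 0}"
  shows "\<exists>B>0. \<forall>l\<in>K. \<forall>l'\<in>K. norm (angles l' - angles l) \<le> B * norm (l' - l)"
proof -
  obtain B where B: "B > 0" "\<And>l v. l \<in> K \<Longrightarrow> norm (dangles l v) \<le> B * norm v"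
    using compact_dangles_bounds[OF assms(1,3)] by blast
  have "norm (angles l' - angles l) \<le> B * norm (l' - l)" if "l \<in> K" "l' \<in> K" for l l'
  proof -
    define v where "v = l' - l"
    have K: "l + s *\<^sub>R v \<in> K" if "s \<in> {0..1}" for s
      using convexD_alt[OF assms(2) \<open>l \<in> K\<close> \<open>l' \<in> K\<close>, of s] that by (simp add: v_def algebra_simps)
    have der: "((\<lambda>s. angles (l + s *\<^sub>R v)) has_vector_derivative dangles (l + s *\<^sub>R v) v) (at s
        within S)"
      if "s \<in> {0..1}" for s S
      by (rule has_vector_derivative_angles) (use assms(3) K[OF that] in blast)+
    have "\<exists>x\<in>{0<..<1}. norm (angles (l + 1 *\<^sub>R v) - angles (l + 0 *\<^sub>R v)) \<le> norm ((1 - 0) *\<^sub>R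
        dangles (l + x *\<^sub>R v) v)"
    proof (rule mvt_general)
      show "continuous_on {0..1} (\<lambda>s. angles (l + s *\<^sub>R v))"
        using der by (intro continuous_on_vector_derivative) auto
      show "((\<lambda>s. angles (l + s *\<^sub>R v)) has_derivative (\<lambda>h. h *\<^sub>R dangles (l + x *\<^sub>R v) v)) (at x)"
        if "0 < x" "x < 1" for x
        using der[of x UNIV] that by (simp add: has_vector_derivative_def)
    qed simp
    then obtain x where "x \<in> {0<..<1}" "norm (angles l' - angles l) \<le> norm (dangles (l + x *\<^sub>R v)
        v)"
      by (auto simp: v_def)
    moreover from this have "norm (dangles (l + x *\<^sub>R v) v) \<le> B * norm v" by (intro B K) auto
    ultimately show ?thesis by (simp add: v_def)
  qed
  then show ?thesis using B(1) by blast
qed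

section \<open>Angle estimates for short edges\<close>

text \<open>Under the triangle inequalities the expression is nonnegative. If
  \<open>p > q + r\<close>, it equals \<open>4 * (q * r) - (p - q - r)\<^sup>2\<close>, and the
  bounds on the variables give at least 4 - 9.\<close>

lemma heron_lower_bound:
  fixes p q r :: real
  assumes "1 \<le> p" "p \<le> 5" "1 \<le> q" "q \<le> 5" "1 \<le> r" "r \<le> 5"
  shows "2 * (p * q + q * r + r * p) - p\<^sup>2 - q\<^sup>2 - r\<^sup>2 \<ge> - 5"
proof -
  have far: "2 * (p * q + q * r + r * p) - p\<^sup>2 - q\<^sup>2 - r\<^sup>2 \<ge> - 5"
    if "p > q + r" "p \<le> 5" "1 \<le> q" "1 \<le> r" for p q r :: real
  proof -
    have "(p - q - r)\<^sup>2 \<le> 3\<^sup>2" using that by (intro power_mono) auto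
    moreover have "q * r \<ge> 1" using that by (metis mult_mono' mult_1 zero_le_one)
    moreover have "2 * (p * q + q * r + r * p) - p\<^sup>2 - q\<^sup>2 - r\<^sup>2 = 4 * (q * r) - (p - q - r)\<^sup>2" by
        algebra
    ultimately show ?thesis by simp
  qed
  consider "p > q + r" | "q > r + p" | "r > p + q" | "p \<le> q + r \<and> q \<le> r + p \<and> r \<le> p + q" by linarith
  then show ?thesis
  proof cases
    case 4
    have "2 * (p * q + q * r + r * p) - p\<^sup>2 - q\<^sup>2 - r\<^sup>2 = p * (q + r - p) + q * (r + p - q) + r * (p
        + q - r)"
      by algebra
    also have "\<dots> \<ge> 0" using 4 assms by (intro add_nonneg_nonneg mult_nonneg_nonneg) auto
    finally show ?thesis by simp
  qed (use far[of q r p] far[of r p q] far[of p q r] assms in \<open>simp_all add: algebra_simps\<close>)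
qed

text \<open>The square of 11/5 is below 5, so \<open>heron_lower_bound\<close> applies to the
  products of opposite cosines. The remaining terms add up to at least 6 - 1 + 8 = 13, which beats
  the deficit 5. A bound larger than 2 is chosen to leave room around the cube.\<close>

lemma tdelta_pos_box:
  assumes "a \<in> {1..11/5}" "b \<in> {1..11/5}" "c \<in> {1..11/5}" "d \<in> {1..11/5}" "e \<in> {1..11/5}" "f \<in>
      {1..11/5}"
  shows "tdelta a f b c d e > 0"
proof -
  have prod: "1 \<le> x * y \<and> x * y \<le> 5" if "x \<in> {1..11/5}" "y \<in> {1..11/5}" for x y :: real
  proof -
    have "1 * 1 \<le> x * y" using that by (intro mult_mono) auto
    moreover have "x * y \<le> 11/5 * (11/5)" using that by (intro mult_mono) auto
    ultimately show ?thesis by simp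
  qed
  have trip: "1 \<le> x * y * z" if "x \<in> {1..11/5}" "y \<in> {1..11/5}" "z \<in> {1..11/5}" for x y z :: real
  proof -
    have "1 * 1 \<le> (x * y) * z" using that prod[of x y] by (intro mult_mono) auto
    then show ?thesis by simp
  qed
  have sq: "1 \<le> x\<^sup>2" if "x \<in> {1..11/5}" for x :: real using prod[OF that that] by (simp add:
      power2_eq_square)
  have "2 * ((a * f) * (b * e) + (b * e) * (c * d) + (c * d) * (a * f)) - (a * f)\<^sup>2 - (b * e)\<^sup>2 - (c
      * d)\<^sup>2 \<ge> - 5"
    using prod assms by (intro heron_lower_bound) auto
  moreover have "a\<^sup>2 + b\<^sup>2 + c\<^sup>2 + d\<^sup>2 + e\<^sup>2 + f\<^sup>2 \<ge> 6" using sq assms by (smt (verit))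
  moreover have "a * b * d + a * c * e + b * c * f + d * e * f \<ge> 4" using trip assms by (smt
      (verit))
  ultimately show ?thesis unfolding tdelta_def by (simp add: mult.assoc)
qed

section \<open>The angle at an edge of length near the upper end of the cube\<close>

lemma cos_pi_fifth_gt: "cos (pi / 5) > 4 / 5"
proof -
  define x where "x = cos (pi / 5)"
  have "x > 0" unfolding x_def by (rule cos_gt_zero) auto
  \<comment> \<open>Three fifths and two fifths of \<pi> are supplementary. After removal of the
    factor \<open>x + 1\<close> this becomes the quadratic equation of half the golden
    ratio.\<close>
  have "cos (3 * (pi / 5)) = - cos (2 * (pi / 5))"
  proof -
    have "3 * (pi / 5) = pi - 2 * (pi / 5)" by simp
    then show ?thesis by (metis cos_pi_minus)
  qed
  then have "4 * x ^ 3 - 3 * x = - (2 * x\<^sup>2 - 1)"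
    unfolding x_def cos_treble_cos cos_double_cos .
  then have "(x + 1) * (4 * x\<^sup>2 - 2 * x - 1) = 0" by algebra
  then have "4 * x\<^sup>2 - 2 * x - 1 = 0" using \<open>x > 0\<close> by (simp only: mult_eq_0_iff) auto
  then have "x * (4 * x - 2) = 1" by (simp add: power2_eq_square algebra_simps)
  have "x > 4 / 5"
  proof (rule ccontr)
    assume "\<not> x > 4 / 5"
    then have "x * (4 * x - 2) \<le> x * (6 / 5)" using \<open>x > 0\<close> by (intro mult_left_mono) auto
    also have "\<dots> \<le> 24 / 25" using \<open>\<not> x > 4 / 5\<close> by simp
    finally have "x * (4 * x - 2) \<le> 24 / 25" .
    then show False using \<open>x * (4 * x - 2) = 1\<close> by simp
  qed
  then show ?thesis by (simp add: x_def)
qed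

text \<open>\<open>maxpoly \<le> 0\<close> says that \<open>tphi a 1 b c d e \<le> 4 / 5\<close>, and \<open>f = 1\<close> is the worst case.  As
  \<open>maxpoly\<close> is a convex quadratic polynomial in each of \<open>b, c, d, e\<close>, it suffices to check corners.\<close>

definition maxpoly :: "real \<Rightarrow> real \<Rightarrow> real \<Rightarrow> real \<Rightarrow> real \<Rightarrow> real" where
  "maxpoly a b c d e = 25 * (tnum a 1 b c d e)\<^sup>2 - 16 * (tface a b d * tface a c e)"

lemma maxpoly_swap:
  "maxpoly a c b e d = maxpoly a b c d e" "maxpoly a d e b c = maxpoly a b c d e"
  "maxpoly a e d c b = maxpoly a b c d e"
  unfolding maxpoly_def tnum_def tface_def by algebra+

lemma maxpoly_convex:
  assumes "19/10 \<le> a" "a \<le> 2" "1 \<le> b" "b \<le> 2" "1 \<le> c" "1 \<le> e"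
    and "maxpoly a 1 c d e \<le> 0" "maxpoly a 2 c d e \<le> 0"
  shows "maxpoly a b c d e \<le> 0"
proof -
  \<comment> \<open>\<open>A\<close> is the coefficient of \<open>b\<^sup>2\<close> in
    \<open>maxpoly\<close>; once it is nonnegative, values for \<open>b\<close> between 1 and 2 lie
    below the chord.\<close>
  define A where "A = 25 * (c + a * e)\<^sup>2 - 16 * tface a c e"
  have "A = 9 * c\<^sup>2 + 18 * a * (c * e) + (9 * (a * e)\<^sup>2 + 16 * ((a\<^sup>2 - 1) * (e\<^sup>2 - 1)))"
    unfolding A_def tface_def by (simp add: algebra_simps power2_eq_square)
  moreover have "\<dots> \<ge> 0"
    using assms by (intro add_nonneg_nonneg mult_nonneg_nonneg) auto
  ultimately have "A \<ge> 0" by simp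
  have "maxpoly a b c d e = (2 - b) * maxpoly a 1 c d e + (b - 1) * maxpoly a 2 c d e - A * ((b - 1)
      * (2 - b))"
    unfolding maxpoly_def A_def tnum_def tface_def by (simp add: algebra_simps power2_eq_square)
  also have "\<dots> \<le> 0"
    using assms \<open>A \<ge> 0\<close> by (smt (verit) mult_nonneg_nonneg mult_nonneg_nonpos)
  finally show ?thesis .
qed

lemma maxpoly_corner:
  assumes "19/10 \<le> a" "a \<le> 2" "b \<in> {1, 2}" "c \<in> {1, 2}" "d \<in> {1, 2}" "e \<in> {1, 2}"
  shows "maxpoly a b c d e \<le> 0"
proof -
  \<comment> \<open>At a corner \<open>maxpoly\<close> is a polynomial of degree at most 4 in
    \<open>x\<close>. Each power of \<open>x\<close> is at most a tenth of the preceding one, and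
    with these bounds all sixteen corners become linear problems.\<close>
  define x where "x = 2 - a"
  have x: "0 \<le> x" "x \<le> 1/10" using assms by (auto simp: x_def)
  have a: "a = 2 - x" by (simp add: x_def)
  have 2: "0 \<le> x * x" "x * x \<le> x * (1/10)" using mult_left_mono[OF x(2,1)] by auto
  have 3: "0 \<le> x * (x * x)" "x * (x * x) \<le> x * (x * (1/10))"
    using mult_left_mono[OF 2(2) x(1)] x by auto
  have 4: "0 \<le> x * (x * (x * x))" "x * (x * (x * x)) \<le> x * (x * (x * (1/10)))"
    using mult_left_mono[OF 3(2) x(1)] x by auto
  show ?thesis
    using assms(3-6) unfolding a maxpoly_def tnum_def tface_def
    by (auto simp: power2_eq_square algebra_simps) (use x 2 3 4 in linarith)+
qed

lemma tphi_max_edge: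
  assumes a: "19/10 \<le> a" "a \<le> 2" and b: "1 < b" "b \<le> 2" and c: "1 < c" "c \<le> 2"
    and d: "1 < d" "d \<le> 2" and e: "1 < e" "e \<le> 2" and f: "1 < f"
  shows "tphi a f b c d e \<le> 4 / 5"
proof -
  \<comment> \<open>The variables leave the corners one at a time, in the order
    \<open>e, d, c, b\<close>. Each time a symmetry of \<open>maxpoly\<close> moves the released
    variable to the place of \<open>b\<close>, where \<open>maxpoly_convex\<close> applies.\<close>
  have E: "maxpoly a b c d e \<le> 0" if bcd: "b \<in> {1,2}" "c \<in> {1,2}" "d \<in> {1,2}" for b c d
  proof -
    have "maxpoly a e d c b \<le> 0"
    proof (rule maxpoly_convex[OF a])
      show "maxpoly a 1 d c b \<le> 0" "maxpoly a 2 d c b \<le> 0" using bcd by (auto intro!: maxpoly_corner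
          a)
    qed (use e bcd in auto)
    then show ?thesis by (simp only: maxpoly_swap(3)[where a = a and b = b and c = c and d = d and e
        = e])
  qed
  have D: "maxpoly a b c d e \<le> 0" if bc: "b \<in> {1,2}" "c \<in> {1,2}" for b c
  proof -
    have "maxpoly a d e b c \<le> 0"
    proof (rule maxpoly_convex[OF a])
      show "maxpoly a 1 e b c \<le> 0" "maxpoly a 2 e b c \<le> 0"
        using E[OF bc, of 1] E[OF bc, of 2]
        by (simp_all only: maxpoly_swap(2)[where a = a and b = b and c = c and e = e] insert_iff
            simp_thms)
    qed (use d e bc in auto)
    then show ?thesis by (simp only: maxpoly_swap(2)[where a = a and b = b and c = c and d = d and e
        = e])
  qed
  have C: "maxpoly a b c d e \<le> 0" if b: "b \<in> {1,2}" for b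
  proof -
    have "maxpoly a c b e d \<le> 0"
    proof (rule maxpoly_convex[OF a])
      show "maxpoly a 1 b e d \<le> 0" "maxpoly a 2 b e d \<le> 0"
        using D[OF b, of 1] D[OF b, of 2]
        by (simp_all only: maxpoly_swap(1)[where a = a and b = b and d = d and e = e] insert_iff
            simp_thms)
    qed (use c d b in auto)
    then show ?thesis by (simp only: maxpoly_swap(1)[where a = a and b = b and c = c and d = d and e
        = e])
  qed
  have "maxpoly a b c d e \<le> 0"
  proof (rule maxpoly_convex[OF a])
    show "maxpoly a 1 c d e \<le> 0" "maxpoly a 2 c d e \<le> 0" using C by auto
  qed (use b c e in auto)
  define P where "P = tface a b d * tface a c e"
  have P: "P > 0" "tface a b d > 0" "tface a c e > 0"
    using tface_pos[of a b d] tface_pos[of a c e] a b c d e by (auto simp: P_def)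
  have "(tnum a 1 b c d e)\<^sup>2 \<le> (4 / 5)\<^sup>2 * P"
    using \<open>maxpoly a b c d e \<le> 0\<close> by (simp add: maxpoly_def P_def power2_eq_square)
  then have "tnum a 1 b c d e \<le> 4 / 5 * sqrt P"
    using real_le_rsqrt[of "tnum a 1 b c d e" "(4 / 5)\<^sup>2 * P"] by (simp add: real_sqrt_mult)
  moreover have "tnum a f b c d e \<le> tnum a 1 b c d e"
  proof -
    have "(a\<^sup>2 - 1) * 1 \<le> (a\<^sup>2 - 1) * f" using a f by (intro mult_left_mono) auto
    then show ?thesis by (simp add: tnum_def)
  qed
  ultimately show ?thesis
    using P by (simp add: tphi_def P_def real_sqrt_mult field_simps)
qed

lemma tang_max_edge:
  assumes "19/10 \<le> a" "a \<le> 2" "1 < b" "b \<le> 2" "1 < c" "c \<le> 2" "1 < d" "d \<le> 2" "1 < e" "e \<le> 2" "1 <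
      f"
  shows "tang a f b c d e > pi / 5"
proof -
  have "pi / 5 = arccos (cos (pi / 5))" by (simp add: arccos_cos)
  also have "\<dots> < arccos (4 / 5)"
    using cos_pi_fifth_gt by (intro arccos_less_arccos) auto
  also have "\<dots> \<le> tang a f b c d e"
    unfolding tang_def using tphi_max_edge[OF assms] by (intro arccos_le_arccos) auto
  finally show ?thesis .
qed

section \<open>The angle at a short edge\<close>

lemma sinh_le_mult_cosh: "sinh x \<le> x * cosh x" if "x \<ge> 0" for x :: real
proof -
  have "sinh 0 - 0 * cosh 0 \<ge> sinh x - x * cosh x"
    by (rule DERIV_nonpos_imp_nonincreasing[OF that])
      (auto intro!: derivative_eq_intros exI simp: mult_nonneg_nonneg)
  then show ?thesis by simp
qed

lemma cosh_small: "cosh x \<le> 3 / 2" if "0 \<le> x" "x \<le> 1 / 2" for x :: real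
proof -
  have "exp x \<le> exp (1 / 2)" "exp (- x) \<le> 1" using that by auto
  then have "exp x + exp (- x) \<le> 3" using exp_half_le2 by linarith
  then show ?thesis by (simp add: cosh_def)
qed

text \<open>The squared sine of the angle is \<open>tdelta * (a\<^sup>2 - 1) / P\<close>, at most
  \<open>144 * (4 * l\<^sup>2) / 16 = (6 * l)\<^sup>2\<close>. For \<open>l \<le> 1/15\<close> this
  leaves a cosine of absolute value at least 9/10, and it is positive because the numerator
  \<open>tnum\<close> is. Hence the angle is at most its tangent, at most
  \<open>20/3 * l\<close>.\<close>

lemma tang_min_edge:
  assumes l: "0 < l" "l \<le> 1 / 15" and b: "1 < b" "b \<le> 2" and c: "1 < c" "c \<le> 2"
    and d: "1 < d" "d \<le> 2" and e: "1 < e" "e \<le> 2" and f: "1 < f" "f \<le> 2"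
  shows "tang (cosh l) f b c d e < 3 * pi * l"
proof -
  define a where "a = cosh l"
  have a: "1 < a" "a \<le> 2" using l cosh_small[of l] by (simp_all add: a_def cosh_real_gt_1)
  have "sinh l \<le> l * 2"
    using sinh_le_mult_cosh[of l] l mult_left_mono[OF a(2), of l] unfolding a_def by linarith
  then have "(sinh l)\<^sup>2 \<le> (l * 2)\<^sup>2" using l by (intro power_mono) auto
  then have s: "a\<^sup>2 - 1 \<le> 4 * l\<^sup>2" by (simp add: a_def cosh_square_eq power_mult_distrib)
  define P where "P = tface a b d * tface a c e"
  have P4: "tface a b d > 4" "tface a c e > 4" using tface_pos a b c d e by auto
  then have P: "P \<ge> 16" unfolding P_def using mult_mono[of 4 "tface a b d" 4 "tface a c e"] by simp
  define p where "p = tphi a f b c d e"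
  \<comment> \<open>The terms add up to at most 24 - 1 + 64 + 48 = 135; 144 is the next
    square.\<close>
  have D: "tdelta a f b c d e \<le> 144"
  proof -
    have sq: "x\<^sup>2 \<le> 4" if "1 < x" "x \<le> 2" for x :: real
      using that power_mono[of x 2 2] by simp
    have pr: "1 \<le> x * y \<and> x * y \<le> 4" if "1 < x" "x \<le> 2" "1 < y" "y \<le> 2" for x y :: real
      using that mult_mono[of x 2 y 2] mult_mono[of 1 x 1 y] by simp
    have tr: "x * y * z \<le> 8" if "1 < x" "x \<le> 2" "1 < y" "y \<le> 2" "1 < z" "z \<le> 2" for x y z :: real
      using that pr[of x y] mult_mono[of "x * y" 4 z 2] by simp
    have qd: "x * y \<le> 16" if "1 \<le> x \<and> x \<le> 4" "1 \<le> y \<and> y \<le> 4" for x y :: real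
      using that mult_mono[of x 4 y 4] by simp
    have "2 * (x * y + y * z + z * x) - x\<^sup>2 - y\<^sup>2 - z\<^sup>2 \<le> 48"
      if "1 \<le> x \<and> x \<le> 4" "1 \<le> y \<and> y \<le> 4" "1 \<le> z \<and> z \<le> 4" for x y z :: real
      using qd[of x y] qd[of y z] qd[of z x] that
        sum_squares_bound[of x y] sum_squares_bound[of y z] sum_squares_bound[of z x] by simp
    from this[OF pr pr pr, OF a f b e c d]
    show ?thesis
      using sq[OF a] sq[OF b] sq[OF c] sq[OF d] sq[OF e] sq[OF f]
        tr[OF a b d] tr[OF a c e] tr[OF b c f] tr[OF d e f]
      unfolding tdelta_def by (simp add: mult.assoc)
  qed
  have "1 - p\<^sup>2 = tdelta a f b c d e * (a\<^sup>2 - 1) / P"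
    unfolding p_def P_def by (rule one_minus_tphi_sq) (use a b c d e in auto)
  also have "\<dots> \<le> 144 * (4 * l\<^sup>2) / 16"
    using D s P a by (intro frac_le mult_mono) auto
  finally have p1: "1 - p\<^sup>2 \<le> (6 * l)\<^sup>2" by (simp add: power_mult_distrib)
  have "l\<^sup>2 \<le> (1 / 15)\<^sup>2" using l by (intro power_mono) auto
  then have "p\<^sup>2 \<ge> (9 / 10)\<^sup>2" using p1 by (simp add: power_mult_distrib power2_eq_square)
  moreover have "p > 0"
  proof -
    have "(a\<^sup>2 - 1) * f \<le> 4 * (1 / 15)\<^sup>2 * 2" using s f a \<open>l\<^sup>2 \<le> (1 / 15)\<^sup>2\<close>
      by (intro mult_mono) (linarith | simp)+
    moreover have "b * c > 1" using b c by (simp add: less_1_mult)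
    moreover have "d * e + a * b * e + a * c * d > 0" using a b c d e by (intro add_pos_pos
        mult_pos_pos) auto
    ultimately have "tnum a f b c d e > 0" unfolding tnum_def by (simp add: power2_eq_square)
    then show ?thesis unfolding p_def tphi_def using P4 by simp
  qed
  ultimately have p9: "p \<ge> 9 / 10" using power2_le_imp_le by force
  show ?thesis
  proof (cases "p \<ge> 1")
    case True
    then show ?thesis using l by (simp add: tang_def a_def[symmetric] p_def[symmetric])
  next
    case False
    define t where "t = arccos p"
    have ct: "cos t = p" unfolding t_def using False p9 by simp
    have t: "0 \<le> t" "t < pi / 2"
      unfolding t_def using arccos_lbound[of p] arccos_less_arccos[of 0 p] False p9 by auto
    have "sin t = sqrt (1 - p\<^sup>2)" unfolding t_def using False p9 by (simp add: sin_arccos)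
    also have "\<dots> \<le> 6 * l" using p1 l by (intro real_le_lsqrt) auto
    finally have "tan t \<le> 6 * l / (9 / 10)"
      unfolding tan_def ct using p9 l by (intro frac_le) auto
    moreover have "t \<le> tan t"
      using arctan_le_self[of "tan t"] arctan_tan[of t] t tan_pos_pi2_le[of t] by simp
    ultimately have "t \<le> 20 / 3 * l" by simp
    also have "\<dots> < 3 * pi * l" using pi_gt3 l by simp
    finally show ?thesis
      using False p9 by (simp add: tang_def a_def[symmetric] p_def[symmetric] t_def)
  qed
qed

section \<open>A global Peano theorem\<close>

text \<open>The index set will contain all times and is uncountable, so compactness of the product
  yields a cluster point and not a convergent subsequence: the index \<open>n\<close> depends on the
  finite set \<open>T\<close>.\<close>

lemma pointwise_cluster:
  fixes X :: "nat \<Rightarrow> 'i \<Rightarrow> real"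
  assumes "\<And>n i. X n i \<in> {lo i..hi i}"
  shows "\<exists>x. \<forall>T d N. finite T \<longrightarrow> d > 0 \<longrightarrow> (\<exists>n\<ge>N. \<forall>i\<in>T. \<bar>X n i - x i\<bar> < d)"
proof -
  have "compactin (product_topology (\<lambda>i. euclidean) UNIV) (PiE UNIV (\<lambda>i. {lo i..hi i}))"
    unfolding compactin_PiE by auto
  then have c: "compact (PiE UNIV (\<lambda>i. {lo i..hi i}))"
    by (simp only: euclidean_product_topology compactin_euclidean_iff)
  have "X n \<in> PiE UNIV (\<lambda>i. {lo i..hi i})" for n using assms by (simp add: PiE_UNIV_domain)
  then have ev: "eventually (\<lambda>x. x \<in> PiE UNIV (\<lambda>i. {lo i..hi i})) (filtermap X sequentially)"
    by (simp add: eventually_filtermap)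
  have ne: "filtermap X sequentially \<noteq> bot" by (simp add: filtermap_bot_iff)
  obtain x where x: "inf (nhds x) (filtermap X sequentially) \<noteq> bot"
    using compact_filter[THEN iffD1, OF c, rule_format, OF ne ev] by blast
  show ?thesis
  proof (intro exI[of _ x] allI impI)
    fix T d N assume T: "finite (T :: 'i set)" "(d :: real) > 0"
    define U where "U = PiE UNIV (\<lambda>i. if i \<in> T then ball (x i) d else UNIV)"
    have "open U" unfolding U_def
    proof (rule open_PiE)
      show "finite {i. (if i \<in> T then ball (x i) d else UNIV) \<noteq> UNIV}"
        by (rule finite_subset[OF _ T(1)]) auto
    qed auto
    moreover have "x \<in> U" using T(2) by (auto simp: U_def)
    ultimately have "eventually (\<lambda>y. y \<in> U) (nhds x)" by (rule eventually_nhds_in_open)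
    show "\<exists>n\<ge>N. \<forall>i\<in>T. \<bar>X n i - x i\<bar> < d"
    proof (rule ccontr)
      assume no: "\<not> ?thesis"
      have "eventually (\<lambda>n. X n \<notin> U) sequentially"
        unfolding eventually_sequentially
      proof (intro exI allI impI)
        fix n assume "n \<ge> N"
        then obtain i where "i \<in> T" "\<not> \<bar>X n i - x i\<bar> < d" using no by blast
        then have "X n i \<notin> ball (x i) d" by (auto simp: dist_real_def abs_minus_commute)
        moreover have "y i \<in> ball (x i) d" if "y \<in> U" for y
          using PiE_mem[OF that[unfolded U_def] UNIV_I, of i] \<open>i \<in> T\<close> by simp
        ultimately show "X n \<notin> U" by blast
      qed
      then have "eventually (\<lambda>y. y \<notin> U) (filtermap X sequentially)" by (simp add:
          eventually_filtermap)
      then have "eventually (\<lambda>y. False) (inf (nhds x) (filtermap X sequentially))"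
        unfolding eventually_inf using \<open>eventually (\<lambda>y. y \<in> U) (nhds x)\<close>
        by (intro exI[of _ "\<lambda>y. y \<in> U"] exI[of _ "\<lambda>y. y \<notin> U"]) simp
      then show False using x by (simp add: eventually_False)
    qed
  qed
qed

text \<open>Euler step functions on the grid of width \<open>1 / (n + 1)\<close> have a pointwise cluster point by
  Tychonoff's theorem; as \<open>f\<close> need not be Lipschitz, the sequence itself may fail to converge.\<close>

lemma peano_global:
  fixes f :: "('e \<Rightarrow> real) \<Rightarrow> 'e \<Rightarrow> real"
  assumes fin: "finite E" and bd: "\<And>x e. e \<in> E \<Longrightarrow> \<bar>f x e\<bar> \<le> C"
    and cont: "\<And>X x e. (\<And>e. e \<in> E \<Longrightarrow> (\<lambda>n. X n e) \<longlonglongrightarrow> x e) \<Longrightarrow> e \<in> E \<Longrightarrow> (\<lambda>n. f (X n) e) \<longlonglongrightarrow> f x e"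
  shows "\<exists>u. (\<forall>e\<in>E. u 0 e = x0 e) \<and>
    (\<forall>t\<ge>0. \<forall>e\<in>E. ((\<lambda>s. u s e) has_real_derivative f (u t) e) (at t within {0..}))"
proof (cases "E = {}")
  case False
  then have C: "C \<ge> 0" using bd by (metis abs_ge_zero all_not_in_conv order_trans)
  define h where "h n = 1 / (real n + 1)" for n
  have h: "h n > 0" for n by (simp add: h_def)
  define p where "p n = rec_nat x0 (\<lambda>_ y e. y e + h n * f y e)" for n
  have p0: "p n 0 = x0" and pS: "p n (Suc k) e = p n k e + h n * f (p n k) e" for n k e
    by (simp_all add: p_def)
  define fl where "fl n t = nat \<lfloor>t / h n\<rfloor>" for n t
  have fl: "real (fl n t) * h n \<le> t" "t < real (fl n t) * h n + h n" if "t \<ge> 0" for n t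
  proof -
    have "real (fl n t) \<le> t / h n" "t / h n < real (fl n t) + 1"
      using that h[of n] by (simp_all add: fl_def)
    then show "real (fl n t) * h n \<le> t" "t < real (fl n t) * h n + h n"
      using h[of n] by (simp_all add: field_simps)
  qed
  have fl_mono: "fl n s \<le> fl n t" if "s \<le> t" for n s t
    unfolding fl_def using that h[of n] by (intro nat_mono floor_mono divide_right_mono) auto
  \<comment> \<open>Time and coordinate together form the index. The value 0 at irrelevant indices
    keeps every factor of the product in a bounded interval.\<close>
  define X where "X n i = (if fst i \<ge> 0 \<and> snd i \<in> E then p n (fl n (fst i)) (snd i) else 0)"
    for n and i :: "real \<times> 'e"
  have X: "X n (t, e) = p n (fl n t) e" if "t \<ge> 0" "e \<in> E" for n t e using that by (simp add: X_def)
  have diff: "p n m e - p n k e = (\<Sum>j=k..<m. h n * f (p n j) e)" if "k \<le> m" for n k m e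
    using that by (induction m rule: dec_induct) (simp_all add: pS)
  \<comment> \<open>Compares \<open>m - k\<close> Euler steps with motion at constant velocity
    \<open>v\<close>. The case \<open>v = 0\<close> gives the a priori bound;
    \<open>v = f (u t) e\<close> will give the derivative.\<close>
  have dev: "\<bar>p n m e - p n k e - real (m - k) * h n * v\<bar> \<le> real (m - k) * h n * w"
    if "k \<le> m" and w: "\<And>j. k \<le> j \<Longrightarrow> j < m \<Longrightarrow> \<bar>f (p n j) e - v\<bar> \<le> w" for n k m e v w
  proof -
    have "p n m e - p n k e - real (m - k) * h n * v = (\<Sum>j=k..<m. h n * (f (p n j) e - v))"
      by (simp add: diff[OF that(1)] sum_subtractf right_diff_distrib)
    also have "\<bar>\<dots>\<bar> \<le> (\<Sum>j=k..<m. \<bar>h n * (f (p n j) e - v)\<bar>)" by (rule sum_abs)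
    also have "\<dots> \<le> (\<Sum>j=k..<m. h n * w)"
      by (intro sum_mono) (use w h[of n] in \<open>simp add: abs_mult mult_left_mono\<close>)
    finally show ?thesis by simp
  qed
  have bound: "\<bar>p n m e - p n k e\<bar> \<le> C * (real (m - k) * h n)" if "k \<le> m" "e \<in> E" for n k m e
    using dev[OF that(1), of n e 0 C] bd[OF that(2)] by (simp add: mult.commute)
  have "\<exists>x. \<forall>T d N. finite T \<longrightarrow> d > 0 \<longrightarrow> (\<exists>n\<ge>N. \<forall>i\<in>T. \<bar>X n i - x i\<bar> < d)"
  proof (rule pointwise_cluster[of X "\<lambda>i. if fst i \<ge> 0 \<and> snd i \<in> E then x0 (snd i) - C * fst i else
      0"
      "\<lambda>i. if fst i \<ge> 0 \<and> snd i \<in> E then x0 (snd i) + C * fst i else 0"])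
    fix n and i :: "real \<times> 'e"
    have "\<bar>p n (fl n (fst i)) (snd i) - x0 (snd i)\<bar> \<le> C * fst i" if "fst i \<ge> 0" "snd i \<in> E"
      using bound[of 0 "fl n (fst i)" "snd i" n] fl(1)[OF that(1), of n] that C
      by (simp add: p0) (meson mult_left_mono order_trans)
    then show "X n i \<in> {if fst i \<ge> 0 \<and> snd i \<in> E then x0 (snd i) - C * fst i else 0 ..
        if fst i \<ge> 0 \<and> snd i \<in> E then x0 (snd i) + C * fst i else 0}"
      by (auto simp: X_def abs_le_iff)
  qed
  then obtain x where x: "\<And>T d N. finite T \<Longrightarrow> d > 0 \<Longrightarrow> \<exists>n\<ge>N. \<forall>i\<in>T. \<bar>X n i - x i\<bar> < d"
    by blast
  define u where "u t e = x (t, e)" for t e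
  have close: "\<exists>n\<ge>N. \<forall>t\<in>T. \<forall>e\<in>E. \<bar>p n (fl n t) e - u t e\<bar> < d" if "finite T" "\<And>t. t \<in> T \<Longrightarrow> t \<ge> 0" "d
      > 0" for T d N
    using x[of "T \<times> E" d N] that fin by (fastforce simp: X u_def)
  have small: "\<exists>N. \<forall>n\<ge>N. h n < d" if "d > 0" for d
    using LIMSEQ_inverse_real_of_nat[THEN order_tendstoD(2), OF that]
    by (simp add: h_def eventually_sequentially inverse_eq_divide add.commute)
  have u0: "u 0 e = x0 e" if "e \<in> E" for e
  proof (rule ccontr)
    assume "u 0 e \<noteq> x0 e"
    then have pos: "\<bar>u 0 e - x0 e\<bar> > 0" by simp
    have "\<exists>n\<ge>0. \<forall>t\<in>{0}. \<forall>e'\<in>E. \<bar>p n (fl n t) e' - u t e'\<bar> < \<bar>u 0 e - x0 e\<bar>"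
      by (rule close[OF _ _ pos]) auto
    then obtain n where "\<forall>e'\<in>E. \<bar>p n (fl n 0) e' - u 0 e'\<bar> < \<bar>u 0 e - x0 e\<bar>" by auto
    then have "\<bar>p n (fl n 0) e - u 0 e\<bar> < \<bar>u 0 e - x0 e\<bar>" using that by blast
    then show False by (simp add: fl_def p0)
  qed
  have der: "((\<lambda>s. u s e) has_real_derivative f (u t) e) (at t within {0..})" if t: "t \<ge> 0" and e:
      "e \<in> E" for t e
  proof -
    define v where "v = f (u t) e"
    have "\<exists>d>0. \<forall>s\<ge>0. \<bar>s - t\<bar> < d \<longrightarrow> \<bar>u s e - u t e - (s - t) * v\<bar> \<le> w * \<bar>s - t\<bar>" if w: "w > 0" for w
    proof -
      \<comment> \<open>Sequential continuity of \<open>f\<close> at \<open>u t\<close> becomes a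
        radius: otherwise points closer than \<open>h n\<close> for every \<open>n\<close> would
        form a counterexample.\<close>
      obtain r where r: "r > 0" "\<And>y. (\<And>e. e \<in> E \<Longrightarrow> \<bar>y e - u t e\<bar> < r) \<Longrightarrow> \<bar>f y e - v\<bar> \<le> w"
      proof (rule ccontr)
        assume "\<not> thesis"
        then have "\<forall>n. \<exists>y. (\<forall>e\<in>E. \<bar>y e - u t e\<bar> < h n) \<and> \<not> \<bar>f y e - v\<bar> \<le> w"
          using that h by metis
        then obtain Y where Y: "\<And>n e. e \<in> E \<Longrightarrow> \<bar>Y n e - u t e\<bar> < h n" "\<And>n. \<not> \<bar>f (Y n) e - v\<bar> \<le> w"
          by metis
        have "(\<lambda>n. Y n e) \<longlonglongrightarrow> u t e" if "e \<in> E" for e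
        proof (rule LIMSEQ_I)
          fix q :: real assume "q > 0"
          then show "\<exists>N. \<forall>n\<ge>N. norm (Y n e - u t e) < q"
            using small[of q] Y(1)[OF that] by (metis order_less_trans real_norm_def)
        qed
        then have "(\<lambda>n. f (Y n) e) \<longlonglongrightarrow> v" unfolding v_def by (rule cont) (use e in auto)
        then have "eventually (\<lambda>n. \<bar>f (Y n) e - v\<bar> < w) sequentially"
          using tendstoD[of _ v _ w] w by (simp add: dist_real_def)
        then obtain n where "\<bar>f (Y n) e - v\<bar> < w" by (auto simp: eventually_sequentially)
        then show False using Y(2)[of n] by simp
      qed
      \<comment> \<open>For grid times within \<open>3 * d\<close> of each other the Euler points
        differ by less than \<open>r / 2\<close>; the other half of \<open>r\<close> pays for the
        distance between the Euler point at \<open>t\<close> and \<open>u t\<close>.\<close>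
      define d where "d = r / (8 * (C + 1))"
      have d: "d > 0" using r C by (simp add: d_def)
      have Cd: "C * (3 * d) < r / 2"
      proof -
        have "C * (3 * d) = r * (3 * C) / (8 * (C + 1))" by (simp add: d_def)
        also have "\<dots> < r / 2" using r(1) C by (simp add: field_simps add_nonneg_pos)
        finally show ?thesis .
      qed
      have "\<bar>u s e - u t e - (s - t) * v\<bar> \<le> w * \<bar>s - t\<bar>" if s: "s \<ge> 0" "\<bar>s - t\<bar> < d" for s
      \<comment> \<open>The good \<open>n\<close> depends on \<open>s\<close>, so \<open>s\<close>
        is fixed first and the inequality is reached up to an arbitrary \<open>q\<close>, in which
        \<open>n\<close> no longer occurs.\<close>
      proof (rule field_le_epsilon)
        fix q :: real assume q: "q > 0"
        \<comment> \<open>\<open>g\<close> bounds both the step width and the distance to the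
          cluster point at \<open>s\<close> and \<open>t\<close>. Rounding times to the grid costs
          \<open>g * (w + \<bar>v\<bar>)\<close> and replacing Euler points by \<open>u\<close>
          costs \<open>2 * g\<close>, together at most \<open>q\<close>.\<close>
        define g where "g = min (q / (2 + w + \<bar>v\<bar>)) (min d (r / 2))"
        have "g \<le> min d (r / 2)" unfolding g_def by (rule min.cobounded2)
        then have g: "g > 0" "g \<le> d" "g \<le> r / 2"
          using q w d r(1) by (simp_all add: g_def)
        have gq: "g * (2 + w + \<bar>v\<bar>) \<le> q"
        proof -
          have "g \<le> q / (2 + w + \<bar>v\<bar>)" by (simp add: g_def)
          then show ?thesis using w by (simp add: pos_le_divide_eq add_pos_nonneg)
        qed
        obtain N where N: "\<And>n. n \<ge> N \<Longrightarrow> h n < g" using small[OF g(1)] by blast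
        obtain n where n: "n \<ge> N" "\<And>t' e. t' \<in> {s, t} \<Longrightarrow> e \<in> E \<Longrightarrow> \<bar>p n (fl n t') e - u t' e\<bar> < g"
        proof -
          have "\<exists>n\<ge>N. \<forall>t'\<in>{s, t}. \<forall>e\<in>E. \<bar>p n (fl n t') e - u t' e\<bar> < g"
            using s(1) t by (intro close g(1)) auto
          then show thesis using that by blast
        qed
        have hg: "h n < g" using N n(1) by blast
        have main: "\<bar>p n (fl n b) e - p n (fl n a) e - (b - a) * v\<bar> \<le> (b - a) * w + g * (w + \<bar>v\<bar>)"
          if ab: "a \<in> {s, t}" "b \<in> {s, t}" "a \<le> b" for a b
        proof -
          let ?m = "real (fl n b - fl n a) * h n"
          have a0: "a \<ge> 0" "b \<ge> 0" using ab s t by auto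
          have "?m = real (fl n b) * h n - real (fl n a) * h n"
            using fl_mono[OF ab(3), of n] by (simp add: of_nat_diff algebra_simps)
          then have m: "\<bar>?m - (b - a)\<bar> \<le> g" using fl[OF a0(1), of n] fl[OF a0(2), of n] hg by
              linarith
          have "\<bar>f (p n j) e - v\<bar> \<le> w" if j: "fl n a \<le> j" "j < fl n b" for j
          proof (rule r(2))
            fix e' assume e': "e' \<in> E"
            have mid: "\<bar>p n j e' - p n (fl n t) e'\<bar> \<le> C * (3 * d)"
            proof -
              have jh: "real (fl n a) * h n \<le> real j * h n" "real j * h n \<le> real (fl n b) * h n"
                using j h[of n] by (auto intro!: mult_right_mono)
              have range: "\<bar>real j * h n - real (fl n t) * h n\<bar> \<le> 3 * d"
              proof -
                have "\<bar>a - t\<bar> < d" "\<bar>b - t\<bar> < d" using ab s(2) d by auto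
                then show ?thesis
                  using jh fl[OF a0(1), of n] fl[OF a0(2), of n] fl[OF t, of n] hg g(2) by linarith
              qed
              show ?thesis
              proof (cases "j \<le> fl n t")
                case True
                have "\<bar>p n j e' - p n (fl n t) e'\<bar> \<le> C * (real (fl n t - j) * h n)"
                  using bound[OF True e', of n] by (simp add: abs_minus_commute)
                also have "\<dots> \<le> C * (3 * d)"
                  using range True C by (intro mult_left_mono) (auto simp: of_nat_diff
                      algebra_simps)
                finally show ?thesis .
              next
                case False
                then have "fl n t \<le> j" by simp
                have "\<bar>p n j e' - p n (fl n t) e'\<bar> \<le> C * (real (j - fl n t) * h n)"
                  by (rule bound) fact+
                also have "\<dots> \<le> C * (3 * d)"
                  using range False C by (intro mult_left_mono) (auto simp: of_nat_diff
                      algebra_simps)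
                finally show ?thesis .
              qed
            qed
            show "\<bar>p n j e' - u t e'\<bar> < r" using mid Cd n(2)[of t e'] e' g(3) by fastforce
          qed
          then have 1: "\<bar>p n (fl n b) e - p n (fl n a) e - ?m * v\<bar> \<le> ?m * w"
            by (intro dev fl_mono ab(3))
          have 2: "\<bar>(?m - (b - a)) * v\<bar> \<le> g * \<bar>v\<bar>" unfolding abs_mult using m by (intro
              mult_right_mono) auto
          have 3: "?m * w \<le> (b - a + g) * w" using m w by (intro mult_right_mono) auto
          have "p n (fl n b) e - p n (fl n a) e - (b - a) * v
              = (p n (fl n b) e - p n (fl n a) e - ?m * v) + (?m - (b - a)) * v"
            by (simp add: left_diff_distrib)
          also have "\<bar>\<dots>\<bar> \<le> ?m * w + g * \<bar>v\<bar>"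
            by (rule order_trans[OF abs_triangle_ineq add_mono[OF 1 2]])
          also have "\<dots> \<le> (b - a + g) * w + g * \<bar>v\<bar>" by (rule add_right_mono[OF 3])
          also have "\<dots> = (b - a) * w + g * (w + \<bar>v\<bar>)" by (simp add: algebra_simps)
          finally show ?thesis .
        qed
        have "\<bar>p n (fl n s) e - p n (fl n t) e - (s - t) * v\<bar> \<le> \<bar>s - t\<bar> * w + g * (w + \<bar>v\<bar>)"
        proof (cases "s \<le> t")
          case True
          have "p n (fl n s) e - p n (fl n t) e - (s - t) * v
              = - (p n (fl n t) e - p n (fl n s) e - (t - s) * v)" by (simp add: algebra_simps)
          then show ?thesis using main[of s t] True by simp
        next
          case False
          then show ?thesis using main[of t s] by simp
        qed
        moreover have "\<bar>p n (fl n s) e - u s e\<bar> < g" "\<bar>p n (fl n t) e - u t e\<bar> < g" using n(2) e by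
            auto
        ultimately have "\<bar>u s e - u t e - (s - t) * v\<bar> \<le> \<bar>s - t\<bar> * w + g * (w + \<bar>v\<bar>) + 2 * g"
          by linarith
        also have "\<dots> = \<bar>s - t\<bar> * w + g * (2 + w + \<bar>v\<bar>)" by (simp add: algebra_simps)
        finally have "\<bar>u s e - u t e - (s - t) * v\<bar> \<le> \<bar>s - t\<bar> * w + g * (2 + w + \<bar>v\<bar>)" .
        then show "\<bar>u s e - u t e - (s - t) * v\<bar> \<le> w * \<bar>s - t\<bar> + q"
          using gq by (simp add: mult.commute)
      qed
      then show ?thesis using d by blast
    qed
    note approx = this
    show ?thesis
      unfolding has_field_derivative_def v_def[symmetric] has_derivative_within_alt2
    proof (intro conjI allI impI)
      fix w :: real assume "w > 0"
      then obtain d where "d > 0" and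
        d: "\<And>s. s \<ge> 0 \<Longrightarrow> \<bar>s - t\<bar> < d \<Longrightarrow> \<bar>u s e - u t e - (s - t) * v\<bar> \<le> w * \<bar>s - t\<bar>"
        using approx by blast
      then show "\<forall>\<^sub>F s in at t within {0..}. norm (u s e - u t e - v * (s - t)) \<le> w * norm (s - t)"
        unfolding eventually_at by (intro exI[of _ d]) (auto simp: dist_real_def mult.commute)
    qed (rule bounded_linear_mult_right)
  qed
  show ?thesis using u0 der by blast
qed auto

section \<open>Monotone curvature flows\<close>

lemma sum_sq_eq_0_iff: "finite A \<Longrightarrow> (\<Sum>x\<in>A. (f x :: real)\<^sup>2) = 0 \<longleftrightarrow> (\<forall>x\<in>A. f x = 0)"
  by (simp add: sum_nonneg_eq_0_iff)

lemma member_le_sum_sq: "finite A \<Longrightarrow> x \<in> A \<Longrightarrow> (f x :: real)\<^sup>2 \<le> (\<Sum>x\<in>A. (f x)\<^sup>2)"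
  by (rule member_le_sum) auto

text \<open>With \<open>log_ratio_lower\<close> this makes the Lyapunov function comparable to the
  squared distance, as long as the ratios stay in a compact part of the positive axis.\<close>

lemma log_ratio_upper: "x - 1 - ln x \<le> (x - 1)\<^sup>2 / x" if "x > 0" for x :: real
proof -
  have "ln (1 / x) \<le> 1 / x - 1" using that by (intro ln_le_minus_one) auto
  then have "x - 1 - ln x \<le> x - 2 + 1 / x" using that by (simp add: ln_div)
  also have "\<dots> = (x - 1)\<^sup>2 / x" using that by (simp add: field_simps power2_eq_square)
  finally show ?thesis .
qed

lemma log_ratio_lower: "(x - 1)\<^sup>2 / (2 * b) \<le> x - 1 - ln x" if "0 < x" "x \<le> b" "1 \<le> b" for x b ::
    real
proof -
  define h where "h x = x - 1 - ln x - (x - 1)\<^sup>2 / (2 * b)" for x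
  have der: "(h has_real_derivative (y - 1) * (1 / y - 1 / b)) (at y)" if "y > 0" for y
    unfolding h_def using that \<open>1 \<le> b\<close>
    by (auto intro!: derivative_eq_intros simp: field_simps power2_eq_square)
  have "h 1 \<le> h x"
  proof (cases "x \<le> 1")
    case True
    show ?thesis
    proof (rule DERIV_nonpos_imp_nonincreasing[OF True])
      fix y assume "x \<le> y" "y \<le> 1"
      then have "(y - 1) * (1 / y - 1 / b) \<le> 0"
        using that by (intro mult_nonpos_nonneg) (auto simp: field_simps)
      then show "\<exists>z. (h has_real_derivative z) (at y) \<and> z \<le> 0"
        using der[of y] \<open>x \<le> y\<close> that by auto
    qed
  next
    case False
    then have "1 \<le> x" by simp
    then show ?thesis
    proof (rule DERIV_nonneg_imp_nondecreasing)
      fix y assume "1 \<le> y" "y \<le> x"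
      then have "(y - 1) * (1 / y - 1 / b) \<ge> 0"
        using that by (intro mult_nonneg_nonneg) (auto simp: field_simps)
      then show "\<exists>z. (h has_real_derivative z) (at y) \<and> z \<ge> 0"
        using der[of y] \<open>1 \<le> y\<close> by auto
    qed
  qed
  then show ?thesis by (simp add: h_def)
qed

lemma nonincreasing_on_halfline:
  fixes g :: "real \<Rightarrow> real"
  assumes der: "\<And>t. t \<ge> 0 \<Longrightarrow> (g has_real_derivative g' t) (at t within {0..})"
    and neg: "\<And>t. t \<ge> 0 \<Longrightarrow> g' t \<le> 0" and "t \<ge> 0"
  shows "g t \<le> g 0"
proof (rule DERIV_nonpos_imp_decreasing_open[OF \<open>t \<ge> 0\<close>])
  have "continuous_on {0..} g"
    using der by (auto simp: continuous_on_eq_continuous_within intro: DERIV_continuous)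
  then show "continuous_on {0..t} g" by (rule continuous_on_subset) auto
  fix s assume "0 < s" "s < t"
  then have "at s within {0..} = at s" by (intro at_within_interior) (simp add: interior_Ici)
  then show "\<exists>y. (g has_real_derivative y) (at s) \<and> y \<le> 0"
    using der[of s] neg[of s] \<open>0 < s\<close> by auto
qed

text \<open>The box \<open>{lo..hi}\<close> is where \<open>K\<close> is well behaved; \<open>w\<close> is the width of the collar on which \<open>K\<close>
  points inwards.\<close>

locale curvature =
  fixes E :: "'e set" and K :: "('e \<Rightarrow> real) \<Rightarrow> 'e \<Rightarrow> real" and lo hi w C :: real
  assumes fin: "finite E"
    and lo: "0 < lo" and lohi: "lo < hi" and w: "w > 0"
    and cong: "\<And>l l' e. (\<And>e. e \<in> E \<Longrightarrow> l e = l' e) \<Longrightarrow> e \<in> E \<Longrightarrow> K l e = K l' e"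
    and mono: "\<And>l l'. (\<And>e. e \<in> E \<Longrightarrow> l e > 0) \<Longrightarrow> (\<And>e. e \<in> E \<Longrightarrow> l' e > 0) \<Longrightarrow>
      (\<Sum>e\<in>E. (l' e - l e) * (K l' e - K l e)) \<le> 0"
    and strong: "\<And>R. R > 0 \<Longrightarrow> \<exists>k>0. \<forall>l l'. (\<forall>e\<in>E. l e \<in> {lo..hi}) \<longrightarrow> (\<forall>e\<in>E. l' e > 0 \<and> \<bar>l' e - l e\<bar> \<le>
        R) \<longrightarrow>
      (\<Sum>e\<in>E. (l' e - l e) * (K l' e - K l e)) \<le> - k * (\<Sum>e\<in>E. (l' e - l e)\<^sup>2)"
    and lip: "\<exists>B>0. \<forall>l l'. (\<forall>e\<in>E. l e \<in> {lo..hi}) \<longrightarrow> (\<forall>e\<in>E. l' e \<in> {lo..hi}) \<longrightarrow>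
      (\<Sum>e\<in>E. (K l' e - K l e)\<^sup>2) \<le> B * (\<Sum>e\<in>E. (l' e - l e)\<^sup>2)"
    and cont: "\<And>X x e. (\<And>e. e \<in> E \<Longrightarrow> x e > 0) \<Longrightarrow> (\<And>e n. e \<in> E \<Longrightarrow> X n e > 0) \<Longrightarrow>
      (\<And>e. e \<in> E \<Longrightarrow> (\<lambda>n. X n e) \<longlonglongrightarrow> x e) \<Longrightarrow> e \<in> E \<Longrightarrow> (\<lambda>n. K (X n) e) \<longlonglongrightarrow> K x e"
    and inward_lo: "\<And>l e. (\<And>e. e \<in> E \<Longrightarrow> l e \<in> {lo..hi}) \<Longrightarrow> e \<in> E \<Longrightarrow> l e \<le> lo + w \<Longrightarrow> K l e \<ge> 0"
    and inward_hi: "\<And>l e. (\<And>e. e \<in> E \<Longrightarrow> l e \<in> {lo..hi}) \<Longrightarrow> e \<in> E \<Longrightarrow> l e \<ge> hi - w \<Longrightarrow> K l e \<le> 0"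
    and bounded: "\<And>l e. e \<in> E \<Longrightarrow> \<bar>K l e\<bar> \<le> C"
begin

lemma zero_exists: "\<exists>l. (\<forall>e\<in>E. l e \<in> {lo..hi}) \<and> (\<forall>e\<in>E. K l e = 0)"
proof -
  obtain k where k: "k > 0" "\<And>l l'. (\<forall>e\<in>E. l e \<in> {lo..hi}) \<Longrightarrow> (\<forall>e\<in>E. l' e > 0 \<and> \<bar>l' e - l e\<bar> \<le> hi -
      lo) \<Longrightarrow>
      (\<Sum>e\<in>E. (l' e - l e) * (K l' e - K l e)) \<le> - k * (\<Sum>e\<in>E. (l' e - l e)\<^sup>2)"
    using strong[of "hi - lo"] lohi by auto
  obtain B where B: "B > 0" "\<And>l l'. (\<forall>e\<in>E. l e \<in> {lo..hi}) \<Longrightarrow> (\<forall>e\<in>E. l' e \<in> {lo..hi}) \<Longrightarrow>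
      (\<Sum>e\<in>E. (K l' e - K l e)\<^sup>2) \<le> B * (\<Sum>e\<in>E. (l' e - l e)\<^sup>2)"
    using lip by auto
  \<comment> \<open>\<open>h \<le> k / B\<close> turns the factor
    \<open>1 - 2 * h * k + h\<^sup>2 * B\<close> into at most \<open>1 - h * k\<close>, and
    \<open>h \<le> 1 / (2 * k)\<close> keeps that positive. The other two bounds limit a step to the
    widths of the collar and of the cube: a coordinate where \<open>K\<close> may point outwards is
    too far from the wall to reach it.\<close>
  define h where "h = min (k / B) (min (1 / (2 * k)) (min (w / (\<bar>C\<bar> + 1)) ((hi - lo) / (\<bar>C\<bar> + 1))))"
  have h: "h > 0" "h \<le> k / B" "h \<le> 1 / (2 * k)" "h \<le> w / (\<bar>C\<bar> + 1)" "h \<le> (hi - lo) / (\<bar>C\<bar> + 1)"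
    using k(1) B(1) w lohi by (simp_all add: h_def min_le_iff_disj)
  have hB: "h * B \<le> k" using h(2) B by (simp add: field_simps)
  have hk: "h * k \<le> 1 / 2" using h(3) k by (simp add: field_simps)
  have hw: "h * (\<bar>C\<bar> + 1) \<le> w" "h * (\<bar>C\<bar> + 1) \<le> hi - lo"
    using h(4,5) by (simp_all add: pos_le_divide_eq add_nonneg_pos)
  define F where "F l = (\<lambda>e. if e \<in> E then l e + h * K l e else l e)" for l
  have F: "F l e \<in> {lo..hi}" if "\<forall>e\<in>E. l e \<in> {lo..hi}" "e \<in> E" for l e
  proof -
    have "h * \<bar>K l e\<bar> \<le> h * (\<bar>C\<bar> + 1)" using bounded[OF that(2), of l] h(1) by (intro
        mult_left_mono) auto
    moreover have "\<bar>h * K l e\<bar> = h * \<bar>K l e\<bar>" using h(1) by (simp add: abs_mult)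
    ultimately have "\<bar>h * K l e\<bar> \<le> w" "\<bar>h * K l e\<bar> \<le> hi - lo" using hw by linarith+
    moreover have "l e > lo + w \<or> h * K l e \<ge> 0"
      using inward_lo[of l e] that h(1) by force
    moreover have "l e < hi - w \<or> h * K l e \<le> 0"
      using inward_hi[of l e] that h(1) by (force simp: mult_le_0_iff)
    moreover have "lo \<le> l e" "l e \<le> hi" using that by auto
    ultimately have "lo \<le> l e + h * K l e \<and> l e + h * K l e \<le> hi" by linarith
    then show ?thesis using that(2) by (simp add: F_def)
  qed
  define q where "q = 1 - h * k"
  have q: "0 < q" "q < 1" using hk h(1) k by (auto simp: q_def)
  have contr: "(\<Sum>e\<in>E. (F l' e - F l e)\<^sup>2) \<le> q * (\<Sum>e\<in>E. (l' e - l e)\<^sup>2)"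
    if "\<forall>e\<in>E. l e \<in> {lo..hi}" "\<forall>e\<in>E. l' e \<in> {lo..hi}" for l l'
  proof -
    define D where "D = (\<Sum>e\<in>E. (l' e - l e)\<^sup>2)"
    have "D \<ge> 0" unfolding D_def by (intro sum_nonneg) auto
    have "(\<Sum>e\<in>E. (F l' e - F l e)\<^sup>2)
        = (\<Sum>e\<in>E. (l' e - l e)\<^sup>2 + 2 * h * ((l' e - l e) * (K l' e - K l e)) + h\<^sup>2 * (K l' e - K l
            e)\<^sup>2)"
      by (intro sum.cong) (simp_all add: F_def power2_eq_square algebra_simps)
    also have "\<dots> = D + 2 * h * (\<Sum>e\<in>E. (l' e - l e) * (K l' e - K l e)) + h\<^sup>2 * (\<Sum>e\<in>E. (K l' e - K l
        e)\<^sup>2)"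
      by (simp add: D_def sum.distrib sum_distrib_left)
    also have "\<dots> \<le> D + 2 * h * (- k * D) + h\<^sup>2 * (B * D)"
    proof -
      have "\<forall>e\<in>E. l' e > 0 \<and> \<bar>l' e - l e\<bar> \<le> hi - lo" using that lo by (auto simp: abs_le_iff; force)
      then show ?thesis
        unfolding D_def using k(2)[of l l'] B(2)[of l l'] that h(1)
        by (intro add_mono mult_left_mono) auto
    qed
    also have "\<dots> = (1 - 2 * h * k + h * (h * B)) * D" by (simp add: algebra_simps power2_eq_square)
    also have "\<dots> \<le> q * D"
      using hB h(1) \<open>D \<ge> 0\<close> by (intro mult_right_mono) (simp_all add: q_def mult.assoc)
    finally show ?thesis by (simp add: D_def)
  qed
  define X where "X n = (F ^^ n) (\<lambda>_. lo)" for n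
  have XS: "X (Suc n) = F (X n)" for n by (simp add: X_def)
  have box: "\<forall>e\<in>E. X n e \<in> {lo..hi}" for n
    by (induction n) (use lohi F in \<open>auto simp: X_def\<close>)
  define D0 where "D0 = (\<Sum>e\<in>E. (X 1 e - X 0 e)\<^sup>2)"
  have "D0 \<ge> 0" unfolding D0_def by (intro sum_nonneg) auto
  have "(\<Sum>e\<in>E. (X (Suc n) e - X n e)\<^sup>2) \<le> q ^ n * D0" for n
  proof (induction n)
    case (Suc n)
    have "(\<Sum>e\<in>E. (X (Suc (Suc n)) e - X (Suc n) e)\<^sup>2) \<le> q * (\<Sum>e\<in>E. (X (Suc n) e - X n e)\<^sup>2)"
      using contr[OF box[of n] box[of "Suc n"]] by (simp only: XS)
    also have "\<dots> \<le> q * (q ^ n * D0)" using Suc q by (intro mult_left_mono) auto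
    finally show ?case by simp
  qed (simp add: D0_def)
  note geo = this
  have step: "\<bar>X (Suc n) e - X n e\<bar> \<le> sqrt D0 * sqrt q ^ n" if "e \<in> E" for n e
  proof -
    have "(X (Suc n) e - X n e)\<^sup>2 \<le> q ^ n * D0"
      using geo[of n] member_le_sum_sq[OF fin that, of "\<lambda>e. X (Suc n) e - X n e"] by linarith
    then have "\<bar>X (Suc n) e - X n e\<bar> \<le> sqrt (q ^ n * D0)" by (simp add: real_le_rsqrt)
    then show ?thesis by (simp add: real_sqrt_mult real_sqrt_power mult.commute)
  qed
  have "convergent (\<lambda>n. X n e)" if "e \<in> E" for e
  proof -
    have "summable (\<lambda>n. X (Suc n) e - X n e)"
    proof (rule summable_comparison_test)
      show "\<exists>N. \<forall>n\<ge>N. norm (X (Suc n) e - X n e) \<le> sqrt D0 * sqrt q ^ n" using step[OF that] by auto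
      show "summable (\<lambda>n. sqrt D0 * sqrt q ^ n)" using q by (intro summable_mult summable_geometric)
          auto
    qed
    then have "convergent (\<lambda>n. X n e - X 0 e)"
      using sum_lessThan_telescope[of "\<lambda>n. X n e"] by (simp add: summable_iff_convergent)
    then show ?thesis using convergent_diff_const_right_iff by blast
  qed
  then obtain x where x: "\<And>e. e \<in> E \<Longrightarrow> (\<lambda>n. X n e) \<longlonglongrightarrow> x e"
    unfolding convergent_def by metis
  have xbox: "x e \<in> {lo..hi}" if "e \<in> E" for e
    using x[OF that] box that
    by (meson LIMSEQ_le_const LIMSEQ_le_const2 atLeastAtMost_iff)
  have "K x e = 0" if "e \<in> E" for e
  proof -
    have "(\<lambda>n. K (X n) e) \<longlonglongrightarrow> K x e"
    proof (rule cont[OF _ _ x that])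
      show "x e > 0" if "e \<in> E" for e using xbox[OF that] lo by auto
      show "X n e > 0" if "e \<in> E" for e n using bspec[OF box that, of n] lo by auto
    qed
    moreover have "(\<lambda>n. K (X n) e) \<longlonglongrightarrow> 0"
    proof -
      have "(\<lambda>n. (X (Suc n) e - X n e) / h) \<longlonglongrightarrow> (x e - x e) / h"
        using x[OF that] h(1) by (intro tendsto_intros LIMSEQ_Suc) auto
      moreover have "(X (Suc n) e - X n e) / h = K (X n) e" for n
        using h(1) that by (simp add: XS F_def)
      ultimately show ?thesis by simp
    qed
    ultimately show ?thesis by (rule LIMSEQ_unique)
  qed
  then show ?thesis using xbox by blast
qed

text \<open>\<open>strong\<close> asks only one of the two points to lie in the cube, so zeros far
  outside, even degenerate ones, are excluded as well.\<close>

lemma zero_unique: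
  assumes "\<And>e. e \<in> E \<Longrightarrow> l e \<in> {lo..hi}" "\<And>e. e \<in> E \<Longrightarrow> K l e = 0"
    and "\<And>e. e \<in> E \<Longrightarrow> l' e > 0" "\<And>e. e \<in> E \<Longrightarrow> K l' e = 0" and "e \<in> E"
  shows "l' e = l e"
proof -
  define R where "R = (\<Sum>e\<in>E. \<bar>l' e - l e\<bar>) + 1"
  have "\<bar>l' e - l e\<bar> \<le> R" if "e \<in> E" for e
    using member_le_sum[OF that, of "\<lambda>e. \<bar>l' e - l e\<bar>"] fin by (simp add: R_def)
  moreover have "R > 0" unfolding R_def by (intro add_nonneg_pos sum_nonneg) auto
  ultimately obtain k where k: "k > 0"
    "(\<Sum>e\<in>E. (l' e - l e) * (K l' e - K l e)) \<le> - k * (\<Sum>e\<in>E. (l' e - l e)\<^sup>2)"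
    using strong[of R] assms(1,3) by blast
  have "(\<Sum>e\<in>E. (l' e - l e) * (K l' e - K l e)) = 0" using assms(2,4) by simp
  then have "(\<Sum>e\<in>E. (l' e - l e)\<^sup>2) \<le> 0" using k by (simp add: mult_le_0_iff)
  then have "(\<Sum>e\<in>E. (l' e - l e)\<^sup>2) = 0" by (simp add: antisym sum_nonneg)
  then show ?thesis using sum_sq_eq_0_iff[OF fin, of "\<lambda>e. l' e - l e"] \<open>e \<in> E\<close> by simp
qed

text \<open>For \<open>u = ln L\<close> the equation reads \<open>u' = K (exp u)\<close>. Its
  right-hand side is bounded and defined everywhere, which yields positivity and infinite lifetime
  at once.\<close>

lemma flow_exists:
  assumes "\<And>e. e \<in> E \<Longrightarrow> l0 e > 0"
  shows "\<exists>L. (\<forall>e\<in>E. L 0 e = l0 e) \<and> (\<forall>t e. L t e > 0) \<and>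
    (\<forall>t\<ge>0. \<forall>e\<in>E. ((\<lambda>s. L s e) has_real_derivative K (L t) e * L t e) (at t within {0..}))"
proof -
  have "\<exists>u. (\<forall>e\<in>E. u 0 e = ln (l0 e)) \<and>
    (\<forall>t\<ge>0. \<forall>e\<in>E. ((\<lambda>s. u s e) has_real_derivative K (\<lambda>e. exp (u t e)) e) (at t within {0..}))"
    by (rule peano_global[OF fin, of "\<lambda>u. K (\<lambda>e. exp (u e))" C])
      (auto intro!: bounded cont tendsto_intros)
  then obtain u where u: "\<And>e. e \<in> E \<Longrightarrow> u 0 e = ln (l0 e)"
    "\<And>t e. t \<ge> 0 \<Longrightarrow> e \<in> E \<Longrightarrow> ((\<lambda>s. u s e) has_real_derivative K (\<lambda>e. exp (u t e)) e) (at t within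
        {0..})"
    by blast
  show ?thesis
    by (intro exI[of _ "\<lambda>t e. exp (u t e)"])
      (use u assms in \<open>auto intro!: derivative_eq_intros\<close>)
qed

text \<open>The function \<open>\<Sum>\<^sub>e (L e - x e - x e ln (L e / x e))\<close> is decreasing along the flow, for its
    derivative is
  \<open>\<Sum>\<^sub>e (L e - x e) (K L e - K x e)\<close>; its sublevel sets are compact in the positive functions.\<close>

lemma flow_converges:
  assumes x: "\<And>e. e \<in> E \<Longrightarrow> x e \<in> {lo..hi}" and Kx: "\<And>e. e \<in> E \<Longrightarrow> K x e = 0"
    and pos: "\<And>t e. t \<ge> 0 \<Longrightarrow> e \<in> E \<Longrightarrow> L t e > 0"
    and der: "\<And>t e. t \<ge> 0 \<Longrightarrow> e \<in> E \<Longrightarrow> ((\<lambda>s. L s e) has_real_derivative K (L t) e * L t e) (at t within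
        {0..})"
  shows "\<exists>A>0. \<exists>lam>0. \<forall>t\<ge>0. L2_set (\<lambda>e. L t e - x e) E \<le> A * exp (- lam * t)"
proof -
  have xpos: "x e > 0" if "e \<in> E" for e using x[OF that] lo by auto
  define r where "r t e = L t e / x e" for t e
  have r: "r t e > 0" if "t \<ge> 0" "e \<in> E" for t e using pos[OF that] xpos that by (simp add: r_def)
  define V where "V t = (\<Sum>e\<in>E. x e * (r t e - 1 - ln (r t e)))" for t
  define P where "P t = (\<Sum>e\<in>E. (L t e - x e) * (K (L t) e - K x e))" for t
  define D where "D t = (\<Sum>e\<in>E. (L t e - x e)\<^sup>2)" for t
  have D0: "D t \<ge> 0" for t unfolding D_def by (intro sum_nonneg) auto
  have term0: "x e * (r t e - 1 - ln (r t e)) \<ge> 0" if "t \<ge> 0" "e \<in> E" for t e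
    using ln_le_minus_one[OF r[OF that]] xpos[OF that(2)] by simp
  have dV: "(V has_real_derivative P t) (at t within {0..})" if t: "t \<ge> 0" for t
  proof -
    have "((\<lambda>t. x e * (r t e - 1 - ln (r t e))) has_real_derivative (L t e - x e) * (K (L t) e - K x
        e)) (at t within {0..})"
      if e: "e \<in> E" for e
      unfolding r_def using pos[OF t e] xpos[OF e] Kx[OF e]
      by (auto intro!: derivative_eq_intros der[OF t e] simp: field_simps)
    then show ?thesis unfolding V_def P_def by (rule DERIV_sum)
  qed
  have "P t \<le> 0" if "t \<ge> 0" for t
    unfolding P_def by (rule mono) (use pos xpos that in auto)
  then have V0: "V t \<le> V 0" if "t \<ge> 0" for t
    using nonincreasing_on_halfline[OF dV _ that] by blast
  define c where "c = V 0 / lo"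
  have "V 0 \<ge> 0" unfolding V_def by (intro sum_nonneg term0) auto
  have rV: "r t e - 1 - ln (r t e) \<le> c" if "t \<ge> 0" "e \<in> E" for t e
  proof -
    have "x e * (r t e - 1 - ln (r t e)) \<le> V t"
      unfolding V_def by (rule member_le_sum[OF that(2)]) (use term0 that fin in auto)
    then have "x e * (r t e - 1 - ln (r t e)) \<le> V 0" using V0[OF that(1)] by simp
    moreover have "lo * (r t e - 1 - ln (r t e)) \<le> x e * (r t e - 1 - ln (r t e))"
      using x[OF that(2)] ln_le_minus_one[OF r[OF that]] by (intro mult_right_mono) auto
    ultimately show ?thesis using lo by (simp add: c_def field_simps)
  qed
  \<comment> \<open>The bounds \<open>a\<close> and \<open>b\<close> solve
    \<open>r - 1 - ln r \<le> c\<close> for \<open>r\<close>: from below by dropping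
    \<open>r\<close>, from above by \<open>ln (r / 2) \<le> r / 2 - 1\<close> and
    \<open>ln 2 \<le> 1\<close>.\<close>
  define b where "b = 2 * (c + 1)"
  define a where "a = exp (- 1 - c)"
  have "c \<ge> 0" using \<open>V 0 \<ge> 0\<close> lo by (simp add: c_def)
  have ab: "a \<le> r t e" "r t e \<le> b" if "t \<ge> 0" "e \<in> E" for t e
  proof -
    have "ln (r t e) \<ge> - 1 - c" using rV[OF that] r[OF that] by linarith
    then show "a \<le> r t e" unfolding a_def using r[OF that] by (metis exp_le_cancel_iff exp_ln)
    have "ln (r t e / 2) \<le> r t e / 2 - 1" using r[OF that] by (intro ln_le_minus_one) auto
    moreover have "ln (r t e / 2) = ln (r t e) - ln 2" using r[OF that] by (simp add: ln_div)
    moreover have "ln 2 \<le> (1 :: real)" using ln_le_minus_one[of 2] by simp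
    ultimately show "r t e \<le> b" using rV[OF that] by (simp add: b_def)
  qed
  have Lr: "L t e = x e * r t e" if "e \<in> E" for t e using xpos[OF that] by (simp add: r_def)
  have "\<bar>L t e - x e\<bar> \<le> hi * (b + 1)" if "t \<ge> 0" "e \<in> E" for t e
  proof -
    have "L t e - x e = x e * (r t e - 1)" by (simp add: Lr[OF that(2)] algebra_simps)
    then have "\<bar>L t e - x e\<bar> = x e * \<bar>r t e - 1\<bar>" using xpos[OF that(2)] by (simp add: abs_mult)
    also have "\<dots> \<le> hi * (b + 1)"
      using x[OF that(2)] lo ab[OF that] r[OF that] by (intro mult_mono) auto
    finally show ?thesis .
  qed
  note dist = this
  have "hi * (b + 1) > 0" using lo lohi \<open>c \<ge> 0\<close> by (simp add: b_def)
  from strong[OF this] obtain k where k1: "k > 0"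
    and k2: "\<And>l l'. (\<forall>e\<in>E. l e \<in> {lo..hi}) \<Longrightarrow> (\<forall>e\<in>E. l' e > 0 \<and> \<bar>l' e - l e\<bar> \<le> hi * (b + 1)) \<Longrightarrow>
      (\<Sum>e\<in>E. (l' e - l e) * (K l' e - K l e)) \<le> - k * (\<Sum>e\<in>E. (l' e - l e)\<^sup>2)" by blast
  have "P t \<le> - k * D t" if "t \<ge> 0" for t
    unfolding P_def D_def by (rule k2) (use x pos dist that in auto)
  note k = k1 this
  have VD: "V t \<le> D t / (lo * a)" if "t \<ge> 0" for t
  proof -
    have "x e * (r t e - 1 - ln (r t e)) \<le> (L t e - x e)\<^sup>2 / (lo * a)" if e: "e \<in> E" for e
    proof -
      have "x e * (r t e - 1 - ln (r t e)) \<le> x e * ((r t e - 1)\<^sup>2 / r t e)"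
        using log_ratio_upper[OF r[OF \<open>t \<ge> 0\<close> e]] xpos[OF e] by (intro mult_left_mono) auto
      also have "\<dots> = (L t e - x e)\<^sup>2 / (x e * r t e)"
        unfolding Lr[OF e] using xpos[OF e] r[OF \<open>t \<ge> 0\<close> e] by (simp add: field_simps
            power2_eq_square)
      also have "\<dots> \<le> (L t e - x e)\<^sup>2 / (lo * a)"
        using x[OF e] lo ab[OF \<open>t \<ge> 0\<close> e] by (intro divide_left_mono mult_mono mult_pos_pos) (auto
            simp: a_def r \<open>t \<ge> 0\<close> e xpos)
      finally show ?thesis .
    qed
    then show ?thesis unfolding V_def D_def sum_divide_distrib by (rule sum_mono)
  qed
  have DV: "D t \<le> 2 * b * hi * V t" if "t \<ge> 0" for t
  proof -
    have "(L t e - x e)\<^sup>2 \<le> 2 * b * hi * (x e * (r t e - 1 - ln (r t e)))" if e: "e \<in> E" for e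
    proof -
      have b: "b \<ge> 1" using \<open>c \<ge> 0\<close> by (simp add: b_def)
      have "(L t e - x e)\<^sup>2 = x e * (x e * (r t e - 1)\<^sup>2)"
        unfolding Lr[OF e] by (simp add: field_simps power2_eq_square)
      also have "\<dots> \<le> hi * (x e * (r t e - 1)\<^sup>2)" using x[OF e] xpos[OF e] by (intro mult_right_mono)
          auto
      also have "(r t e - 1)\<^sup>2 = 2 * b * ((r t e - 1)\<^sup>2 / (2 * b))" using b by simp
      also have "hi * (x e * (2 * b * ((r t e - 1)\<^sup>2 / (2 * b)))) \<le> hi * (x e * (2 * b * (r t e - 1
          - ln (r t e))))"
        using log_ratio_lower[OF r[OF \<open>t \<ge> 0\<close> e] ab(2)[OF \<open>t \<ge> 0\<close> e] b] b xpos[OF e] lo lohi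
        by (intro mult_left_mono) auto
      finally show ?thesis by (simp add: algebra_simps)
    qed
    then show ?thesis unfolding V_def D_def sum_distrib_left by (rule sum_mono)
  qed
  \<comment> \<open>The rate results from \<open>V' = P \<le> - k * D\<close> and
    \<open>D \<ge> lo * a * V\<close>.\<close>
  define m where "m = k * (lo * a)"
  have m: "m > 0" using k lo by (simp add: m_def a_def)
  have "V t * exp (m * t) \<le> V 0 * exp (m * 0)" if "t \<ge> 0" for t
  proof (rule nonincreasing_on_halfline[where g = "\<lambda>t. V t * exp (m * t)" and g' = "\<lambda>t. (P t + m * V
      t) * exp (m * t)"])
    fix t :: real assume t: "t \<ge> 0"
    show "((\<lambda>t. V t * exp (m * t)) has_real_derivative (P t + m * V t) * exp (m * t)) (at t within
        {0..})"
      by (auto intro!: derivative_eq_intros dV t simp: algebra_simps)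
    have "m * V t \<le> m * (D t / (lo * a))" using VD[OF t] m by (intro mult_left_mono) auto
    also have "\<dots> = k * D t" using lo by (simp add: m_def a_def)
    finally show "(P t + m * V t) * exp (m * t) \<le> 0" using k(2)[OF t] by (simp add: mult_le_0_iff)
  qed fact
  note decay = this
  have Vexp: "V t \<le> V 0 * exp (- (m * t))" if "t \<ge> 0" for t
    using decay[OF that] by (simp add: exp_minus field_simps)
  \<comment> \<open>The distance is \<open>sqrt D\<close>, so it decays at half the rate of
    \<open>V\<close>. The summand 1 keeps \<open>A\<close> positive when
    \<open>V 0 = 0\<close>.\<close>
  define A where "A = sqrt (2 * b * hi * V 0) + 1"
  have "L2_set (\<lambda>e. L t e - x e) E \<le> A * exp (- (m / 2) * t)" if "t \<ge> 0" for t
  proof -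
    have nn: "2 * b * hi \<ge> 0" using \<open>c \<ge> 0\<close> lo lohi by (simp add: b_def)
    have "D t \<le> 2 * b * hi * (V 0 * exp (- (m * t)))"
      using DV[OF that] mult_left_mono[OF Vexp[OF that] nn] by linarith
    also have "\<dots> = (2 * b * hi * V 0) * (exp (- (m / 2) * t))\<^sup>2"
      by (simp add: power2_eq_square flip: exp_add)
    finally have "sqrt (D t) \<le> sqrt ((2 * b * hi * V 0) * (exp (- (m / 2) * t))\<^sup>2)" by simp
    also have "\<dots> = sqrt (2 * b * hi * V 0) * exp (- (m / 2) * t)" by (simp add: real_sqrt_mult)
    also have "\<dots> \<le> A * exp (- (m / 2) * t)" by (simp add: A_def)
    finally show ?thesis by (simp add: L2_set_def D_def)
  qed
  moreover have "A > 0"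
    using \<open>c \<ge> 0\<close> lo lohi \<open>V 0 \<ge> 0\<close> by (simp add: A_def b_def add_nonneg_pos)
  ultimately show ?thesis using m by (meson half_gt_zero)
qed

end

section \<open>Edges of the triangulation\<close>

lemma pairs_4: "{s :: 4 set. card s = 2} = {{1, 2}, {1, 3}, {1, 4}, {2, 3}, {2, 4}, {3, 4}}"
proof (intro set_eqI iffI)
  fix s :: "4 set" assume "s \<in> {s. card s = 2}"
  then obtain x y where "s = {x, y}" "x \<noteq> y" by (auto simp: card_2_iff)
  then show "s \<in> {{1, 2}, {1, 3}, {1, 4}, {2, 3}, {2, 4}, {3, 4}}"
    using exhaust_4[of x] exhaust_4[of y] insert_commute[of y x "{}"] by (elim disjE) simp_all
next
  fix s :: "4 set" assume "s \<in> {{1, 2}, {1, 3}, {1, 4}, {2, 3}, {2, 4}, {3, 4}}"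
  then show "s \<in> {s. card s = 2}" by (elim insertE emptyE) simp_all
qed

definition sixof :: "(4 set \<Rightarrow> real) \<Rightarrow> six" where
  "sixof l = (l {1, 2}, l {1, 3}, l {1, 4}, l {2, 3}, l {2, 4}, l {3, 4})"

lemma sum_pairs_4: "(\<Sum>s\<in>{s :: 4 set. card s = 2}. f s) = f {1, 2} + f {1, 3} + f {1, 4} + f {2, 3} +
    f {2, 4} + f {3, 4}"
  for f :: "4 set \<Rightarrow> real"
  unfolding pairs_4 by (simp add: doubleton_eq_iff)

lemma sum_pairs_4_inner: "(\<Sum>s\<in>{s :: 4 set. card s = 2}. f s * g s) = sixof f \<bullet> sixof g"
  by (simp add: sum_pairs_4 sixof_def)

lemma extended_angle_tang:
  assumes "distinct [i, j, k, h]"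
  shows "extended_angle l {i, j} = tang (cosh (l {i, j})) (cosh (l {k, h})) (cosh (l {i, k})) (cosh
      (l {i, h}))
    (cosh (l {j, k})) (cosh (l {j, h}))"
proof -
  have "phi l i j k h = tphi (cosh (l {i, j})) (cosh (l {k, h})) (cosh (l {i, k})) (cosh (l {i, h}))
    (cosh (l {j, k})) (cosh (l {j, h}))"
    unfolding phi_def Let_def tphi_def tnum_def tface_def
    by (simp add: cosh_square_eq algebra_simps)
  then show ?thesis by (simp add: extended_angle_eq[OF assms] tang_def)
qed

lemma sixof_extended_angle: "sixof (extended_angle l) = angles (sixof l)"
  by (simp add: sixof_def angles_def tangs_def sixmap_def extended_angle_tang[of 1 2 3 4]
      extended_angle_tang[of 1 3 2 4] extended_angle_tang[of 1 4 2 3] extended_angle_tang[of 2 3 1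
          4]
      extended_angle_tang[of 2 4 1 3] extended_angle_tang[of 3 4 1 2] insert_commute)

lemma pair_4_cases:
  fixes s :: "4 set"
  assumes "card s = 2"
  obtains i j k h where "distinct [i, j, k, h]" "s = {i, j}" "- s = {k, h}"
proof -
  obtain i j where ij: "s = {i, j}" "i \<noteq> j" using assms by (auto simp: card_2_iff)
  have "card (- s) = 2" using assms by (simp add: Compl_eq_Diff_UNIV card_Diff_subset)
  then obtain k h where kh: "- s = {k, h}" "k \<noteq> h" by (auto simp: card_2_iff)
  have "k \<notin> s" "h \<notin> s" using kh(1) by blast+
  then have "distinct [i, j, k, h]" using ij kh(2) by auto
  then show thesis using ij(1) kh(1) that by blast
qed

definition sixbox :: "real \<Rightarrow> real \<Rightarrow> six set" where
  "sixbox a b = {a..b} \<times> {a..b} \<times> {a..b} \<times> {a..b} \<times> {a..b} \<times> {a..b}"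

lemma compact_sixbox: "compact (sixbox a b)"
  unfolding sixbox_def by (intro compact_Times compact_Icc)

lemma convex_sixbox: "convex (sixbox a b)"
  unfolding sixbox_def by (intro convex_Times convex_real_interval)

lemma sixof_diff: "sixof l - sixof l' = sixof (\<lambda>s. l s - l' s)"
  by (simp add: sixof_def)

lemma norm_sixof_sq: "(norm (sixof l))\<^sup>2 = (\<Sum>s\<in>{s. card s = 2}. (l s)\<^sup>2)"
  unfolding power2_norm_eq_inner by (simp add: power2_eq_square sum_pairs_4_inner)

lemma norm_sixof_le:
  assumes "\<And>s. card s = 2 \<Longrightarrow> \<bar>l s\<bar> \<le> R"
  shows "norm (sixof l) \<le> 6 * R"
proof -
  have "norm (sixof l) \<le> \<bar>l {1, 2}\<bar> + (\<bar>l {1, 3}\<bar> + (\<bar>l {1, 4}\<bar> + (\<bar>l {2, 3}\<bar> + (\<bar>l {2, 4}\<bar> + \<bar>l {3,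
      4}\<bar>))))"
    unfolding sixof_def
    using norm_Pair_le[of "l {1, 2}" "(l {1, 3}, l {1, 4}, l {2, 3}, l {2, 4}, l {3, 4})"]
      norm_Pair_le[of "l {1, 3}" "(l {1, 4}, l {2, 3}, l {2, 4}, l {3, 4})"]
      norm_Pair_le[of "l {1, 4}" "(l {2, 3}, l {2, 4}, l {3, 4})"]
      norm_Pair_le[of "l {2, 3}" "(l {2, 4}, l {3, 4})"] norm_Pair_le[of "l {2, 4}" "l {3, 4}"]
    unfolding real_norm_def by linarith
  also have "\<dots> \<le> R + (R + (R + (R + (R + R))))"
    by (intro add_mono assms) auto
  finally show ?thesis by simp
qed

lemma dist_Pair_leD: "dist (x, y) (x', y') \<le> r \<Longrightarrow> dist x x' \<le> r \<and> dist y y' \<le> r"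
  using dist_fst_le[of "(x, y)" "(x', y')"] dist_snd_le[of "(x, y)" "(x', y')"] by simp

lemma cball_sixbox: "cball l r \<subseteq> sixbox (a - r) (b + r)" if "l \<in> sixbox a b"
proof
  fix m assume "m \<in> cball l r"
  obtain a1 a2 a3 a4 a5 a6 where l: "l = (a1, a2, a3, a4, a5, a6)" by (metis prod.exhaust)
  obtain b1 b2 b3 b4 b5 b6 where m: "m = (b1, b2, b3, b4, b5, b6)" by (metis prod.exhaust)
  have "\<bar>a1 - b1\<bar> \<le> r \<and> \<bar>a2 - b2\<bar> \<le> r \<and> \<bar>a3 - b3\<bar> \<le> r \<and> \<bar>a4 - b4\<bar> \<le> r \<and> \<bar>a5 - b5\<bar> \<le> r \<and> \<bar>a6 - b6\<bar> \<le>
      r"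
    using \<open>m \<in> cball l r\<close> unfolding l m mem_cball
    by (auto dest!: dist_Pair_leD simp: dist_real_def)
  then show "m \<in> sixbox (a - r) (b + r)"
    using that by (simp add: sixbox_def l m abs_le_iff)
qed

lemma sixbox_admissible:
  assumes "0 < a" "b \<le> arcosh (11/5)"
  shows "sixbox a b \<subseteq> {l \<in> sixpos. sixdelta (sixmap cosh l) > 0}"
proof
  fix l assume l: "l \<in> sixbox a b"
  have "cosh x \<in> {1..11/5}" if "x \<in> {a..b}" for x
  proof -
    have "cosh x \<le> cosh (arcosh (11/5))"
      using that assms by (intro cosh_real_nonneg_le_iff[THEN iffD2]) auto
    then show ?thesis by (simp add: cosh_real_ge_1)
  qed
  then show "l \<in> {l \<in> sixpos. sixdelta (sixmap cosh l) > 0}"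
    using l assms(1) by (auto simp: sixbox_def sixpos_def sixdelta_def sixmap_def intro!:
        tdelta_pos_box)
qed

section \<open>From single tetrahedra to the curvature of the triangulation\<close>

lemma edge_proj_in_edges: "a \<in> tet_edges M \<Longrightarrow> edge_proj M a \<in> edges M"
  unfolding edges_def edge_proj_def by (rule quotientI)

lemma finite_tet_edges: "finite (tets M) \<Longrightarrow> finite (tet_edges M)"
  unfolding tet_edges_def by (intro finite_cartesian_product) simp_all

lemma finite_edges: "finite (tets M) \<Longrightarrow> finite (edges M)"
  unfolding edges_def using finite_tet_edges
  by (metis edge_equiv_def finite_quotient inf_le2 )

lemma sum_edge_fibres:
  assumes "finite (tets M)"
  shows "(\<Sum>e\<in>edges M. \<Sum>a\<in>edge_fibre M e. g a) = (\<Sum>j\<in>tets M. \<Sum>s\<in>{s. card s = 2}. g (j, s))"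
proof -
  have "(\<Sum>e\<in>edges M. \<Sum>a\<in>{a. a \<in> tet_edges M \<and> edge_proj M a = e}. g a) = sum g (tet_edges M)"
    by (rule sum.group) (use assms finite_tet_edges finite_edges edge_proj_in_edges in auto)
  also have "\<dots> = (\<Sum>j\<in>tets M. \<Sum>s\<in>{s. card s = 2}. g (j, s))"
    unfolding tet_edges_def by (simp add: sum.cartesian_product case_prod_unfold)
  finally show ?thesis by (simp add: edge_fibre_def)
qed

lemma tet_lengths_fibre: "(j, s) \<in> edge_fibre M e \<Longrightarrow> tet_lengths M l j s = l e"
  by (auto simp: edge_fibre_def tet_lengths_def)

text \<open>Summation over fibres is adjoint to pulling lengths back to the tetrahedra, so the
  pairing splits into one pairing per tetrahedron, and \<open>- K\<close> inherits the monotonicity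
  of the angles.\<close>

lemma sum_mult_ricci_diff:
  assumes "finite (tets M)"
  shows "(\<Sum>e\<in>edges M. (l' e - l e) * (generalized_ricci M l' e - generalized_ricci M l e))
    = - (\<Sum>j\<in>tets M. (sixof (tet_lengths M l' j) - sixof (tet_lengths M l j))
        \<bullet> (angles (sixof (tet_lengths M l' j)) - angles (sixof (tet_lengths M l j))))"
proof -
  define g where "g = (\<lambda>(j, s). (tet_lengths M l' j s - tet_lengths M l j s)
    * (extended_angle (tet_lengths M l' j) s - extended_angle (tet_lengths M l j) s))"
  have "(l' e - l e) * (generalized_ricci M l' e - generalized_ricci M l e) = - (\<Sum>a\<in>edge_fibre M e.
      g a)" for e
  proof -
    have "(\<Sum>a\<in>edge_fibre M e. g a) = (\<Sum>(j, s)\<in>edge_fibre M e. (l' e - l e)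
        * (extended_angle (tet_lengths M l' j) s - extended_angle (tet_lengths M l j) s))"
      unfolding g_def by (intro sum.cong) (auto simp: tet_lengths_fibre)
    also have "\<dots> = (l' e - l e) * (\<Sum>(j, s)\<in>edge_fibre M e.
        (extended_angle (tet_lengths M l' j) s - extended_angle (tet_lengths M l j) s))"
      by (simp add: sum_distrib_left case_prod_unfold)
    also have "\<dots> = - ((l' e - l e) * (generalized_ricci M l' e - generalized_ricci M l e))"
      by (simp add: generalized_ricci_def sum_subtractf case_prod_unfold algebra_simps)
    finally show ?thesis by simp
  qed
  then have "(\<Sum>e\<in>edges M. (l' e - l e) * (generalized_ricci M l' e - generalized_ricci M l e))
      = - (\<Sum>e\<in>edges M. \<Sum>a\<in>edge_fibre M e. g a)"
    by (simp add: sum_negf)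
  also have "\<dots> = - (\<Sum>j\<in>tets M. \<Sum>s\<in>{s. card s = 2}. g (j, s))"
    by (simp add: sum_edge_fibres[OF assms])
  also have "\<dots> = - (\<Sum>j\<in>tets M. (sixof (tet_lengths M l' j) - sixof (tet_lengths M l j))
        \<bullet> (angles (sixof (tet_lengths M l' j)) - angles (sixof (tet_lengths M l j))))"
    unfolding g_def prod.case sum_pairs_4_inner by (simp only: sixof_diff
        sixof_extended_angle[symmetric])
  finally show ?thesis .
qed

text \<open>Grouped by fibres, the right-hand side contains each square on the left as often as the
  valence of its edge. This carries strong monotonicity from tetrahedra to edge functions.\<close>

lemma sum_sq_le_sum_norm:
  assumes "finite (tets M)" and "\<And>e. e \<in> edges M \<Longrightarrow> valence M e \<ge> 1"
  shows "(\<Sum>e\<in>edges M. (l' e - l e)\<^sup>2)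
    \<le> (\<Sum>j\<in>tets M. (norm (sixof (tet_lengths M l' j) - sixof (tet_lengths M l j)))\<^sup>2)"
proof -
  have "(l' e - l e)\<^sup>2 \<le> (\<Sum>a\<in>edge_fibre M e. (tet_lengths M l' (fst a) (snd a) - tet_lengths M l
      (fst a) (snd a))\<^sup>2)"
    if e: "e \<in> edges M" for e
  proof -
    have "(\<Sum>a\<in>edge_fibre M e. (tet_lengths M l' (fst a) (snd a) - tet_lengths M l (fst a) (snd
        a))\<^sup>2)
        = (\<Sum>a\<in>edge_fibre M e. (l' e - l e)\<^sup>2)"
      by (intro sum.cong) (auto simp: tet_lengths_fibre)
    also have "\<dots> = real (valence M e) * (l' e - l e)\<^sup>2" by (simp add: valence_def)
    also have "\<dots> \<ge> 1 * (l' e - l e)\<^sup>2" using assms(2)[OF e] by (intro mult_right_mono) auto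
    finally show ?thesis by simp
  qed
  then have "(\<Sum>e\<in>edges M. (l' e - l e)\<^sup>2)
    \<le> (\<Sum>e\<in>edges M. \<Sum>a\<in>edge_fibre M e. (tet_lengths M l' (fst a) (snd a) - tet_lengths M l (fst a)
        (snd a))\<^sup>2)"
    by (rule sum_mono)
  also have "\<dots> = (\<Sum>j\<in>tets M. (norm (sixof (tet_lengths M l' j) - sixof (tet_lengths M l j)))\<^sup>2)"
    by (simp add: sum_edge_fibres[OF assms(1)] sixof_diff norm_sixof_sq)
  finally show ?thesis .
qed

lemma extended_angle_cong:
  assumes "\<And>s. card s = 2 \<Longrightarrow> l s = l' s" and "card s = 2"
  shows "extended_angle l s = extended_angle l' s"
proof -
  obtain i j k h where s: "distinct [i, j, k, h]" "s = {i, j}" by (rule pair_4_cases[OF assms(2)])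
  then have "card {i, j} = 2" "card {k, h} = 2" "card {i, k} = 2" "card {i, h} = 2" "card {j, k} =
      2" "card {j, h} = 2"
    by auto
  then show ?thesis unfolding s(2) extended_angle_tang[OF s(1)] by (simp only: assms(1))
qed

lemma extended_angle_bounds:
  assumes "card s = 2"
  shows "0 \<le> extended_angle l s" "extended_angle l s \<le> pi"
proof -
  obtain i j k h where s: "distinct [i, j, k, h]" "s = {i, j}" by (rule pair_4_cases[OF assms])
  show "0 \<le> extended_angle l s" "extended_angle l s \<le> pi"
    unfolding s(2) extended_angle_eq[OF s(1)] by (intro arccos_lbound arccos_ubound; simp)+
qed

lemma abs_le_norm_sixof: "\<bar>f s\<bar> \<le> norm (sixof f)" if "card s = 2"
proof -
  have "(f s)\<^sup>2 \<le> (norm (sixof f))\<^sup>2"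
    unfolding norm_sixof_sq by (rule member_le_sum) (use that in auto)
  then show ?thesis by (simp add: abs_le_square_iff[symmetric])
qed

lemma tendsto_extended_angle:
  fixes X :: "nat \<Rightarrow> 4 set \<Rightarrow> real"
  assumes "\<And>s. card s = 2 \<Longrightarrow> x s > 0" "\<And>n s. card s = 2 \<Longrightarrow> X n s > 0"
    and "\<And>s. card s = 2 \<Longrightarrow> (\<lambda>n. X n s) \<longlonglongrightarrow> x s" and "card s = 2"
  shows "(\<lambda>n. extended_angle (X n) s) \<longlonglongrightarrow> extended_angle x s"
proof -
  have "(\<lambda>n. sixof (X n)) \<longlonglongrightarrow> sixof x"
    unfolding sixof_def by (intro tendsto_Pair assms(3)) simp_all
  then have "(\<lambda>n. angles (sixof (X n))) \<longlonglongrightarrow> angles (sixof x)"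
    by (rule continuous_on_tendsto_compose[OF continuous_on_angles])
      (use assms(1,2) in \<open>auto simp: sixof_def sixpos_def\<close>)
  then have "(\<lambda>n. norm (sixof (\<lambda>s. extended_angle (X n) s - extended_angle x s))) \<longlonglongrightarrow> 0"
    by (simp add: LIM_zero_iff tendsto_norm_zero_iff sixof_extended_angle[symmetric] flip:
        sixof_diff)
  then have "(\<lambda>n. extended_angle (X n) s - extended_angle x s) \<longlonglongrightarrow> 0"
  proof (rule Lim_null_comparison[rotated], intro always_eventually allI)
    show "norm (extended_angle (X n) s - extended_angle x s)
        \<le> norm (sixof (\<lambda>s. extended_angle (X n) s - extended_angle x s))" for n
      using abs_le_norm_sixof[OF assms(4), of "\<lambda>s. extended_angle (X n) s - extended_angle x s"] by
          simp
  qed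
  then show ?thesis by (simp add: LIM_zero_iff)
qed

lemma tet_edge_card: "(j, s) \<in> edge_fibre M e \<Longrightarrow> j \<in> tets M \<and> card s = 2"
  by (simp add: edge_fibre_def tet_edges_def)

lemma edge_proj_mem: "j \<in> tets M \<Longrightarrow> card s = 2 \<Longrightarrow> edge_proj M (j, s) \<in> edges M"
  by (rule edge_proj_in_edges) (simp add: tet_edges_def)

lemma angle_near_upper_bound:
  assumes "\<And>s. card s = 2 \<Longrightarrow> l s \<in> {0<..arcosh 2}" and "card s = 2" and "l s \<ge> arcosh (19/10)"
  shows "extended_angle l s > pi / 5"
proof -
  obtain i j k h where s: "distinct [i, j, k, h]" "s = {i, j}" by (rule pair_4_cases[OF assms(2)])
  have c: "1 < cosh (l s) \<and> cosh (l s) \<le> 2" if "card s = 2" for s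
  proof -
    have "cosh (l s) \<le> cosh (arcosh 2)"
      using assms(1)[OF that] by (intro cosh_real_nonneg_le_iff[THEN iffD2]) auto
    then show ?thesis using assms(1)[OF that] by (simp add: cosh_real_gt_1)
  qed
  have "cosh (arcosh (19/10)) \<le> cosh (l {i, j})"
    using assms(3) assms(1)[OF assms(2)] s(2) by (intro cosh_real_nonneg_le_iff[THEN iffD2]) auto
  then have "19/10 \<le> cosh (l {i, j})" by simp
  moreover have "card {i, j} = 2" "card {k, h} = 2" "card {i, k} = 2" "card {i, h} = 2" "card {j, k}
      = 2" "card {j, h} = 2"
    using s by auto
  ultimately show ?thesis
    unfolding s(2) extended_angle_tang[OF s(1)] using c by (intro tang_max_edge) auto
qed

lemma angle_near_lower_bound:
  assumes "\<And>s. card s = 2 \<Longrightarrow> l s \<in> {0<..arcosh 2}" and "card s = 2" and "l s \<le> 1 / 15"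
  shows "extended_angle l s < 3 * pi * l s"
proof -
  obtain i j k h where s: "distinct [i, j, k, h]" "s = {i, j}" by (rule pair_4_cases[OF assms(2)])
  have c: "1 < cosh (l s) \<and> cosh (l s) \<le> 2" if "card s = 2" for s
  proof -
    have "cosh (l s) \<le> cosh (arcosh 2)"
      using assms(1)[OF that] by (intro cosh_real_nonneg_le_iff[THEN iffD2]) auto
    then show ?thesis using assms(1)[OF that] by (simp add: cosh_real_gt_1)
  qed
  have "card {i, j} = 2" "card {k, h} = 2" "card {i, k} = 2" "card {i, h} = 2" "card {j, k} = 2"
      "card {j, h} = 2"
    using s by auto
  then show ?thesis
    using assms(1)[OF assms(2)] assms(3)
    unfolding s(2) extended_angle_tang[OF s(1)] using c by (intro tang_min_edge) auto
qed

text \<open>The collar reaches at most up to \<open>2 * lo\<close> from below and at most down to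
  \<open>arcosh (19/10)\<close> from above; these are the ranges in which the two angle estimates
  apply.\<close>

theorem curvature_generalized_ricci:
  assumes fin: "finite (tets M)" and val: "\<And>e. e \<in> edges M \<Longrightarrow> 10 \<le> valence M e \<and> valence M e \<le> d" and
      d: "10 \<le> d"
  defines "lo \<equiv> inverse (3 * real d)" and "hi \<equiv> arcosh 2"
  shows "curvature (edges M) (generalized_ricci M) lo hi (min lo (arcosh 2 - arcosh (19/10)))
    (2 * pi + pi * card (tet_edges M))"
proof
  let ?L = "\<lambda>l j. sixof (tet_lengths M l j)"
  \<comment> \<open>Valences of at least 10 put the lower collar, of edges no longer than
    \<open>2 * lo\<close>, below the length 1/15 of \<open>tang_min_edge\<close>.\<close>
  have lo: "0 < lo" "lo \<le> 1 / 30" using d by (auto simp: lo_def field_simps)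
  have hi: "1 / 2 < hi"
  proof -
    have "cosh (1/2 :: real) < cosh (arcosh 2)" using cosh_small[of "1/2"] by simp
    then show ?thesis unfolding hi_def by (subst (asm) cosh_real_nonneg_less_iff) auto
  qed
  have pos: "?L l j \<in> sixpos" if "\<And>e. e \<in> edges M \<Longrightarrow> l e > 0" "j \<in> tets M" for l j
    using that edge_proj_mem[OF that(2)] by (simp add: sixof_def sixpos_def tet_lengths_def)
  have box: "?L l j \<in> sixbox a b" if "\<And>e. e \<in> edges M \<Longrightarrow> l e \<in> {a..b}" "j \<in> tets M" for l j a b
    using that(1)[OF edge_proj_mem[OF that(2)]] by (simp add: sixof_def sixbox_def tet_lengths_def)
  have norm_le: "norm (?L l' j - ?L l j) \<le> 6 * R" if "\<And>e. e \<in> edges M \<Longrightarrow> \<bar>l' e - l e\<bar> \<le> R" "j \<in> tets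
      M" for l l' j R
    unfolding sixof_diff by (rule norm_sixof_le) (simp add: tet_lengths_def that edge_proj_mem)
  show "finite (edges M)" using fin by (rule finite_edges)
  show "0 < lo" by fact
  show "lo < hi" using lo hi by simp
  show "0 < min lo (arcosh 2 - arcosh (19/10))" using lo by simp
  show "generalized_ricci M l e = generalized_ricci M l' e" if "\<And>e. e \<in> edges M \<Longrightarrow> l e = l' e" "e \<in>
      edges M" for l l' e
  proof -
    have "extended_angle (tet_lengths M l j) s = extended_angle (tet_lengths M l' j) s" if "(j, s) \<in>
        edge_fibre M e" for j s
      using tet_edge_card[OF that] \<open>\<And>e. e \<in> edges M \<Longrightarrow> l e = l' e\<close>
      by (intro extended_angle_cong) (auto simp: tet_lengths_def edge_proj_mem)
    then have "(\<Sum>(j, s)\<in>edge_fibre M e. extended_angle (tet_lengths M l j) s)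
        = (\<Sum>(j, s)\<in>edge_fibre M e. extended_angle (tet_lengths M l' j) s)"
      by (intro sum.cong) auto
    then show ?thesis by (simp add: generalized_ricci_def)
  qed
  show "(\<Sum>e\<in>edges M. (l' e - l e) * (generalized_ricci M l' e - generalized_ricci M l e)) \<le> 0"
    if "\<And>e. e \<in> edges M \<Longrightarrow> l e > 0" "\<And>e. e \<in> edges M \<Longrightarrow> l' e > 0" for l l'
  proof -
    have "(?L l' j - ?L l j) \<bullet> (angles (?L l' j) - angles (?L l j)) \<ge> 0" if "j \<in> tets M" for j
      using angles_monotone[OF pos pos, OF _ that _ that, of l l'] \<open>\<And>e. e \<in> edges M \<Longrightarrow> l e > 0\<close>
        \<open>\<And>e. e \<in> edges M \<Longrightarrow> l' e > 0\<close> by (simp add: inner_diff_right)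
    then show ?thesis unfolding sum_mult_ricci_diff[OF fin] by (simp add: sum_nonneg)
  qed
  show "\<exists>k>0. \<forall>l l'. (\<forall>e\<in>edges M. l e \<in> {lo..hi}) \<longrightarrow> (\<forall>e\<in>edges M. 0 < l' e \<and> \<bar>l' e - l e\<bar> \<le> R) \<longrightarrow>
      (\<Sum>e\<in>edges M. (l' e - l e) * (generalized_ricci M l' e - generalized_ricci M l e)) \<le> - k *
          (\<Sum>e\<in>edges M. (l' e - l e)\<^sup>2)"
    if "R > 0" for R
  proof -
    \<comment> \<open>A ball of this radius around a point of the cube has coordinates that remain
      positive and at most \<open>arcosh (11/5)\<close>, so it is still hyper-ideal.\<close>
    define r where "r = min (lo / 2) (arcosh (11/5) - arcosh 2)"
    have r: "r > 0" "lo - r > 0" "hi + r \<le> arcosh (11/5)" using lo by (auto simp: r_def hi_def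
        min_def)
    have "6 * R > 0" using that by simp
    from angles_strongly_monotone[OF compact_sixbox sixbox_admissible[OF r(2,3)] r(1) this]
    obtain k where k: "k > 0" "\<And>l l'. \<lbrakk>cball l r \<inter> sixpos \<subseteq> sixbox (lo - r) (hi + r); l \<in> sixpos; l'
        \<in> sixpos;
      norm (l' - l) \<le> 6 * R\<rbrakk> \<Longrightarrow> k * (norm (l' - l))\<^sup>2 \<le> (l' - l) \<bullet> (angles l' - angles l)"
      by blast
    show ?thesis
    proof (intro exI[of _ k] conjI allI impI)
      fix l l' assume l: "\<forall>e\<in>edges M. l e \<in> {lo..hi}" and l': "\<forall>e\<in>edges M. 0 < l' e \<and> \<bar>l' e - l e\<bar> \<le>
          R"
      have "k * (norm (?L l' j - ?L l j))\<^sup>2 \<le> (?L l' j - ?L l j) \<bullet> (angles (?L l' j) - angles (?L l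
          j))"
        if j: "j \<in> tets M" for j
      proof (rule k(2))
        have "?L l j \<in> sixbox lo hi" using l by (intro box j) auto
        then show "cball (?L l j) r \<inter> sixpos \<subseteq> sixbox (lo - r) (hi + r)" using cball_sixbox by blast
        show "?L l j \<in> sixpos" using l lo by (intro pos j) force
        show "?L l' j \<in> sixpos" using l' by (intro pos j) auto
        show "norm (?L l' j - ?L l j) \<le> 6 * R" using l' by (intro norm_le j) auto
      qed
      then have "(\<Sum>j\<in>tets M. k * (norm (?L l' j - ?L l j))\<^sup>2)
          \<le> (\<Sum>j\<in>tets M. (?L l' j - ?L l j) \<bullet> (angles (?L l' j) - angles (?L l j)))"
        by (rule sum_mono)
      moreover have "k * (\<Sum>e\<in>edges M. (l' e - l e)\<^sup>2) \<le> k * (\<Sum>j\<in>tets M. (norm (?L l' j - ?L l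
          j))\<^sup>2)"
        using k(1) by (intro mult_left_mono sum_sq_le_sum_norm fin) (use val in fastforce)+
      ultimately show "(\<Sum>e\<in>edges M. (l' e - l e) * (generalized_ricci M l' e - generalized_ricci M l
          e))
          \<le> - k * (\<Sum>e\<in>edges M. (l' e - l e)\<^sup>2)"
        unfolding sum_mult_ricci_diff[OF fin] sum_distrib_left[symmetric] mult_minus_left
            neg_le_iff_le
        by linarith
    qed (rule k(1))
  qed
  show "\<exists>B>0. \<forall>l l'. (\<forall>e\<in>edges M. l e \<in> {lo..hi}) \<longrightarrow> (\<forall>e\<in>edges M. l' e \<in> {lo..hi}) \<longrightarrow>
      (\<Sum>e\<in>edges M. (generalized_ricci M l' e - generalized_ricci M l e)\<^sup>2) \<le> B * (\<Sum>e\<in>edges M. (l' e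
          - l e)\<^sup>2)"
  proof -
    have "hi \<le> arcosh (11/5)" unfolding hi_def by (rule less_imp_le) simp
    from angles_lipschitz[OF compact_sixbox convex_sixbox sixbox_admissible[OF lo(1) this]]
    obtain B where B: "B > 0" "\<And>l l'. l \<in> sixbox lo hi \<Longrightarrow> l' \<in> sixbox lo hi \<Longrightarrow> norm (angles l' -
        angles l) \<le> B * norm (l' - l)"
      by blast
    define N where "N = real (card (tet_edges M))"
    define A where "A = real (card (edges M)) * (N * (B * 6))\<^sup>2 + 1"
    have "A > 0" unfolding A_def by (intro add_nonneg_pos) auto
    show ?thesis
    proof (intro exI[of _ A] conjI allI impI)
      fix l l' assume l: "\<forall>e\<in>edges M. l e \<in> {lo..hi}" and l': "\<forall>e\<in>edges M. l' e \<in> {lo..hi}"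
      define S where "S = (\<Sum>e\<in>edges M. (l' e - l e)\<^sup>2)"
      have S: "S \<ge> 0" unfolding S_def by (intro sum_nonneg) auto
      have coord: "\<bar>l' e - l e\<bar> \<le> sqrt S" if "e \<in> edges M" for e
        using member_le_sum_sq[OF finite_edges[OF fin] that, of "\<lambda>e. l' e - l e"]
        by (simp add: S_def real_le_rsqrt)
      have ang: "\<bar>extended_angle (tet_lengths M l' j) s - extended_angle (tet_lengths M l j) s\<bar> \<le> B
          * (6 * sqrt S)"
        if "j \<in> tets M" "card s = 2" for j s
      proof -
        have "\<bar>extended_angle (tet_lengths M l' j) s - extended_angle (tet_lengths M l j) s\<bar>
            \<le> norm (angles (?L l' j) - angles (?L l j))"
          using abs_le_norm_sixof[OF that(2), of "\<lambda>s. extended_angle (tet_lengths M l' j) s -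
              extended_angle (tet_lengths M l j) s"]
          by (simp add: sixof_extended_angle flip: sixof_diff)
        also have "\<dots> \<le> B * norm (?L l' j - ?L l j)" using l l' by (intro B(2) box that(1)) auto
        also have "\<dots> \<le> B * (6 * sqrt S)" using B(1) coord by (intro mult_left_mono norm_le that(1))
            auto
        finally show ?thesis .
      qed
      have K: "\<bar>generalized_ricci M l' e - generalized_ricci M l e\<bar> \<le> N * (B * 6) * sqrt S" if "e \<in>
          edges M" for e
      proof -
        have "generalized_ricci M l' e - generalized_ricci M l e
            = - (\<Sum>(j, s)\<in>edge_fibre M e. extended_angle (tet_lengths M l' j) s - extended_angle
                (tet_lengths M l j) s)"
          by (simp add: generalized_ricci_def sum_subtractf case_prod_unfold)
        then have "\<bar>generalized_ricci M l' e - generalized_ricci M l e\<bar>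
            \<le> (\<Sum>(j, s)\<in>edge_fibre M e. \<bar>extended_angle (tet_lengths M l' j) s - extended_angle
                (tet_lengths M l j) s\<bar>)"
          by (simp add: case_prod_unfold sum_abs)
        also have "\<dots> \<le> (\<Sum>a\<in>edge_fibre M e. B * (6 * sqrt S))"
          by (rule sum_mono) (auto intro!: ang dest: tet_edge_card)
        also have "\<dots> = real (card (edge_fibre M e)) * (B * (6 * sqrt S))" by simp
        also have "\<dots> \<le> N * (B * (6 * sqrt S))"
          unfolding N_def edge_fibre_def using B(1) S finite_tet_edges[OF fin]
          by (intro mult_right_mono of_nat_mono card_mono) auto
        finally show ?thesis by simp
      qed
      have "(generalized_ricci M l' e - generalized_ricci M l e)\<^sup>2 \<le> (N * (B * 6))\<^sup>2 * S" if "e \<in>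
          edges M" for e
      proof -
        have "(generalized_ricci M l' e - generalized_ricci M l e)\<^sup>2 \<le> (N * (B * 6) * sqrt S)\<^sup>2"
          using power_mono[OF K[OF that], of 2] by simp
        then show ?thesis using S by (simp add: power_mult_distrib)
      qed
      then have "(\<Sum>e\<in>edges M. (generalized_ricci M l' e - generalized_ricci M l e)\<^sup>2) \<le> (\<Sum>e\<in>edges M.
          (N * (B * 6))\<^sup>2 * S)"
        by (rule sum_mono)
      also have "\<dots> \<le> A * S" using S by (simp add: A_def algebra_simps)
      finally show "(\<Sum>e\<in>edges M. (generalized_ricci M l' e - generalized_ricci M l e)\<^sup>2) \<le> A *
          (\<Sum>e\<in>edges M. (l' e - l e)\<^sup>2)"
        by (simp add: S_def)
    qed fact
  qed
  show "(\<lambda>n. generalized_ricci M (X n) e) \<longlonglongrightarrow> generalized_ricci M x e"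
    if "\<And>e. e \<in> edges M \<Longrightarrow> x e > 0" "\<And>e n. e \<in> edges M \<Longrightarrow> X n e > 0"
      "\<And>e. e \<in> edges M \<Longrightarrow> (\<lambda>n. X n e) \<longlonglongrightarrow> x e" "e \<in> edges M" for X x e
  proof -
    have "(\<lambda>n. extended_angle (tet_lengths M (X n) (fst a)) (snd a)) \<longlonglongrightarrow> extended_angle (tet_lengths M
        x (fst a)) (snd a)"
      if "a \<in> edge_fibre M e" for a
    proof (rule tendsto_extended_angle)
      have j: "fst a \<in> tets M" "card (snd a) = 2" using tet_edge_card[of "fst a" "snd a"] that by
          auto
      show "card (snd a) = 2" by fact
      fix s :: "4 set" assume s: "card s = 2"
      note mem = edge_proj_mem[OF j(1) s]
      show "tet_lengths M x (fst a) s > 0" "tet_lengths M (X n) (fst a) s > 0" for n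
        unfolding tet_lengths_def by (intro \<open>\<And>e. e \<in> edges M \<Longrightarrow> x e > 0\<close> \<open>\<And>e n. e \<in> edges M \<Longrightarrow> X n e >
            0\<close> mem)+
      show "(\<lambda>n. tet_lengths M (X n) (fst a) s) \<longlonglongrightarrow> tet_lengths M x (fst a) s"
        unfolding tet_lengths_def by (intro \<open>\<And>e. e \<in> edges M \<Longrightarrow> (\<lambda>n. X n e) \<longlonglongrightarrow> x e\<close> mem)
    qed
    then show ?thesis
      unfolding generalized_ricci_def case_prod_unfold by (intro tendsto_intros)
  qed
  have tl: "tet_lengths M l j s \<in> {0<..arcosh 2}"
    if "\<And>e. e \<in> edges M \<Longrightarrow> l e \<in> {lo..hi}" "j \<in> tets M" "card s = 2" for l j s
    using that(1)[OF edge_proj_mem[OF that(2,3)]] lo(1) by (simp add: tet_lengths_def hi_def)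
  \<comment> \<open>The factor 3 in \<open>lo\<close> is chosen for this: at most \<open>d\<close>
    angles, each below \<open>3 * pi * (2 * lo)\<close>, sum to at most 2\<pi>.\<close>
  have lod: "3 * pi * (2 * lo) * real d = 2 * pi" using d by (simp add: lo_def)
  show "0 \<le> generalized_ricci M l e"
    if l: "\<And>e. e \<in> edges M \<Longrightarrow> l e \<in> {lo..hi}" and e: "e \<in> edges M" and le: "l e \<le> lo + min lo (arcosh
        2 - arcosh (19/10))" for l e
  proof -
    have "(\<Sum>(j, s)\<in>edge_fibre M e. extended_angle (tet_lengths M l j) s) \<le> (\<Sum>a\<in>edge_fibre M e. 3 *
        pi * (2 * lo))"
    proof (rule sum_mono, clarify)
      fix j s assume a: "(j, s) \<in> edge_fibre M e"
      have js: "j \<in> tets M" "card s = 2" using tet_edge_card[OF a] by auto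
      have "l e \<le> 2 * lo" using le by linarith
      have "extended_angle (tet_lengths M l j) s < 3 * pi * tet_lengths M l j s"
        using js lo(2) \<open>l e \<le> 2 * lo\<close> by (intro angle_near_lower_bound tl l) (simp_all add:
            tet_lengths_fibre[OF a])
      also have "\<dots> \<le> 3 * pi * (2 * lo)" using \<open>l e \<le> 2 * lo\<close> by (simp add: tet_lengths_fibre[OF a])
      finally show "extended_angle (tet_lengths M l j) s \<le> 3 * pi * (2 * lo)" by simp
    qed
    also have "\<dots> = 3 * pi * (2 * lo) * real (valence M e)" by (simp add: valence_def)
    also have "\<dots> \<le> 3 * pi * (2 * lo) * real d" using val[OF e] lo(1) by (intro mult_left_mono) auto
    finally show ?thesis unfolding lod by (simp add: generalized_ricci_def)
  qed
  show "generalized_ricci M l e \<le> 0"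
    if l: "\<And>e. e \<in> edges M \<Longrightarrow> l e \<in> {lo..hi}" and e: "e \<in> edges M" and le: "l e \<ge> hi - min lo (arcosh
        2 - arcosh (19/10))" for l e
  proof -
    have "2 * pi = 10 * (pi / 5)" by simp
    also have "\<dots> \<le> real (valence M e) * (pi / 5)" using val[OF e] by (intro mult_right_mono) auto
    also have "\<dots> = (\<Sum>a\<in>edge_fibre M e. pi / 5)" by (simp add: valence_def)
    also have "\<dots> \<le> (\<Sum>(j, s)\<in>edge_fibre M e. extended_angle (tet_lengths M l j) s)"
    proof (rule sum_mono, clarify)
      fix j s assume a: "(j, s) \<in> edge_fibre M e"
      have js: "j \<in> tets M" "card s = 2" using tet_edge_card[OF a] by auto
      have "arcosh (19/10) \<le> tet_lengths M l j s" using le unfolding tet_lengths_fibre[OF a] hi_def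
          by linarith
      then have "pi / 5 < extended_angle (tet_lengths M l j) s"
        using js by (intro angle_near_upper_bound tl l)
      then show "pi / 5 \<le> extended_angle (tet_lengths M l j) s" by simp
    qed
    finally show ?thesis by (simp add: generalized_ricci_def)
  qed
  show "\<bar>generalized_ricci M l e\<bar> \<le> 2 * pi + pi * card (tet_edges M)" if "e \<in> edges M" for l e
  proof -
    have "0 \<le> (\<Sum>(j, s)\<in>edge_fibre M e. extended_angle (tet_lengths M l j) s)"
      by (intro sum_nonneg) (auto intro!: extended_angle_bounds dest: tet_edge_card)
    moreover have "(\<Sum>(j, s)\<in>edge_fibre M e. extended_angle (tet_lengths M l j) s) \<le> (\<Sum>a\<in>edge_fibre M
        e. pi)"
      by (intro sum_mono) (auto intro!: extended_angle_bounds dest: tet_edge_card)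
    moreover have "(\<Sum>a\<in>edge_fibre M e. pi) \<le> pi * card (tet_edges M)"
      using finite_tet_edges[OF fin] by (simp add: edge_fibre_def card_mono mult.commute)
    ultimately show ?thesis unfolding generalized_ricci_def using pi_gt_zero by linarith
  qed
qed

section \<open>Hyper-ideal tetrahedra in Minkowski space\<close>

type_synonym mvec = "(real^3) \<times> real"

lemma mink_commute: "mink x y = mink y x"
  by (simp add: mink_def inner_commute mult.commute)

lemma mink_simps [simp]:
  "mink (x + y) z = mink x z + mink y z" "mink (x - y) z = mink x z - mink y z"
  "mink (r *\<^sub>R x) z = r * mink x z" "mink (- x) z = - mink x z" "mink 0 z = 0"
  "mink z (x + y) = mink z x + mink z y" "mink z (x - y) = mink z x - mink z y"
  "mink z (r *\<^sub>R x) = r * mink z x" "mink z (- x) = - mink z x" "mink z 0 = 0"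
  by (simp_all add: mink_def inner_simps algebra_simps)

lemma mink_sum: "mink (\<Sum>i\<in>A. f i) z = (\<Sum>i\<in>A. mink (f i) z)"
  by (induction A rule: infinite_finite_induct) simp_all

text \<open>The orthogonal complement of a timelike vector is positive definite, by the
  Cauchy-Schwarz inequality for the spatial parts.\<close>

lemma mink_orthogonal_timelike:
  assumes "mink x x < 0" "mink x y = 0" "mink y y \<le> 0"
  shows "y = 0"
proof -
  obtain p t where x: "x = (p, t)" by fastforce
  obtain q u where y: "y = (q, u)" by fastforce
  have 1: "p \<bullet> p < t\<^sup>2" "p \<bullet> q = t * u" "q \<bullet> q \<le> u\<^sup>2"
    using assms by (simp_all add: mink_def x y power2_eq_square)
  have "t\<^sup>2 * u\<^sup>2 = (p \<bullet> q)\<^sup>2" using 1(2) by (simp add: power_mult_distrib)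
  also have "\<dots> \<le> (p \<bullet> p) * (q \<bullet> q)" by (rule Cauchy_Schwarz_ineq)
  also have "\<dots> \<le> (p \<bullet> p) * u\<^sup>2" using 1(3) by (intro mult_left_mono) auto
  finally have "(t\<^sup>2 - p \<bullet> p) * u\<^sup>2 \<le> 0" by (simp add: algebra_simps)
  then have "u = 0" using 1(1) by (simp add: mult_le_0_iff)
  then have "q \<bullet> q \<le> 0" using 1(3) by simp
  then have "q = 0" using inner_ge_zero[of q] inner_eq_zero_iff[of q] by linarith
  then show ?thesis using \<open>u = 0\<close> by (simp add: y zero_prod_def)
qed

text \<open>The reversed Cauchy-Schwarz inequality. It puts \<open>- mink x y\<close> in the range
  where \<open>cosh\<close> undoes \<open>arcosh\<close>, so distances can be read as
  products.\<close>

lemma mink_hyperbolic_le: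
  assumes "x \<in> hyperbolic_space" "y \<in> hyperbolic_space"
  shows "mink x y \<le> - 1"
proof -
  obtain p t where x: "x = (p, t)" by fastforce
  obtain q u where y: "y = (q, u)" by fastforce
  have 1: "p \<bullet> p = t\<^sup>2 - 1" "q \<bullet> q = u\<^sup>2 - 1" "t > 0" "u > 0"
    using assms by (simp_all add: hyperbolic_space_def mink_def x y power2_eq_square)
  have "1 \<le> t\<^sup>2" using 1(1) inner_ge_zero[of p] by linarith
  then have t: "1 \<le> t" using power2_le_imp_le[of 1 t] 1(3) by simp
  have "1 \<le> u\<^sup>2" using 1(2) inner_ge_zero[of q] by linarith
  then have u: "1 \<le> u" using power2_le_imp_le[of 1 u] 1(4) by simp
  have "(p \<bullet> q)\<^sup>2 \<le> (t\<^sup>2 - 1) * (u\<^sup>2 - 1)" using Cauchy_Schwarz_ineq[of p q] unfolding 1(1,2) .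
  also have "\<dots> = (t * u - 1)\<^sup>2 - (t - u)\<^sup>2" by (simp add: power2_eq_square algebra_simps)
  also have "\<dots> \<le> (t * u - 1)\<^sup>2" by simp
  finally have "(p \<bullet> q)\<^sup>2 \<le> (t * u - 1)\<^sup>2" .
  moreover have "0 \<le> t * u - 1" using mult_mono[OF t u] t by simp
  ultimately have "p \<bullet> q \<le> t * u - 1" by (rule power2_le_imp_le)
  then show ?thesis by (simp add: mink_def x y)
qed

text \<open>A family with a dual family spans: the map to the four products is onto, hence injective.\<close>

lemma mink_dual_family:
  fixes p q :: "4 \<Rightarrow> mvec"
  assumes "\<And>i j. i \<noteq> j \<Longrightarrow> mink (p i) (q j) = 0" and "\<And>i. mink (p i) (q i) \<noteq> 0"
    and "\<And>i. mink x (q i) = 0"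
  shows "x = 0"
proof -
  define T :: "mvec \<Rightarrow> real^4" where "T x = (\<chi> i. mink x (q i))" for x
  have lin: "linear T" by (rule linearI) (simp_all add: T_def vec_eq_iff)
  have "surj T"
  proof (rule surjI)
    fix y :: "real^4"
    show "T (\<Sum>i\<in>UNIV. (y $ i / mink (p i) (q i)) *\<^sub>R p i) = y"
    proof (subst vec_eq_iff, intro allI)
      fix j
      have "T (\<Sum>i\<in>UNIV. (y $ i / mink (p i) (q i)) *\<^sub>R p i) $ j
          = (\<Sum>i\<in>UNIV. y $ i / mink (p i) (q i) * mink (p i) (q j))"
        by (simp add: T_def mink_sum)
      also have "\<dots> = (\<Sum>i\<in>UNIV. if i = j then y $ j else 0)"
      proof (rule sum.cong)
        show "y $ i / mink (p i) (q i) * mink (p i) (q j) = (if i = j then y $ j else 0)" for i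
          using assms(1)[of i j] assms(2)[of i] by (cases "i = j") simp_all
      qed simp
      finally show "T (\<Sum>i\<in>UNIV. (y $ i / mink (p i) (q i)) *\<^sub>R p i) $ j = y $ j" by simp
    qed
  qed
  then have "inj T" by (rule linear_surjective_imp_injective[OF lin]) simp
  moreover have "T x = T 0" using assms(3) by (simp add: T_def vec_eq_iff)
  ultimately show ?thesis by (rule injD)
qed

section \<open>Hyper-ideal vertices and their Gram matrix\<close>

definition admissible :: "(4 set \<Rightarrow> real) \<Rightarrow> bool" where
  "admissible l \<longleftrightarrow> (\<forall>i j. i \<noteq> j \<longrightarrow> l {i, j} > 0) \<and>
     (\<forall>i j k h. distinct [i, j, k, h] \<longrightarrow> tdelta (cosh (l {i, j})) (cosh (l {k, h})) (cosh (l {i, k}))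
        (cosh (l {i, h})) (cosh (l {j, k})) (cosh (l {j, h})) > 0)"

text \<open>The \<open>v i\<close> are the hyper-ideal vertices, unit spacelike vectors. Their polar
  planes truncate the tetrahedron and lie at distance \<open>l {i, j}\<close> from each other,
  whence the entries \<open>- cosh\<close>.\<close>

definition vertex_gram :: "(4 set \<Rightarrow> real) \<Rightarrow> (4 \<Rightarrow> mvec) \<Rightarrow> bool" where
  "vertex_gram l v \<longleftrightarrow> (\<forall>i. mink (v i) (v i) = 1) \<and> (\<forall>i j. i \<noteq> j \<longrightarrow> mink (v i) (v j) = - cosh (l {i,
      j}))"

lemma admissible_cosh: "admissible l \<Longrightarrow> i \<noteq> j \<Longrightarrow> cosh (l {i, j}) > 1"
  by (simp add: admissible_def cosh_real_gt_1)

text \<open>The rows of the adjugate of the Gram matrix, up to sign, give vectors dual to the \<open>v i\<close>.\<close>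

definition conormal :: "(4 set \<Rightarrow> real) \<Rightarrow> (4 \<Rightarrow> mvec) \<Rightarrow> 4 \<Rightarrow> 4 \<Rightarrow> 4 \<Rightarrow> 4 \<Rightarrow> mvec" where
  "conormal l v i j k h = (let a = cosh (l {i, j}); f = cosh (l {k, h}); b = cosh (l {i, k}); c =
      cosh (l {i, h});
       d = cosh (l {j, k}); e = cosh (l {j, h}) in
     tface a b d *\<^sub>R v h - tnum a f b c d e *\<^sub>R v k - tnum b e a c d f *\<^sub>R v j - tnum d c a e b f
         *\<^sub>R v i)"

lemma conormal_mink:
  assumes "vertex_gram l v" "distinct [i, j, k, h]"
  shows "mink (conormal l v i j k h) (v i) = 0" "mink (conormal l v i j k h) (v j) = 0"
    "mink (conormal l v i j k h) (v k) = 0"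
    "mink (conormal l v i j k h) (v h) = tdelta (cosh (l {i, j})) (cosh (l {k, h})) (cosh (l {i,
        k}))
        (cosh (l {i, h})) (cosh (l {j, k})) (cosh (l {j, h}))"
proof -
  have g: "mink (v x) (v x) = 1" "x \<noteq> y \<Longrightarrow> mink (v x) (v y) = - cosh (l {x, y})" for x y
    using assms(1) by (auto simp: vertex_gram_def)
  have ne: "i \<noteq> j" "i \<noteq> k" "i \<noteq> h" "j \<noteq> k" "j \<noteq> h" "k \<noteq> h" "j \<noteq> i" "k \<noteq> i" "h \<noteq> i" "k \<noteq> j" "h \<noteq> j"
      "h \<noteq> k"
    using assms(2) by auto
  have c: "{j, i} = {i, j}" "{k, i} = {i, k}" "{h, i} = {i, h}" "{k, j} = {j, k}" "{h, j} = {j, h}"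
      "{h, k} = {k, h}"
    by auto
  note simps = conormal_def Let_def mink_simps g(1) g(2)[OF ne(1)] g(2)[OF ne(2)] g(2)[OF ne(3)]
      g(2)[OF ne(4)]
    g(2)[OF ne(5)] g(2)[OF ne(6)] g(2)[OF ne(7)] g(2)[OF ne(8)] g(2)[OF ne(9)] g(2)[OF ne(10)]
        g(2)[OF ne(11)]
    g(2)[OF ne(12)] c tface_def tnum_def tdelta_def
  show "mink (conormal l v i j k h) (v i) = 0" unfolding simps by algebra
  show "mink (conormal l v i j k h) (v j) = 0" unfolding simps by algebra
  show "mink (conormal l v i j k h) (v k) = 0" unfolding simps by algebra
  show "mink (conormal l v i j k h) (v h) = tdelta (cosh (l {i, j})) (cosh (l {k, h})) (cosh (l {i,
      k}))
        (cosh (l {i, h})) (cosh (l {j, k})) (cosh (l {j, h}))" unfolding simps by algebra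
qed

lemma distinct_4_cases:
  fixes i j k h m :: 4
  assumes "distinct [i, j, k, h]"
  shows "m = i \<or> m = j \<or> m = k \<or> m = h"
proof -
  have "m \<in> {i, j, k, h}" unfolding distinct4_UNIV[OF assms, symmetric] by (rule UNIV_I)
  then show ?thesis by simp
qed

lemma distinct_4_split:
  fixes h :: 4
  obtains i j k where "distinct [i, j, k, h]"
proof -
  have "h = 1 \<or> h = 2 \<or> h = 3 \<or> h = 4" by (rule exhaust_4)
  then show thesis
    using that[of 2 3 4] that[of 1 3 4] that[of 1 2 4] that[of 1 2 3] by auto
qed

lemma vertex_gram_nondegenerate:
  assumes "admissible l" "vertex_gram l v" "\<And>i. mink x (v i) = 0"
  shows "x = 0"
proof -
  have "\<exists>w. (\<forall>i. i \<noteq> h \<longrightarrow> mink w (v i) = 0) \<and> mink w (v h) \<noteq> 0" for h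
  proof -
    obtain i j k where d: "distinct [i, j, k, h]" by (rule distinct_4_split)
    have "mink (conormal l v i j k h) (v h) > 0"
      using conormal_mink(4)[OF assms(2) d] assms(1) d by (simp add: admissible_def)
    moreover have "mink (conormal l v i j k h) (v m) = 0" if "m \<noteq> h" for m
      using conormal_mink(1-3)[OF assms(2) d] distinct_4_cases[OF d, of m] that by auto
    ultimately show ?thesis by (intro exI[of _ "conormal l v i j k h"]) auto
  qed
  then obtain w where "\<And>h i. i \<noteq> h \<Longrightarrow> mink (w h) (v i) = 0" "\<And>h. mink (w h) (v h) \<noteq> 0" by metis
  then show ?thesis by (intro mink_dual_family[of w v] assms(3)) auto
qed

text \<open>The normal of the face opposite to a vertex is orthogonal to the other three, hence a
  multiple of a conormal. Unit length fixes the factors \<open>p, q\<close> up to sign, the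
  inequalities make both nonpositive, and the product of the normals becomes the quotient of
  cofactors \<open>tphi\<close>.\<close>

lemma mink_normals:
  assumes l: "admissible l" and v: "vertex_gram l v" and d: "distinct [i, j, k, h]"
    and mh: "mink mh (v i) = 0" "mink mh (v j) = 0" "mink mh (v k) = 0" "mink mh mh = 1" "mink mh (v
        h) \<le> 0"
    and mk: "mink mk (v i) = 0" "mink mk (v j) = 0" "mink mk (v h) = 0" "mink mk mk = 1" "mink mk (v
        k) \<le> 0"
  shows "arccos (- mink mk mh) = extended_angle l {i, j}"
proof -
  let ?a = "cosh (l {i, j})" and ?f = "cosh (l {k, h})" and ?b = "cosh (l {i, k})" and ?c = "cosh (l
      {i, h})"
    and ?d = "cosh (l {j, k})" and ?e = "cosh (l {j, h})"
  define D where "D = tdelta ?a ?f ?b ?c ?d ?e"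
  have d': "distinct [i, j, h, k]" using d by auto
  have D: "D > 0" using l d by (simp add: D_def admissible_def)
  have D': "tdelta ?a ?f ?c ?b ?e ?d = D" unfolding D_def tdelta_def by algebra
  have hk: "{h, k} = {k, h}" by auto
  define wh where "wh = conormal l v i j k h"
  define wk where "wk = conormal l v i j h k"
  note cm = conormal_mink[OF v d, folded wh_def D_def] conormal_mink[OF v d', folded wk_def,
      unfolded hk D']
  have all: "P i \<Longrightarrow> P j \<Longrightarrow> P k \<Longrightarrow> P h \<Longrightarrow> P m" for P m
    using distinct_4_cases[OF d, of m] by auto
  have zero: "mink x (v i) = 0 \<Longrightarrow> mink x (v j) = 0 \<Longrightarrow> mink x (v k) = 0 \<Longrightarrow> mink x (v h) = 0 \<Longrightarrow> x = 0" for
      x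
    by (rule vertex_gram_nondegenerate[OF l v], rule all)
  define p where "p = mink mh (v h) / D"
  define q where "q = mink mk (v k) / D"
  have "mh - p *\<^sub>R wh = 0" by (rule zero) (use mh cm D in \<open>simp_all add: p_def\<close>)
  then have mh': "mh = p *\<^sub>R wh" by simp
  have "mk - q *\<^sub>R wk = 0" by (rule zero) (use mk cm D in \<open>simp_all add: q_def\<close>)
  then have mk': "mk = q *\<^sub>R wk" by simp
  define P where "P = tface ?a ?b ?d"
  define R where "R = tface ?a ?c ?e"
  define n where "n = tnum ?a ?f ?b ?c ?d ?e"
  have gt1: "?a > 1" "?b > 1" "?c > 1" "?d > 1" "?e > 1" using d l by (auto intro!: admissible_cosh)
  have PR: "P > 0" "R > 0" unfolding P_def R_def using tface_pos gt1 by (smt (verit))+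
  have wh: "\<exists>x y. wh = P *\<^sub>R v h - n *\<^sub>R v k - x *\<^sub>R v j - y *\<^sub>R v i"
    unfolding wh_def conormal_def Let_def P_def n_def by blast
  have "tnum ?a ?f ?c ?b ?e ?d = n" unfolding n_def by (rule tnum_swap)
  then have wk: "\<exists>x y. wk = R *\<^sub>R v k - n *\<^sub>R v h - x *\<^sub>R v j - y *\<^sub>R v i"
    unfolding wk_def conormal_def Let_def R_def hk by metis
  have whh: "mink wh wh = P * D" and whk: "mink wk wh = - n * D"
    using wh cm by auto
  have wkk: "mink wk wk = R * D" using wk cm by auto
  have pD: "p\<^sup>2 * (P * D) = 1" using mh(4) unfolding mh' by (simp add: whh power2_eq_square
      mult.assoc)
  have qD: "q\<^sup>2 * (R * D) = 1" using mk(4) unfolding mk' by (simp add: wkk power2_eq_square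
      mult.assoc)
  have "p \<le> 0" "q \<le> 0" using mh(5) mk(5) D by (simp_all add: p_def q_def divide_nonpos_pos)
  then have pq: "p * q \<ge> 0" by (simp add: mult_nonpos_nonpos)
  have "(p * q * D * (sqrt P * sqrt R))\<^sup>2 = (p\<^sup>2 * (P * D)) * (q\<^sup>2 * (R * D))"
  proof -
    have sq: "(sqrt P)\<^sup>2 = P" "(sqrt R)\<^sup>2 = R" using PR by simp_all
    show ?thesis by (simp only: power_mult_distrib sq) (simp add: power2_eq_square)
  qed
  then have "(p * q * D * (sqrt P * sqrt R))\<^sup>2 = 1" by (simp add: pD qD)
  moreover have "p * q * D * (sqrt P * sqrt R) \<ge> 0" using pq D PR by simp
  ultimately have one: "p * q * D * (sqrt P * sqrt R) = 1" by (simp add: power2_eq_1_iff)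
  have "- mink mk mh = p * q * D * n" unfolding mh' mk' by (simp add: whk algebra_simps)
  also have "\<dots> = tphi ?a ?f ?b ?c ?d ?e"
    using one PR unfolding tphi_def P_def[symmetric] R_def[symmetric] n_def[symmetric]
    by (simp add: eq_divide_eq)
  finally have eq: "- mink mk mh = tphi ?a ?f ?b ?c ?d ?e" .
  have "\<bar>tphi ?a ?f ?b ?c ?d ?e\<bar> < 1" using abs_tphi_less_1_iff[OF gt1] D by (simp add: D_def)
  then show ?thesis unfolding eq extended_angle_tang[OF d] tang_def by (simp add: abs_less_iff)
qed

text \<open>A triangular factorisation of the Gram matrix adapted to signature (3, 1). The vectors
  \<open>v 1, v 2\<close> span a Lorentzian plane; the new coordinates \<open>s, y3, z4\<close> are
  square roots of quotients of successive principal minors, which are positive up to a common sign.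
  Nonnegative time coordinates serve later to place the corners on the upper sheet.\<close>

lemma vertex_gram_exists:
  assumes "admissible l"
  shows "\<exists>v. vertex_gram l v \<and> (\<forall>i. snd (v i) \<ge> 0)"
proof -
  define a where "a = cosh (l {1, 2})" define b where "b = cosh (l {1, 3})" define c where "c = cosh
      (l {1, 4})"
  define d where "d = cosh (l {2, 3})" define e where "e = cosh (l {2, 4})" define f where "f = cosh
      (l {3, 4})"
  note defs = a_def b_def c_def d_def e_def f_def
  have g: "a > 1" "b > 1" "c > 1" "d > 1" "e > 1" "f > 1"
    unfolding defs using admissible_cosh[OF assms] by simp_all
  have "distinct [1, 2, 3, 4 :: 4]" by simp
  then have D: "tdelta a f b c d e > 0"
    unfolding defs by (rule assms[unfolded admissible_def, THEN conjunct2, rule_format])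
  define s where "s = sqrt (a\<^sup>2 - 1)"
  define P where "P = tface a b d"
  define n where "n = tnum a f b c d e"
  define D where "D = tdelta a f b c d e"
  have s: "s > 0" "s\<^sup>2 = a\<^sup>2 - 1" using g by (simp_all add: s_def)
  have P: "P > 0" using tface_pos[of a b d] g by (simp add: P_def)
  define y3 where "y3 = sqrt P / s"
  define t3 where "t3 = (d + a * b) / s"
  define t4 where "t4 = (e + a * c) / s"
  define y4 where "y4 = n / (s * sqrt P)"
  define z4 where "z4 = sqrt D / sqrt P"
  have y3: "y3\<^sup>2 = P / s\<^sup>2" using P by (simp add: y3_def power_divide)
  have 33: "b\<^sup>2 + y3\<^sup>2 - t3\<^sup>2 = 1"
  proof -
    have "s\<^sup>2 * (b\<^sup>2 + y3\<^sup>2 - t3\<^sup>2) = s\<^sup>2 * b\<^sup>2 + P - (d + a * b)\<^sup>2"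
      using s(1) unfolding y3 t3_def by (simp add: field_simps)
    also have "\<dots> = s\<^sup>2 * 1" unfolding s(2) P_def tface_def by algebra
    finally show ?thesis using s(1) by simp
  qed
  have y34: "y3 * y4 = n / s\<^sup>2" using P s(1) by (simp add: y3_def y4_def power2_eq_square)
  have 34: "b * c + y3 * y4 - t3 * t4 = - f"
  proof -
    have "s\<^sup>2 * (b * c + y3 * y4 - t3 * t4) = s\<^sup>2 * (b * c) + n - (d + a * b) * (e + a * c)"
      using s(1) unfolding y34 t3_def t4_def by (simp add: field_simps power2_eq_square)
    also have "\<dots> = s\<^sup>2 * (- f)" unfolding s(2) n_def tnum_def by algebra
    finally show ?thesis using s(1) by (simp only: mult_cancel_left) simp
  qed
  have 44: "c\<^sup>2 + y4\<^sup>2 + z4\<^sup>2 - t4\<^sup>2 = 1"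
  proof -
    have "y4\<^sup>2 + z4\<^sup>2 = (n\<^sup>2 + D * s\<^sup>2) / (s\<^sup>2 * P)"
      using P s(1) D by (simp add: y4_def z4_def power_divide power_mult_distrib D_def field_simps)
    also have "n\<^sup>2 + D * s\<^sup>2 = P * tface a c e"
      using tface_mult_minus_tnum[of a b d c e f] unfolding s(2) n_def D_def P_def by simp
    finally have yz: "y4\<^sup>2 + z4\<^sup>2 = tface a c e / s\<^sup>2" using P by simp
    have "s\<^sup>2 * (c\<^sup>2 + (y4\<^sup>2 + z4\<^sup>2) - t4\<^sup>2) = s\<^sup>2 * c\<^sup>2 + tface a c e - (e + a * c)\<^sup>2"
      using s(1) unfolding yz t4_def by (simp add: field_simps)
    also have "\<dots> = s\<^sup>2 * 1" unfolding s(2) tface_def by algebra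
    finally show ?thesis using s(1) by simp
  qed
  define v :: "4 \<Rightarrow> mvec" where "v i = (if i = 1 then (vector [1, 0, 0], 0) else if i = 2 then
      (vector [- a, 0, 0], s)
    else if i = 3 then (vector [- b, y3, 0], t3) else (vector [- c, y4, z4], t4))" for i
  have v: "v 1 = (vector [1, 0, 0], 0)" "v 2 = (vector [- a, 0, 0], s)" "v 3 = (vector [- b, y3, 0],
      t3)"
    "v 4 = (vector [- c, y4, z4], t4)"
    by (simp_all add: v_def)
  have M: "mink (vector [x1, x2, x3], x4) (vector [z1, z2, z3], z4) = x1 * z1 + x2 * z2 + x3 * z3 -
      x4 * z4"
    for x1 x2 x3 x4 z1 z2 z3 z4 :: real
    by (simp add: mink_def inner_vec_def sum_3)
  have m: "mink (v 1) (v 1) = 1" "mink (v 2) (v 2) = 1" "mink (v 3) (v 3) = 1" "mink (v 4) (v 4) =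
      1"
    "mink (v 1) (v 2) = - a" "mink (v 1) (v 3) = - b" "mink (v 1) (v 4) = - c"
    "mink (v 2) (v 3) = - d" "mink (v 2) (v 4) = - e" "mink (v 3) (v 4) = - f"
    unfolding v M using s 33 34 44 by (simp_all add: t3_def t4_def power2_eq_square)
  have m': "mink (v 2) (v 1) = - a" "mink (v 3) (v 1) = - b" "mink (v 4) (v 1) = - c"
    "mink (v 3) (v 2) = - d" "mink (v 4) (v 2) = - e" "mink (v 4) (v 3) = - f"
    by (subst mink_commute, rule m)+
  have c': "cosh (l {1, 2}) = a" "cosh (l {1, 3}) = b" "cosh (l {1, 4}) = c" "cosh (l {2, 3}) = d"
    "cosh (l {2, 4}) = e" "cosh (l {3, 4}) = f" "cosh (l {2, 1}) = a" "cosh (l {3, 1}) = b"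
    "cosh (l {4, 1}) = c" "cosh (l {3, 2}) = d" "cosh (l {4, 2}) = e" "cosh (l {4, 3}) = f"
    by (simp_all add: defs insert_commute)
  have "mink (v i) (v i) = 1" for i using exhaust_4[of i] m(1-4) by auto
  moreover have "mink (v i) (v j) = - cosh (l {i, j})" if "i \<noteq> j" for i j
    using exhaust_4[of i] exhaust_4[of j] that by (elim disjE) (simp_all add: m m' c')
  moreover have "snd (v i) \<ge> 0" for i
  proof -
    have "t3 \<ge> 0" "t4 \<ge> 0" using s(1) g by (simp_all add: t3_def t4_def)
    then show ?thesis using s(1) by (simp add: v_def)
  qed
  ultimately show ?thesis by (auto simp: vertex_gram_def)
qed

text \<open>\<open>v\<close> will be the normals of the triangular faces and \<open>w\<close> those
  of the hexagonal ones. \<open>wneg\<close> orients the latter so that the polyhedron lies in the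
  cone spanned by the \<open>v i\<close>.\<close>

locale tetrahedron_frame =
  fixes l :: "4 set \<Rightarrow> real" and v w :: "4 \<Rightarrow> mvec"
  assumes adm: "admissible l" and gram: "vertex_gram l v" and future: "\<And>i. snd (v i) \<ge> 0"
    and w1: "\<And>i. mink (w i) (w i) = 1" and wv: "\<And>i j. i \<noteq> j \<Longrightarrow> mink (w i) (v j) = 0"
    and wneg: "\<And>i. mink (w i) (v i) < 0"
begin

definition normals :: face_normals where
  "normals a = (case a of Inl i \<Rightarrow> w i | Inr i \<Rightarrow> v i)"

lemma normals_simps [simp]: "normals (Inl i) = w i" "normals (Inr i) = v i"
  by (simp_all add: normals_def)

definition coord :: "mvec \<Rightarrow> 4 \<Rightarrow> real" where
  "coord x i = mink x (w i) / mink (v i) (w i)"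

lemma coord_sum: "x = (\<Sum>i\<in>UNIV. coord x i *\<^sub>R v i)"
proof -
  have "mink (x - (\<Sum>i\<in>UNIV. coord x i *\<^sub>R v i)) (w j) = 0" for j
  proof -
    have "mink (\<Sum>i\<in>UNIV. coord x i *\<^sub>R v i) (w j) = (\<Sum>i\<in>UNIV. if i = j then mink x (w j) else 0)"
      unfolding mink_sum
    proof (rule sum.cong)
      show "mink (coord x i *\<^sub>R v i) (w j) = (if i = j then mink x (w j) else 0)" for i
        using wv[of j i] wneg[of i] by (cases "i = j") (auto simp: coord_def mink_commute)
    qed simp
    then show ?thesis by simp
  qed
  then have "x - (\<Sum>i\<in>UNIV. coord x i *\<^sub>R v i) = 0"
  proof (rule mink_dual_family[of v w, rotated 2])
    show "mink (v i) (w j) = 0" if "i \<noteq> j" for i j by (subst mink_commute, rule wv) (use that in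
        auto)
    show "mink (v i) (w i) \<noteq> 0" for i using wneg[of i] mink_commute[of "v i" "w i"] by simp
  qed
  then show ?thesis by simp
qed

lemma mink_v: "mink x (v i) = coord x i - (\<Sum>j\<in>-{i}. cosh (l {i, j}) * coord x j)"
proof -
  have "mink x (v i) = (\<Sum>j\<in>UNIV. coord x j * mink (v j) (v i))"
    by (subst coord_sum) (simp add: mink_sum)
  also have "\<dots> = coord x i * mink (v i) (v i) + (\<Sum>j\<in>UNIV - {i}. coord x j * mink (v j) (v i))"
    by (rule sum.remove) auto
  also have "(\<Sum>j\<in>UNIV - {i}. coord x j * mink (v j) (v i)) = (\<Sum>j\<in>-{i}. - (cosh (l {i, j}) * coord x
      j))"
    by (rule sum.cong) (use gram in \<open>auto simp: vertex_gram_def insert_commute\<close>)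
  finally show ?thesis using gram by (simp add: vertex_gram_def sum_negf)
qed

lemma mink_self: "mink x x = (\<Sum>i\<in>UNIV. coord x i * mink x (v i))"
proof -
  have "mink x x = mink (\<Sum>i\<in>UNIV. coord x i *\<^sub>R v i) x" using coord_sum by metis
  also have "\<dots> = (\<Sum>i\<in>UNIV. coord x i * mink (v i) x)" by (simp add: mink_sum)
  also have "\<dots> = (\<Sum>i\<in>UNIV. coord x i * mink x (v i))"
    by (intro sum.cong refl arg_cong2[where f = "(*)"] mink_commute)
  finally show ?thesis .
qed

lemma in_polyhedron_iff:
  "x \<in> hyp_polyhedron normals \<longleftrightarrow> x \<in> hyperbolic_space \<and> (\<forall>i. coord x i \<ge> 0) \<and> (\<forall>i. mink x (v i) \<le> 0)"
proof -
  have "coord x i \<ge> 0 \<longleftrightarrow> mink x (w i) \<le> 0" for i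
    using wneg[of i] by (simp add: coord_def mink_commute zero_le_divide_iff)
  then show ?thesis
    unfolding hyp_polyhedron_def by (auto simp: normals_def split: sum.splits)
qed

lemma in_face_iff:
  "x \<in> hyp_face normals (Inl i) \<longleftrightarrow> x \<in> hyp_polyhedron normals \<and> coord x i = 0"
  "x \<in> hyp_face normals (Inr i) \<longleftrightarrow> x \<in> hyp_polyhedron normals \<and> mink x (v i) = 0"
  using wneg[of i] by (auto simp: hyp_face_def coord_def mink_commute)

text \<open>In the polyhedron \<open>mink x x\<close> is a sum of nonpositive terms
  \<open>coord x i * mink x (v i)\<close> and equals -1. If the face \<open>Inr i\<close> met
  \<open>Inl i\<close>, all coordinates would vanish. On two triangular faces each of the two
  coordinates would be at least \<open>cosh > 1\<close> times the other. With one coordinate left,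
  the sum would be nonnegative.\<close>

lemma face_exclusions:
  assumes x: "x \<in> hyp_polyhedron normals"
  shows "\<not> (mink x (v i) = 0 \<and> coord x i = 0)"
    and "i \<noteq> j \<Longrightarrow> \<not> (mink x (v i) = 0 \<and> mink x (v j) = 0)"
    and "distinct [i, j, k] \<Longrightarrow> \<not> (coord x i = 0 \<and> coord x j = 0 \<and> coord x k = 0)"
proof -
  have nn: "coord x i \<ge> 0" "mink x (v i) \<le> 0" for i using x by (auto simp: in_polyhedron_iff)
  have self: "(\<Sum>i\<in>UNIV. coord x i * mink x (v i)) = - 1"
    using x mink_self[of x] by (simp add: in_polyhedron_iff hyperbolic_space_def)
  have c: "cosh (l {i, j}) > 1" if "i \<noteq> j" for i j by (rule admissible_cosh[OF adm that])
  show 1: "\<not> (mink x (v i) = 0 \<and> coord x i = 0)" for i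
  proof
    assume *: "mink x (v i) = 0 \<and> coord x i = 0"
    then have "(\<Sum>j\<in>-{i}. cosh (l {i, j}) * coord x j) = 0" using mink_v[of x i] by simp
    moreover have "cosh (l {i, j}) * coord x j \<ge> 0" for j using nn by simp
    ultimately have "\<forall>j\<in>-{i}. cosh (l {i, j}) * coord x j = 0" by (subst (asm) sum_nonneg_eq_0_iff)
        auto
    then have "coord x j = 0" for j using * by (cases "j = i") (auto simp: cosh_real_nonzero)
    then show False using self by simp
  qed
  have ge: "coord x i \<ge> cosh (l {i, j}) * coord x j" if "i \<noteq> j" "mink x (v i) = 0" for i j
  proof -
    have "cosh (l {i, j}) * coord x j \<le> (\<Sum>j\<in>-{i}. cosh (l {i, j}) * coord x j)"
      by (rule member_le_sum) (use that nn in auto)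
    then show ?thesis using mink_v[of x i] that(2) by simp
  qed
  show "\<not> (mink x (v i) = 0 \<and> mink x (v j) = 0)" if "i \<noteq> j"
  proof
    assume *: "mink x (v i) = 0 \<and> mink x (v j) = 0"
    have "coord x i \<ge> cosh (l {i, j}) * coord x j" "coord x j \<ge> cosh (l {i, j}) * coord x i"
      using ge[of i j] ge[of j i] that * by (auto simp: insert_commute)
    moreover have "cosh (l {i, j}) * coord x j \<ge> coord x j" "coord x i = 0 \<or> cosh (l {i, j}) * coord
        x i > coord x i"
      using c[OF that] nn[of j] nn[of i] by (auto simp: mult_le_cancel_right1 less_le)
    ultimately have "coord x i = 0" by linarith
    then show False using 1 * by blast
  qed
  show "\<not> (coord x i = 0 \<and> coord x j = 0 \<and> coord x k = 0)" if "distinct [i, j, k]"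
  proof
    assume z: "coord x i = 0 \<and> coord x j = 0 \<and> coord x k = 0"
    have "card (- {i, j, k}) = 1" using that by (simp add: Compl_eq_Diff_UNIV card_Diff_subset)
    then obtain h where h: "- {i, j, k} = {h}" by (auto simp: card_1_singleton_iff)
    have zero: "coord x m = 0" if "m \<noteq> h" for m using h z that by blast
    have "(\<Sum>j\<in>-{h}. cosh (l {h, j}) * coord x j) = 0" by (rule sum.neutral) (use zero in auto)
    then have "mink x (v h) = coord x h" using mink_v[of x h] by simp
    then have "coord x m * mink x (v m) \<ge> 0" for m using zero nn by (cases "m = h") auto
    then have "(\<Sum>i\<in>UNIV. coord x i * mink x (v i)) \<ge> 0" by (rule sum_nonneg)
    then show False using self by simp
  qed
qed

text \<open>Let \<open>coord x i\<close> be the largest coordinate and \<open>S\<close> the sum of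
  the others. Then \<open>coord x i \<le> C * S\<close>, and
  \<open>- mink x (v j) \<ge> m * coord x i\<close> for all \<open>j \<noteq> i\<close>. Thus
  \<open>mink x x = - 1\<close> gives \<open>S * m * coord x i \<le> 1\<close>, and so
  \<open>(coord x i)\<^sup>2 \<le> C / m\<close>.\<close>

lemma coord_bounded: "\<exists>R. \<forall>x\<in>hyp_polyhedron normals. \<forall>i. coord x i \<le> R"
proof -
  define C where "C = Max (range (\<lambda>(i, j). cosh (l {i, j})))"
  define m where "m = Min ((\<lambda>(i, j). cosh (l {i, j}) - 1) ` {(i, j). i \<noteq> j})"
  have C: "cosh (l {i, j}) \<le> C" for i j
    unfolding C_def by (rule Max_ge) auto
  then have C0: "C > 0" using cosh_real_pos[of "l {1, 1}"] by (rule less_le_trans[rotated])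
  have ne: "(\<lambda>(i, j). cosh (l {i, j}) - 1) ` {(i, j). i \<noteq> j} \<noteq> {}"
  proof -
    have "(1 :: 4, 2 :: 4) \<in> {(i, j). i \<noteq> j}" by simp
    then show ?thesis by blast
  qed
  have m: "m \<le> cosh (l {i, j}) - 1" if "i \<noteq> j" for i j
    unfolding m_def by (rule Min_le) (use that in auto)
  have m0: "m > 0"
    unfolding m_def using ne admissible_cosh[OF adm] by (subst Min_gr_iff) auto
  have "coord x k \<le> sqrt (C / m)" if x: "x \<in> hyp_polyhedron normals" for x k
  proof -
    have nn: "coord x i \<ge> 0" "mink x (v i) \<le> 0" for i using x by (auto simp: in_polyhedron_iff)
    have self: "(\<Sum>i\<in>UNIV. coord x i * - mink x (v i)) = 1"
      using x mink_self[of x] by (simp add: in_polyhedron_iff hyperbolic_space_def sum_negf)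
    have "Max (range (coord x)) \<in> range (coord x)" by (rule Max_in) auto
    then obtain i where i: "coord x i = Max (range (coord x))" by (metis rangeE)
    have max: "coord x j \<le> coord x i" for j unfolding i by (rule Max_ge) auto
    define S where "S = (\<Sum>j\<in>-{i}. coord x j)"
    have "coord x i \<le> (\<Sum>j\<in>-{i}. cosh (l {i, j}) * coord x j)" using nn(2)[of i] mink_v[of x i] by
        simp
    also have "\<dots> \<le> (\<Sum>j\<in>-{i}. C * coord x j)" by (intro sum_mono mult_right_mono C nn)
    finally have iS: "coord x i \<le> C * S" by (simp add: S_def sum_distrib_left)
    have "m * coord x i \<le> - mink x (v j)" if "j \<noteq> i" for j
    proof -
      have "cosh (l {j, i}) * coord x i \<le> (\<Sum>k\<in>-{j}. cosh (l {j, k}) * coord x k)"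
        by (rule member_le_sum) (use that nn in auto)
      then have "cosh (l {j, i}) * coord x i - coord x i \<le> - mink x (v j)"
        using mink_v[of x j] max[of j] by linarith
      moreover have "m * coord x i \<le> (cosh (l {j, i}) - 1) * coord x i"
        by (intro mult_right_mono m that nn)
      ultimately show ?thesis by (simp add: left_diff_distrib)
    qed
    then have "(\<Sum>j\<in>-{i}. coord x j * (m * coord x i)) \<le> (\<Sum>j\<in>-{i}. coord x j * - mink x (v j))"
      by (intro sum_mono mult_left_mono nn) auto
    also have "\<dots> \<le> (\<Sum>j\<in>UNIV. coord x j * - mink x (v j))"
      by (rule sum_mono2) (use nn in \<open>auto simp: mult_nonneg_nonpos\<close>)
    finally have "S * (m * coord x i) \<le> 1" unfolding self by (simp add: S_def sum_distrib_right)
    then have "C * (S * (m * coord x i)) \<le> C * 1" using C0 by (intro mult_left_mono) auto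
    moreover have "coord x i * (m * coord x i) \<le> C * S * (m * coord x i)"
      using iS m0 nn by (intro mult_right_mono) auto
    ultimately have "(coord x i)\<^sup>2 * m \<le> C" by (simp add: power2_eq_square algebra_simps)
    then have "(coord x i)\<^sup>2 \<le> C / m" using m0 by (simp add: pos_le_divide_eq)
    then have "coord x i \<le> sqrt (C / m)" by (rule real_le_rsqrt)
    then show ?thesis using max[of k] by linarith
  qed
  then show ?thesis by blast
qed

lemma compact_polyhedron: "compact (hyp_polyhedron normals)"
proof -
  obtain R where R: "\<And>x i. x \<in> hyp_polyhedron normals \<Longrightarrow> coord x i \<le> R" using coord_bounded by blast
  have "norm x \<le> (\<Sum>i\<in>UNIV. R * norm (v i))" if x: "x \<in> hyp_polyhedron normals" for x
  proof -
    have "norm x \<le> (\<Sum>i\<in>UNIV. norm (coord x i *\<^sub>R v i))" by (subst coord_sum) (rule norm_sum)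
    also have "\<dots> \<le> (\<Sum>i\<in>UNIV. R * norm (v i))"
      by (rule sum_mono) (use x R[OF x] in \<open>auto simp: in_polyhedron_iff intro!: mult_right_mono\<close>)
    finally show ?thesis .
  qed
  then have "bounded (hyp_polyhedron normals)" by (rule boundedI)
  moreover have "closed (hyp_polyhedron normals)"
  proof -
    \<comment> \<open>The strict sign that selects the sheet becomes a closed condition, because
      time coordinate 0 is incompatible with \<open>mink x x = - 1\<close>.\<close>
    have pos: "snd x > 0 \<longleftrightarrow> snd x \<ge> 0" if "mink x x = - 1" for x :: mvec
      using that inner_ge_zero[of "fst x"] by (cases "snd x = 0") (auto simp: mink_def)
    have "hyp_polyhedron normals = {x. mink x x = - 1} \<inter> {x. 0 \<le> snd x} \<inter> (\<Inter>a. {x. mink x (normals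
        a) \<le> 0})"
      unfolding hyp_polyhedron_def hyperbolic_space_def using pos by auto
    moreover have "closed \<dots>"
      unfolding mink_def by (intro closed_Int closed_INT ballI closed_Collect_eq closed_Collect_le
          continuous_intros)
    ultimately show ?thesis by simp
  qed
  ultimately show ?thesis by (simp add: compact_eq_bounded_closed)
qed

text \<open>The end at vertex \<open>i\<close> of the edge \<open>{i, h}\<close>: the part of
  \<open>v h\<close> orthogonal to \<open>v i\<close>, scaled to the hyperboloid.\<close>

definition corner :: "4 \<Rightarrow> 4 \<Rightarrow> mvec" where
  "corner i h = (1 / sinh (l {i, h})) *\<^sub>R (cosh (l {i, h}) *\<^sub>R v i + v h)"

lemma sinh_pos: "i \<noteq> j \<Longrightarrow> sinh (l {i, j}) > 0"
  using adm by (simp add: admissible_def)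

lemma v_products: "mink (v i) (v i) = 1" "i \<noteq> j \<Longrightarrow> mink (v i) (v j) = - cosh (l {i, j})"
  using gram by (auto simp: vertex_gram_def)

lemma corner_mink:
  assumes "i \<noteq> h"
  shows "mink (corner i h) (v i) = 0" "mink (corner i h) (v h) = - sinh (l {i, h})"
    "mink (corner i h) (corner i h) = - 1" "mink (corner i h) (corner h i) = - cosh (l {i, h})"
proof -
  let ?c = "cosh (l {i, h})" and ?s = "sinh (l {i, h})"
  have s: "?s > 0" using sinh_pos[OF assms] .
  have c: "?c\<^sup>2 = ?s\<^sup>2 + 1" by (simp add: cosh_square_eq)
  have hi: "{h, i} = {i, h}" by auto
  have hv: "mink (v h) (v i) = - ?c" using v_products(2)[of h i] assms by (simp add: hi)
  note m = v_products(1) v_products(2)[OF assms] hv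
  show 1: "mink (corner i h) (v i) = 0" by (simp add: corner_def m)
  have "mink (corner i h) (v h) = - (?c\<^sup>2 - 1) / ?s" by (simp add: corner_def m power2_eq_square)
  also have "\<dots> = - ?s" using s unfolding c by (simp add: power2_eq_square)
  finally show 2: "mink (corner i h) (v h) = - ?s" .
  have "mink (corner i h) (corner i h) = (1 / ?s) * (?c * mink (corner i h) (v i) + mink (corner i
      h) (v h))"
    by (subst (2) corner_def) simp
  then show "mink (corner i h) (corner i h) = - 1" using 1 2 s by simp
  have "mink (corner i h) (corner h i) = (1 / ?s) * (?c * mink (corner i h) (v h) + mink (corner i
      h) (v i))"
    by (subst (2) corner_def) (simp add: hi)
  then show "mink (corner i h) (corner h i) = - ?c" using 1 2 s by simp
qed

lemma corner_coord:
  assumes "i \<noteq> h"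
  shows "coord (corner i h) m = (if m = i then cosh (l {i, h}) / sinh (l {i, h}) else if m = h then
      1 / sinh (l {i, h}) else 0)"
proof -
  have "mink (v m) (w m) \<noteq> 0" using wneg[of m] mink_commute[of "v m" "w m"] by simp
  moreover have "mink (v i) (w m) = 0" if "m \<noteq> i" for i using wv[OF that] mink_commute[of "v i" "w
      m"] by simp
  ultimately show ?thesis using assms by (auto simp: coord_def corner_def)
qed

lemma corner_in_polyhedron:
  assumes "i \<noteq> h"
  shows "corner i h \<in> hyp_polyhedron normals"
proof -
  have s: "sinh (l {i, h}) > 0" using sinh_pos[OF assms] .
  have co: "coord (corner i h) m \<ge> 0" for m using s unfolding corner_coord[OF assms] by simp
  have "mink (corner i h) (v m) \<le> 0" for m
  proof -
    consider "m = i" | "m = h" | "m \<noteq> i" "m \<noteq> h" by blast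
    then show ?thesis
    proof cases
      case 3
      have "mink (corner i h) (v m) = - ((\<Sum>j\<in>-{m}. cosh (l {m, j}) * coord (corner i h) j))"
        using 3 unfolding mink_v by (simp add: corner_coord[OF assms])
      also have "\<dots> \<le> 0" using co by (simp add: sum_nonneg)
      finally show ?thesis .
    qed (use corner_mink[OF assms] s in auto)
  qed
  moreover have "snd (corner i h) > 0"
  proof -
    have "snd (corner i h) \<ge> 0" using s future by (simp add: corner_def)
    moreover have "snd (corner i h) \<noteq> 0"
    proof
      assume "snd (corner i h) = 0"
      then have "fst (corner i h) \<bullet> fst (corner i h) = - 1" using corner_mink(3)[OF assms] by (simp
          add: mink_def)
      then show False using inner_ge_zero[of "fst (corner i h)"] by linarith
    qed
    ultimately show ?thesis by simp
  qed
  ultimately show ?thesis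
    using co corner_mink(3)[OF assms] by (simp add: in_polyhedron_iff hyperbolic_space_def)
qed

text \<open>By \<open>face_exclusions\<close>, a point lies on at most two hexagons and on at most
  one triangle, whose index differs from theirs; the hexagons are then padded to exactly two.
  Conversely \<open>corner i h\<close> lies on \<open>Inr i\<close> and on both hexagons that
  contain the edge \<open>{i, h}\<close>.\<close>

lemma faces_meet_iff:
  "(\<exists>x\<in>hyp_polyhedron normals. \<forall>a\<in>S. x \<in> hyp_face normals a) \<longleftrightarrow>
   (\<exists>i j k. distinct [i, j, k] \<and> S \<subseteq> {Inr i, Inl j, Inl k})"
proof
  assume "\<exists>x\<in>hyp_polyhedron normals. \<forall>a\<in>S. x \<in> hyp_face normals a"
  then obtain x where x: "x \<in> hyp_polyhedron normals" "\<And>a. a \<in> S \<Longrightarrow> x \<in> hyp_face normals a" by blast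
  define Z where "Z = {j. coord x j = 0}"
  have Z: "card Z \<le> 2"
  proof (rule ccontr)
    assume "\<not> card Z \<le> 2"
    then have "3 \<le> card Z" by simp
    then obtain T where T: "T \<subseteq> Z" "card T = 3" by (meson obtain_subset_with_card_n)
    then obtain i j k where "T = {i, j, k}" "i \<noteq> j" "i \<noteq> k" "j \<noteq> k" by (auto simp: card_3_iff)
    then show False using face_exclusions(3)[OF x(1), of i j k] T(1) by (auto simp: Z_def)
  qed
  have "\<exists>i. i \<notin> Z \<and> (\<forall>i'. mink x (v i') = 0 \<longrightarrow> i' = i)"
  proof (cases "\<exists>i. mink x (v i) = 0")
    case True
    then obtain i where "mink x (v i) = 0" by blast
    then show ?thesis using face_exclusions(1,2)[OF x(1)] unfolding Z_def by blast
  next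
    case False
    have "Z \<noteq> UNIV" using Z by auto
    then show ?thesis using False by blast
  qed
  then obtain i where i: "i \<notin> Z" "\<And>i'. mink x (v i') = 0 \<Longrightarrow> i' = i" by blast
  have "\<exists>B. Z \<subseteq> B \<and> B \<subseteq> - {i} \<and> card B = 2"
    by (rule exists_subset_between) (use Z i(1) in \<open>auto simp: Compl_eq_Diff_UNIV card_Diff_subset\<close>)
  then obtain B where "Z \<subseteq> B" "i \<notin> B" "card B = 2" by blast
  then obtain j k where B: "Z \<subseteq> {j, k}" "i \<notin> {j, k}" "j \<noteq> k" by (auto simp: card_2_iff)
  have "a \<in> {Inr i, Inl j, Inl k}" if "a \<in> S" for a
  proof (cases a)
    case (Inl m)
    then have "m \<in> Z" using x(2)[OF that] by (simp add: in_face_iff Z_def)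
    then show ?thesis using B(1) Inl by blast
  next
    case (Inr m)
    then have "mink x (v m) = 0" using x(2)[OF that] by (simp add: in_face_iff)
    then show ?thesis using i(2) Inr by blast
  qed
  then have "S \<subseteq> {Inr i, Inl j, Inl k}" by blast
  moreover have "distinct [i, j, k]" using B by auto
  ultimately show "\<exists>i j k. distinct [i, j, k] \<and> S \<subseteq> {Inr i, Inl j, Inl k}" by blast
next
  assume "\<exists>i j k. distinct [i, j, k] \<and> S \<subseteq> {Inr i, Inl j, Inl k}"
  then obtain i j k where d: "distinct [i, j, k]" and S: "S \<subseteq> {Inr i, Inl j, Inl k}" by blast
  have "card {i, j, k} < CARD(4)" using d by simp
  then have "{i, j, k} \<noteq> UNIV" by auto
  then obtain h where h: "h \<notin> {i, j, k}" by blast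
  then have "i \<noteq> h" by auto
  have "corner i h \<in> hyp_face normals a" if "a \<in> {Inr i, Inl j, Inl k}" for a
    using that d h corner_in_polyhedron[OF \<open>i \<noteq> h\<close>] corner_mink(1)[OF \<open>i \<noteq> h\<close>] corner_coord[OF \<open>i \<noteq>
        h\<close>]
    by (auto simp: in_face_iff)
  then show "\<exists>x\<in>hyp_polyhedron normals. \<forall>a\<in>S. x \<in> hyp_face normals a"
    using corner_in_polyhedron[OF \<open>i \<noteq> h\<close>] S by blast
qed

lemma hyper_ideal_normals: "hyper_ideal_tetrahedron normals"
  unfolding hyper_ideal_tetrahedron_def
proof (intro conjI allI impI)
  show "mink (normals a) (normals a) = 1" for a by (cases a) (simp_all add: w1 v_products)
  show "compact (hyp_polyhedron normals)" by (rule compact_polyhedron)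
  show "mink (normals (Inr i)) (normals (Inl j)) = 0" if "i \<noteq> j" for i j
    using wv[of j i] that mink_commute[of "v i" "w j"] by simp
qed (rule faces_meet_iff)

lemma edge_end:
  assumes "i \<noteq> j" "x \<in> hyp_edge normals {i, j}" "x \<in> hyp_face normals (Inr i)"
  shows "x = corner i j"
proof -
  let ?c = "cosh (l {i, j})" and ?s = "sinh (l {i, j})"
  have P: "x \<in> hyp_polyhedron normals" "mink x (v i) = 0" using assms(3) by (simp_all add:
      in_face_iff)
  have zero: "coord x k = 0" if "k \<notin> {i, j}" for k
    using assms(2) that by (auto simp: hyp_edge_def in_face_iff)
  have "x = (\<Sum>k\<in>UNIV. coord x k *\<^sub>R v k)" by (rule coord_sum)
  also have "\<dots> = (\<Sum>k\<in>{i, j}. coord x k *\<^sub>R v k)" by (rule sum.mono_neutral_right) (use zero in auto)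
  also have "\<dots> = coord x i *\<^sub>R v i + coord x j *\<^sub>R v j" using assms(1) by simp
  finally have x: "x = coord x i *\<^sub>R v i + coord x j *\<^sub>R v j" .
  have ji: "{j, i} = {i, j}" by auto
  have vji: "mink (v j) (v i) = - ?c" using v_products(2)[of j i] assms(1) by (simp add: ji)
  have "mink x (v i) = coord x i - coord x j * ?c" by (subst x) (simp add: v_products vji)
  then have ci: "coord x i = ?c * coord x j" using P(2) by (simp add: mult.commute)
  have "mink x (v j) = coord x j - ?c * coord x i" by (subst x) (simp add: v_products(1)
      v_products(2)[OF assms(1)])
  then have xj: "mink x (v j) = - (coord x j * ?s\<^sup>2)"
    unfolding ci by (simp add: cosh_square_eq algebra_simps flip: power2_eq_square)
  have "mink x x = coord x i * mink x (v i) + coord x j * mink x (v j)"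
    by (subst (2) x) simp
  then have "(coord x j * ?s)\<^sup>2 = 1"
    using P unfolding xj by (simp add: in_polyhedron_iff hyperbolic_space_def power2_eq_square
        mult_ac)
  moreover have "coord x j * ?s \<ge> 0" using P(1) sinh_pos[OF assms(1)] by (simp add:
      in_polyhedron_iff)
  ultimately have "coord x j * ?s = 1" by (simp add: power2_eq_1_iff)
  then have "coord x j = 1 / ?s" using sinh_pos[OF assms(1)] by (simp add: field_simps)
  then show ?thesis using x ci by (simp add: corner_def scaleR_right_distrib)
qed

lemma edge_lengths_normals: "has_edge_lengths normals l"
  unfolding has_edge_lengths_def
proof (intro allI impI ballI)
  fix i j x y assume ij: "i \<noteq> j" and x: "x \<in> hyp_edge normals {i, j} \<inter> hyp_face normals (Inr i)"
    and y: "y \<in> hyp_edge normals {i, j} \<inter> hyp_face normals (Inr j)"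
  have "x = corner i j" using x by (intro edge_end ij) auto
  moreover have "y = corner j i" using y ij by (intro edge_end) (auto simp: insert_commute)
  moreover have "l {i, j} > 0" using adm ij by (simp add: admissible_def)
  ultimately show "hyp_dist x y = l {i, j}"
    using corner_mink(4)[OF ij] by (simp add: hyp_dist_def arcosh_cosh_real)
qed

end

section \<open>Edge lengths determine the dihedral angles\<close>

lemma complement_pair_4:
  fixes i j :: 4
  assumes "i \<noteq> j"
  obtains k h where "distinct [i, j, k, h]" "- {i, j} = {k, h}"
proof -
  have "card (- {i, j}) = 2" using assms by (simp add: Compl_eq_Diff_UNIV card_Diff_subset)
  then obtain k h where kh: "- {i, j} = {k, h}" "k \<noteq> h" by (auto simp: card_2_iff)
  have "k \<notin> {i, j}" "h \<notin> {i, j}" using kh(1) by blast+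
  then have "distinct [i, j, k, h]" using assms kh(2) by auto
  then show thesis using kh(1) that by blast
qed

lemma tetrahedron_exists:
  assumes "admissible l"
  shows "l \<in> hyper_ideal_lengths"
proof -
  obtain v where v: "vertex_gram l v" "\<And>i. snd (v i) \<ge> 0" using vertex_gram_exists[OF assms] by
      blast
  have "\<exists>w. mink w w = 1 \<and> (\<forall>i. i \<noteq> h \<longrightarrow> mink w (v i) = 0) \<and> mink w (v h) < 0" for h
  proof -
    obtain i j k where d: "distinct [i, j, k, h]" by (rule distinct_4_split)
    define u where "u = conormal l v i j k h"
    note cm = conormal_mink[OF v(1) d, folded u_def]
    have neg: "mink u (v h) > 0" using cm(4) assms d by (simp add: admissible_def)
    have zero: "mink u (v m) = 0" if "m \<noteq> h" for m
      using cm(1-3) distinct_4_cases[OF d, of m] that by auto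
    have "mink u u > 0"
    proof (rule ccontr)
      assume "\<not> mink u u > 0"
      then have "mink u u \<le> 0" by simp
      \<comment> \<open>This vector points to the midpoint of the edge. It is timelike and
        orthogonal to \<open>u\<close>, which forces \<open>u\<close> to be spacelike, so
        \<open>u\<close> can be normalised to a face normal.\<close>
      moreover have "mink (v i + v j) (v i + v j) < 0"
      proof -
        have "mink (v i) (v j) = - cosh (l {i, j})" "mink (v j) (v i) = - cosh (l {i, j})"
          using v(1) d by (auto simp: vertex_gram_def insert_commute)
        moreover have "cosh (l {i, j}) > 1" using assms d by (intro admissible_cosh) auto
        ultimately show ?thesis using v(1) by (simp add: vertex_gram_def)
      qed
      moreover have "mink (v i + v j) u = 0"
        using cm(1,2) mink_commute[of "v i" u] mink_commute[of "v j" u] by simp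
      ultimately have "u = 0" by (intro mink_orthogonal_timelike[of "v i + v j" u])
      then show False using neg by simp
    qed
    then show ?thesis
      using neg zero by (intro exI[of _ "- (1 / sqrt (mink u u)) *\<^sub>R u"]) (auto simp: field_simps)
  qed
  then obtain w where w: "\<And>h. mink (w h) (w h) = 1" "\<And>h i. h \<noteq> i \<Longrightarrow> mink (w h) (v i) = 0"
    "\<And>h. mink (w h) (v h) < 0" by metis
  interpret tetrahedron_frame l v w
    by unfold_locales (use assms v w in auto)
  show ?thesis
    unfolding hyper_ideal_lengths_def using hyper_ideal_normals edge_lengths_normals by blast
qed

lemma hyper_ideal_tetrahedronD:
  assumes "hyper_ideal_tetrahedron n"
  shows "mink (n a) (n a) = 1" "i \<noteq> j \<Longrightarrow> mink (n (Inr i)) (n (Inl j)) = 0"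
    and "distinct [i, j, k] \<Longrightarrow> \<exists>x\<in>hyp_polyhedron n. x \<in> hyp_face n (Inr i) \<inter> hyp_face n (Inl j) \<inter>
        hyp_face n (Inl k)"
    and "hyp_face n (Inr h) \<inter> hyp_face n (Inl h) = {}"
proof -
  note conjs = assms[unfolded hyper_ideal_tetrahedron_def]
  have iff: "(\<exists>x\<in>hyp_polyhedron n. \<forall>a\<in>S. x \<in> hyp_face n a) \<longleftrightarrow>
          (\<exists>i j k. distinct [i, j, k] \<and> S \<subseteq> {Inr i, Inl j, Inl k})" for S
    by (rule conjs[THEN conjunct2, THEN conjunct2, THEN conjunct1, rule_format])
  show "mink (n a) (n a) = 1" by (rule conjs[THEN conjunct1, rule_format])
  show "i \<noteq> j \<Longrightarrow> mink (n (Inr i)) (n (Inl j)) = 0"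
    by (rule conjs[THEN conjunct2, THEN conjunct2, THEN conjunct2, rule_format])
  show "\<exists>x\<in>hyp_polyhedron n. x \<in> hyp_face n (Inr i) \<inter> hyp_face n (Inl j) \<inter> hyp_face n (Inl k)" if
      "distinct [i, j, k]"
  proof -
    have "\<exists>x\<in>hyp_polyhedron n. \<forall>a\<in>{Inr i, Inl j, Inl k}. x \<in> hyp_face n a"
      unfolding iff using that by blast
    then show ?thesis by auto
  qed
  show "hyp_face n (Inr h) \<inter> hyp_face n (Inl h) = {}"
  proof (rule ccontr)
    assume "hyp_face n (Inr h) \<inter> hyp_face n (Inl h) \<noteq> {}"
    then obtain x where x: "x \<in> hyp_face n (Inr h)" "x \<in> hyp_face n (Inl h)" by blast
    then have "x \<in> hyp_polyhedron n" by (simp add: hyp_face_def)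
    then have "\<exists>x\<in>hyp_polyhedron n. \<forall>a\<in>{Inr h, Inl h}. x \<in> hyp_face n a" using x by blast
    then obtain i j k where "distinct [i, j, k]" "{Inr h, Inl h} \<subseteq> {Inr i, Inl j, Inl k}"
      unfolding iff by blast
    then show False by auto
  qed
qed

lemma hyp_faceD:
  assumes "x \<in> hyp_face n a"
  shows "mink x x = - 1" "mink x (n a) = 0" "mink x (n b) \<le> 0" "x \<in> hyperbolic_space"
  using assms by (auto simp: hyp_face_def hyp_polyhedron_def hyperbolic_space_def)

text \<open>The end points \<open>x, y\<close> of the edge \<open>{i, j}\<close> and the normals of the two faces meeting there span
  Minkowski space, which identifies the normals of the truncating planes at \<open>i\<close> and \<open>j\<close>.\<close>

lemma truncation_normals:
  assumes n: "hyper_ideal_tetrahedron n" and len: "has_edge_lengths n l" and pos: "l {i, j} > 0"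
    and d: "distinct [i, j, k, h]" "- {i, j} = {k, h}"
  obtains x y where "x \<in> hyp_face n (Inr i)" "y \<in> hyp_face n (Inr j)"
    "mink x x = - 1" "mink y y = - 1" "mink x y = - cosh (l {i, j})"
    "n (Inr i) = (1 / sinh (l {i, j})) *\<^sub>R (cosh (l {i, j}) *\<^sub>R x - y)"
    "n (Inr j) = (1 / sinh (l {i, j})) *\<^sub>R (cosh (l {i, j}) *\<^sub>R y - x)"
proof -
  let ?C = "cosh (l {i, j})" and ?s = "sinh (l {i, j})"
  let ?mk = "n (Inl k)" and ?mh = "n (Inl h)"
  have s: "?s > 0" using pos by simp
  have C: "?C\<^sup>2 = ?s\<^sup>2 + 1" by (simp add: cosh_square_eq)
  note T = hyper_ideal_tetrahedronD[OF n]
  have "distinct [i, k, h]" "distinct [j, k, h]" using d by auto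
  then obtain x y where x: "x \<in> hyp_face n (Inr i)" "x \<in> hyp_face n (Inl k)" "x \<in> hyp_face n (Inl
      h)"
    and y: "y \<in> hyp_face n (Inr j)" "y \<in> hyp_face n (Inl k)" "y \<in> hyp_face n (Inl h)"
    using T(3) by (metis IntE)
  have "x \<in> hyp_edge n {i, j} \<inter> hyp_face n (Inr i)" "y \<in> hyp_edge n {i, j} \<inter> hyp_face n (Inr j)"
    using x y unfolding hyp_edge_def d(2) by auto
  then have "hyp_dist x y = l {i, j}"
    using len d(1) unfolding has_edge_lengths_def by (metis distinct_length_2_or_more)
  moreover have "mink x y \<le> - 1" using hyp_faceD(4)[OF x(1)] hyp_faceD(4)[OF y(1)] by (rule
      mink_hyperbolic_le)
  ultimately have "- mink x y = ?C" unfolding hyp_dist_def by (metis cosh_arcosh_real le_minus_iff)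
  then have xy: "mink x y = - ?C" "mink y x = - ?C" by (simp_all add: mink_commute[of y x])
  note xx = hyp_faceD(1)[OF x(1)] and yy = hyp_faceD(1)[OF y(1)]
  have kh: "mink x ?mk = 0" "mink x ?mh = 0" "mink y ?mk = 0" "mink y ?mh = 0"
    using hyp_faceD(2) x y by blast+
  define g where "g = mink ?mk ?mh"
  define mh' where "mh' = ?mh - g *\<^sub>R ?mk"
  define y' where "y' = y - ?C *\<^sub>R x"
  have y'y': "mink y' y' = ?s\<^sup>2"
    by (simp add: y'_def xx yy xy algebra_simps flip: power2_eq_square) (simp add: C)
  have unit: "mink ?mk ?mk = 1" "mink ?mh ?mh = 1" using T(1) by auto
  have mh'mh': "mink mh' mh' = 1 - g\<^sup>2"
    by (simp add: mh'_def unit g_def[symmetric] mink_commute[of ?mh ?mk] power2_eq_square)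
  \<comment> \<open>Were the two hexagon normals proportional, a corner on \<open>Inr h\<close> and
    \<open>Inl k\<close> would also lie on \<open>Inl h\<close>, a face disjoint from
    \<open>Inr h\<close>.\<close>
  have "mh' \<noteq> 0"
  proof
    assume "mh' = 0"
    then have mh: "?mh = g *\<^sub>R ?mk" by (simp add: mh'_def)
    have "distinct [h, k, i]" using d by auto
    then obtain z where z: "z \<in> hyp_face n (Inr h)" "z \<in> hyp_face n (Inl k)" using T(3) by blast
    then have "mink z ?mh = 0" unfolding mh using hyp_faceD(2)[OF z(2)] by simp
    then have "z \<in> hyp_face n (Inl h)" using z(1) by (simp add: hyp_face_def)
    then show False using T(4)[of h] z(1) by blast
  qed
  moreover have "mink x mh' = 0" by (simp add: mh'_def kh)
  ultimately have g1: "mink mh' mh' \<noteq> 0" using mink_orthogonal_timelike[of x mh'] xx by force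
  \<comment> \<open>An orthogonal basis by Gram-Schmidt. As no member is null, it is a dual family
    of itself.\<close>
  define q :: "4 \<Rightarrow> mvec" where "q m = (if m = 1 then x else if m = 2 then y' else if m = 3 then ?mk
      else mh')" for m
  have q: "q 1 = x" "q 2 = y'" "q 3 = ?mk" "q 4 = mh'" by (simp_all add: q_def)
  have o: "mink x y' = 0" "mink x ?mk = 0" "mink x mh' = 0" "mink y' ?mk = 0" "mink y' mh' = 0"
      "mink ?mk mh' = 0"
    by (simp_all add: y'_def mh'_def xx xy kh unit g_def)
  have o': "mink y' x = 0" "mink ?mk x = 0" "mink mh' x = 0" "mink ?mk y' = 0" "mink mh' y' = 0"
      "mink mh' ?mk = 0"
    by (subst mink_commute, rule o)+
  have span: "r = 0" if "mink r x = 0" "mink r y = 0" "mink r ?mk = 0" "mink r ?mh = 0" for r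
  proof (rule mink_dual_family[of q q])
    show "mink (q a) (q b) = 0" if "a \<noteq> b" for a b
      using exhaust_4[of a] exhaust_4[of b] that by (elim disjE) (simp_all add: q o o')
    show "mink (q a) (q a) \<noteq> 0" for a
      using exhaust_4[of a] s by (elim disjE) (simp_all add: q xx y'y' unit g1)
    show "mink r (q a) = 0" for a
      using exhaust_4[of a] by (elim disjE) (simp_all add: q that y'_def mh'_def)
  qed
  \<comment> \<open>Stated for arbitrary end points so that it applies again with \<open>x\<close>
    and \<open>y\<close> exchanged. The sign of \<open>mink u y\<close> selects the outward one of
    the two unit normals.\<close>
  have normal: "u = (1 / ?s) *\<^sub>R (?C *\<^sub>R x - y)"
    if u: "mink u u = 1" "mink u ?mk = 0" "mink u ?mh = 0" "mink u x = 0" "mink u y \<le> 0"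
      and xy: "mink x x = - 1" "mink y y = - 1" "mink x y = - ?C" "mink y x = - ?C"
      and kh: "mink x ?mk = 0" "mink x ?mh = 0" "mink y ?mk = 0" "mink y ?mh = 0"
      and span: "\<And>r. mink r x = 0 \<Longrightarrow> mink r y = 0 \<Longrightarrow> mink r ?mk = 0 \<Longrightarrow> mink r ?mh = 0 \<Longrightarrow> r = 0"
    for u x y
  proof -
    define t where "t = - mink u y / ?s\<^sup>2"
    have "u - t *\<^sub>R (?C *\<^sub>R x - y) = 0"
    proof (rule span)
      have "?C * ?C = ?s\<^sup>2 + 1" using C by (simp add: power2_eq_square)
      then show "mink (u - t *\<^sub>R (?C *\<^sub>R x - y)) y = 0" using s by (simp add: xy t_def field_simps)
    qed (use u xy kh in simp_all)
    then have ut: "u = t *\<^sub>R (?C *\<^sub>R x - y)" by simp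
    have "mink (?C *\<^sub>R x - y) (?C *\<^sub>R x - y) = ?C\<^sup>2 - 1"
      by (simp add: xy power2_eq_square algebra_simps)
    moreover have "mink u u = t * (t * mink (?C *\<^sub>R x - y) (?C *\<^sub>R x - y))"
      by (subst (1 2) ut) (simp add: algebra_simps)
    ultimately have "mink u u = t * (t * ?s\<^sup>2)" by (simp add: C)
    then have "(t * ?s)\<^sup>2 = 1" using u(1) by (simp add: power2_eq_square mult_ac)
    moreover have "t \<ge> 0" using u(5) unfolding t_def by (intro divide_nonneg_nonneg) auto
    then have "t * ?s \<ge> 0" using s by simp
    ultimately have "t * ?s = 1" by (simp add: power2_eq_1_iff)
    then have "t = 1 / ?s" using s by (simp add: field_simps)
    then show ?thesis using ut by simp
  qed
  have "n (Inr i) = (1 / ?s) *\<^sub>R (?C *\<^sub>R x - y)"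
  proof (rule normal[OF _ _ _ _ _ xx yy xy kh span])
    show "mink (n (Inr i)) x = 0" "mink (n (Inr i)) y \<le> 0"
      using hyp_faceD(2)[OF x(1)] hyp_faceD(3)[OF y(1)] by (subst mink_commute; simp)+
  qed (use T(1,2) d(1) in auto)
  moreover have "n (Inr j) = (1 / ?s) *\<^sub>R (?C *\<^sub>R y - x)"
  proof (rule normal[OF _ _ _ _ _ yy xx xy(2,1) kh(3,4,1,2)])
    show "mink (n (Inr j)) y = 0" "mink (n (Inr j)) x \<le> 0"
      using hyp_faceD(2)[OF y(1)] hyp_faceD(3)[OF x(1)] by (subst mink_commute; simp)+
    show "r = 0" if "mink r y = 0" "mink r x = 0" "mink r ?mk = 0" "mink r ?mh = 0" for r
      using span that by blast
  qed (use T(1,2) d(1) in auto)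
  ultimately show thesis using that[OF x(1) y(1) xx yy xy(1)] by blast
qed

lemma tetrahedron_vertex_gram:
  assumes n: "hyper_ideal_tetrahedron n" and len: "has_edge_lengths n l" and adm: "admissible l"
  shows "vertex_gram l (\<lambda>i. n (Inr i))" and "mink (n (Inl j)) (n (Inr j)) \<le> 0"
proof -
  have pos: "l {i, j} > 0" if "i \<noteq> j" for i j using adm that by (simp add: admissible_def)
  note T = hyper_ideal_tetrahedronD[OF n]
  have gram: "mink (n (Inr i)) (n (Inr j)) = - cosh (l {i, j})" and neg: "mink (n (Inl j)) (n (Inr
      j)) \<le> 0"
    if ij: "i \<noteq> j" for i j
  proof -
    let ?C = "cosh (l {i, j})" and ?s = "sinh (l {i, j})"
    have s: "?s > 0" using pos[OF ij] by simp
    have C: "?C * ?C = ?s * ?s + 1" using cosh_square_eq[of "l {i, j}"] by (simp add: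
        power2_eq_square)
    obtain k h where d: "distinct [i, j, k, h]" "- {i, j} = {k, h}" by (rule complement_pair_4[OF
        ij])
    obtain x y where xy: "x \<in> hyp_face n (Inr i)" "y \<in> hyp_face n (Inr j)"
      "mink x x = - 1" "mink y y = - 1" "mink x y = - ?C"
      and ni: "n (Inr i) = (1 / ?s) *\<^sub>R (?C *\<^sub>R x - y)" and nj: "n (Inr j) = (1 / ?s) *\<^sub>R (?C *\<^sub>R y
          - x)"
      by (rule truncation_normals[OF n len pos[OF ij] d])
    have yx: "mink y x = - ?C" using xy(5) mink_commute[of y x] by simp
    have "mink (n (Inr i)) (n (Inr j)) = (1 / ?s) * (1 / ?s) * (- ?C * (?C * ?C - 1))"
      unfolding ni nj by (simp add: xy yx algebra_simps)
    also have "\<dots> = - ?C" unfolding C using s by simp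
    finally show "mink (n (Inr i)) (n (Inr j)) = - ?C" .
    \<comment> \<open>This combination is a positive multiple of the end point \<open>x\<close>. As
      \<open>n (Inl j)\<close> is orthogonal to \<open>n (Inr i)\<close>, the sign of its product
      with \<open>x\<close> passes to its product with \<open>n (Inr j)\<close>.\<close>
    have "?C *\<^sub>R n (Inr i) + n (Inr j) = ((?C * ?C - 1) / ?s) *\<^sub>R x"
      unfolding ni nj by (simp add: algebra_simps diff_divide_distrib)
    also have "(?C * ?C - 1) / ?s = ?s" unfolding C using s by simp
    finally have "mink (?C *\<^sub>R n (Inr i) + n (Inr j)) (n (Inl j)) = ?s * mink x (n (Inl j))" by simp
    moreover have "mink (n (Inr i)) (n (Inl j)) = 0" using T(2) ij by blast
    moreover have "mink x (n (Inl j)) \<le> 0" using hyp_faceD(3)[OF xy(1)] .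
    ultimately have "mink (n (Inr j)) (n (Inl j)) \<le> 0" using s by (simp add: mult_le_0_iff)
    then show "mink (n (Inl j)) (n (Inr j)) \<le> 0" using mink_commute[of "n (Inl j)"] by metis
  qed
  show "vertex_gram l (\<lambda>i. n (Inr i))" unfolding vertex_gram_def using gram T(1) by auto
  obtain i where "i \<noteq> j" using distinct_4_split[of j] by (metis distinct_length_2_or_more)
  then show "mink (n (Inl j)) (n (Inr j)) \<le> 0" by (rule neg)
qed

text \<open>For any realisation the lengths fix the Gram matrix of the truncation normals, and hence
  the angles; \<open>tetrahedron_exists\<close> provides a realisation, so the definite description
  is meaningful.\<close>

lemma dihedral_angle_eq_extended_angle:
  assumes adm: "admissible l" and "card s = 2"
  shows "dihedral_angle l s = extended_angle l s"
proof -
  obtain i j k h where d: "distinct [i, j, k, h]" "s = {i, j}" "- s = {k, h}" by (rule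
      pair_4_cases[OF assms(2)])
  have angle: "arccos (- mink (n (Inl k)) (n (Inl h))) = extended_angle l s"
    if n: "hyper_ideal_tetrahedron n" "has_edge_lengths n l" and kh: "k \<noteq> h" "- s = {k, h}" for n k
        h
  proof -
    have "k \<notin> s" "h \<notin> s" using kh(2) by blast+
    then have d': "distinct [i, j, k, h]" using d kh(1) by auto
    note T = hyper_ideal_tetrahedronD[OF n(1)]
    show ?thesis unfolding d(2)
    proof (rule mink_normals[OF adm tetrahedron_vertex_gram(1)[OF n adm] d'])
      have z: "mink (n (Inl a)) (n (Inr b)) = 0" if "a \<noteq> b" for a b
        using T(2)[of b a] that mink_commute[of "n (Inl a)"] by metis
      show "mink (n (Inl h)) (n (Inr i)) = 0" "mink (n (Inl h)) (n (Inr j)) = 0" "mink (n (Inl h))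
          (n (Inr k)) = 0"
        "mink (n (Inl k)) (n (Inr i)) = 0" "mink (n (Inl k)) (n (Inr j)) = 0" "mink (n (Inl k)) (n
            (Inr h)) = 0"
        using d' by (auto intro: z)
    qed (use T(1) tetrahedron_vertex_gram(2)[OF n adm] in auto)
  qed
  obtain n where n: "hyper_ideal_tetrahedron n" "has_edge_lengths n l"
    using tetrahedron_exists[OF adm] unfolding hyper_ideal_lengths_def by blast
  show ?thesis
    unfolding dihedral_angle_def
  proof (rule the_equality)
    show "\<exists>n k h. hyper_ideal_tetrahedron n \<and> has_edge_lengths n l \<and> k \<noteq> h \<and> - s = {k, h} \<and>
        extended_angle l s = arccos (- mink (n (Inl k)) (n (Inl h)))"
    proof (intro exI conjI)
      show "k \<noteq> h" using d(1) by simp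
      then show "extended_angle l s = arccos (- mink (n (Inl k)) (n (Inl h)))"
        by (rule angle[OF n _ d(3), symmetric])
    qed (fact n d(3))+
  next
    fix a
    assume "\<exists>n k h. hyper_ideal_tetrahedron n \<and> has_edge_lengths n l \<and> k \<noteq> h \<and> - s = {k, h} \<and>
        a = arccos (- mink (n (Inl k)) (n (Inl h)))"
    then obtain n k h where n: "hyper_ideal_tetrahedron n" "has_edge_lengths n l" "k \<noteq> h" "- s = {k,
        h}"
      and a: "a = arccos (- mink (n (Inl k)) (n (Inl h)))" by (elim exE conjE)
    show "a = extended_angle l s" unfolding a by (rule angle[OF n])
  qed
qed

section \<open>Hyper-ideal metrics in the cube and convergence of the flow\<close>

lemma admissible_box:
  assumes "\<And>s. card s = 2 \<Longrightarrow> l s \<in> {0<..arcosh 2}"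
  shows "admissible l"
proof -
  have c: "cosh (l {i, j}) \<in> {1..11/5}" if "i \<noteq> j" for i j
  proof -
    have "cosh (l {i, j}) \<le> cosh (arcosh 2)"
      using assms[of "{i, j}"] that by (intro cosh_real_nonneg_le_iff[THEN iffD2]) auto
    then show ?thesis by (simp add: cosh_real_ge_1)
  qed
  have "l {i, j} > 0" if "i \<noteq> j" for i j using assms[of "{i, j}"] that by simp
  moreover have "tdelta (cosh (l {i, j})) (cosh (l {k, h})) (cosh (l {i, k}))
        (cosh (l {i, h})) (cosh (l {j, k})) (cosh (l {j, h})) > 0" if "distinct [i, j, k, h]" for i
            j k h
    by (rule tdelta_pos_box) (use that in \<open>auto intro!: c simp del: atLeastAtMost_iff\<close>)
  ultimately show ?thesis by (auto simp: admissible_def)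
qed

lemma positive_functions_iff:
  "f \<in> positive_functions M \<longleftrightarrow> f \<in> extensional (edges M) \<and> (\<forall>e\<in>edges M. f e > 0)"
  by (auto simp: positive_functions_def PiE_def Pi_def)

theorem theorem1p9:
  fixes M :: "'a triangulation"
  assumes "closed_pseudo_3_manifold M"
    and "\<And>e. e \<in> edges M \<Longrightarrow> valence M e \<ge> 10"
  shows "\<exists>l. zero_curvature_metric M l \<and>
    {l' \<in> positive_functions M. \<forall>e\<in>edges M. generalized_ricci M l' e = 0} = {l} \<and>
    l \<in> edges M \<rightarrow>\<^sub>E {inverse (3 * real (Max (valence M ` edges M))) .. arcosh 3} \<and>
    (\<forall>l0 \<in> positive_functions M.
       (\<exists>L. extended_ricci_flow M l0 L) \<and>
       (\<forall>L. extended_ricci_flow M l0 L \<longrightarrow> converges_exponentially M L l))"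
proof -
  have fin: "finite (tets M)" using assms(1) by (simp add: closed_pseudo_3_manifold_def)
  \<comment> \<open>A triangulation without edges has no largest valence; the default 10 keeps
    \<open>10 \<le> d\<close> true there.\<close>
  define d where "d = (if edges M = {} then 10 else Max (valence M ` edges M))"
  have val: "10 \<le> valence M e \<and> valence M e \<le> d" if "e \<in> edges M" for e
    using assms(2)[OF that] that finite_edges[OF fin] by (auto simp: d_def)
  have d10: "10 \<le> d"
    using val by (cases "edges M = {}") (auto simp: d_def intro: order_trans)
  define lo where "lo = inverse (3 * real d)"
  interpret curvature "edges M" "generalized_ricci M" lo "arcosh 2" "min lo (arcosh 2 - arcosh
      (19/10))"
    "2 * pi + pi * card (tet_edges M)"
    unfolding lo_def by (rule curvature_generalized_ricci[OF fin val d10])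
  obtain x where x: "\<And>e. e \<in> edges M \<Longrightarrow> x e \<in> {lo..arcosh 2}" "\<And>e. e \<in> edges M \<Longrightarrow> generalized_ricci M
      x e = 0"
    using zero_exists by blast
  define l where "l = restrict x (edges M)"
  have l: "l e \<in> {lo..arcosh 2}" "generalized_ricci M l e = 0" if "e \<in> edges M" for e
    using x[OF that] cong[of l x e] that by (simp_all add: l_def)
  have ext: "l \<in> extensional (edges M)" by (simp add: l_def)
  have lpos: "l \<in> positive_functions M"
    unfolding positive_functions_iff using ext order.strict_trans2[OF lo] l(1) by simp
  have tl: "tet_lengths M l j s \<in> {0<..arcosh 2}" if "j \<in> tets M" "card s = 2" for j s
    using l(1)[OF edge_proj_mem[OF that]] lo by (simp add: tet_lengths_def)
  have adm: "admissible (tet_lengths M l j)" if "j \<in> tets M" for j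
    by (rule admissible_box) (rule tl[OF that])
  have metric: "l \<in> hyper_ideal_metrics M"
    using lpos tetrahedron_exists[OF adm] by (simp add: hyper_ideal_metrics_def)
  have "ricci M l e = generalized_ricci M l e" for e
  proof -
    have "(\<Sum>(j, s)\<in>edge_fibre M e. dihedral_angle (tet_lengths M l j) s)
        = (\<Sum>(j, s)\<in>edge_fibre M e. extended_angle (tet_lengths M l j) s)"
    proof (rule sum.cong[OF refl], clarify)
      fix j s assume "(j, s) \<in> edge_fibre M e"
      then have "j \<in> tets M" "card s = 2" using tet_edge_card by metis+
      then show "dihedral_angle (tet_lengths M l j) s = extended_angle (tet_lengths M l j) s"
        by (intro dihedral_angle_eq_extended_angle adm)
    qed
    then show ?thesis by (simp add: ricci_def generalized_ricci_def)
  qed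
  then have zero: "zero_curvature_metric M l" using metric l(2) by (simp add:
      zero_curvature_metric_def)
  have "l' = l" if "l' \<in> positive_functions M" "\<forall>e\<in>edges M. generalized_ricci M l' e = 0" for l'
  proof (rule extensionalityI[OF _ ext])
    show "l' \<in> extensional (edges M)" using that(1) by (simp add: positive_functions_iff)
    have "l' e > 0" "generalized_ricci M l' e = 0" if "e \<in> edges M" for e
      using \<open>l' \<in> positive_functions M\<close> \<open>\<forall>e\<in>edges M. generalized_ricci M l' e = 0\<close> that
      by (simp_all add: positive_functions_iff)
    note l' = this
    show "l' e = l e" if "e \<in> edges M" for e
      by (rule zero_unique[OF l(1) l(2) l'(1) l'(2) that])
  qed
  note uniq = this
  have unique: "{l' \<in> positive_functions M. \<forall>e\<in>edges M. generalized_ricci M l' e = 0} = {l}"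
  proof (intro equalityI subsetI)
    fix l' assume "l' \<in> {l' \<in> positive_functions M. \<forall>e\<in>edges M. generalized_ricci M l' e = 0}"
    then have "l' = l" by (intro uniq) simp_all
    then show "l' \<in> {l}" by simp
  qed (use lpos l(2) in simp)
  have arcosh: "arcosh 2 \<le> arcosh (3 :: real)" by (rule less_imp_le) simp
  have box: "l \<in> edges M \<rightarrow>\<^sub>E {inverse (3 * real (Max (valence M ` edges M))) .. arcosh 3}"
  proof (rule PiE_I)
    fix e assume e: "e \<in> edges M"
    then have "lo = inverse (3 * real (Max (valence M ` edges M)))" by (auto simp: lo_def d_def)
    then show "l e \<in> {inverse (3 * real (Max (valence M ` edges M))) .. arcosh 3}"
      using l(1)[OF e] arcosh by simp
  qed (simp add: l_def)
  have exists: "\<exists>L. extended_ricci_flow M l0 L" if l0: "l0 \<in> positive_functions M" for l0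
  proof -
    have "\<exists>L. (\<forall>e\<in>edges M. L 0 e = l0 e) \<and> (\<forall>t e. L t e > 0) \<and> (\<forall>t\<ge>0. \<forall>e\<in>edges M.
        ((\<lambda>s. L s e) has_real_derivative generalized_ricci M (L t) e * L t e) (at t within {0..}))"
      by (rule flow_exists) (use l0 in \<open>simp add: positive_functions_iff\<close>)
    then obtain L where L: "\<forall>e\<in>edges M. L 0 e = l0 e" "\<forall>t e. L t e > 0"
      "\<forall>t\<ge>0. \<forall>e\<in>edges M.
        ((\<lambda>s. L s e) has_real_derivative generalized_ricci M (L t) e * L t e) (at t within {0..})"
      by (elim exE conjE)
    define L' where "L' t = restrict (L t) (edges M)" for t
    have L': "L' t e = L t e" if "e \<in> edges M" for t e using that by (simp add: L'_def)
    have K: "generalized_ricci M (L' t) e = generalized_ricci M (L t) e" if "e \<in> edges M" for t e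
      by (rule cong[OF L' that])
    have "L' 0 = l0"
    proof (rule extensionalityI[of _ "edges M"])
      show "L' 0 \<in> extensional (edges M)" by (simp add: L'_def)
      show "l0 \<in> extensional (edges M)" using l0 by (simp add: positive_functions_iff)
      show "L' 0 e = l0 e" if "e \<in> edges M" for e using L(1) that by (simp add: L')
    qed
    moreover have "L' t \<in> positive_functions M" for t
      unfolding positive_functions_iff using L(2) by (simp add: L'_def)
    moreover have "((\<lambda>s. L' s e) has_real_derivative generalized_ricci M (L' t) e * L' t e) (at t
        within {0..})"
      if "t \<ge> 0" "e \<in> edges M" for t e
      unfolding K[OF that(2)] L'[OF that(2)] using L(3) that by blast
    ultimately have "extended_ricci_flow M l0 L'" unfolding extended_ricci_flow_def by simp
    then show ?thesis by (rule exI[of _ L'])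
  qed
  have converges: "converges_exponentially M L l" if flow: "extended_ricci_flow M l0 L" for l0 L
    unfolding converges_exponentially_def
  proof (rule flow_converges[OF l])
    show "L t e > 0" if "t \<ge> 0" "e \<in> edges M" for t e
      using flow that by (simp add: extended_ricci_flow_def positive_functions_iff)
    show "((\<lambda>s. L s e) has_real_derivative generalized_ricci M (L t) e * L t e) (at t within {0..})"
      if "t \<ge> 0" "e \<in> edges M" for t e
      using flow that by (simp add: extended_ricci_flow_def)
  qed
  show ?thesis
    by (intro exI[of _ l] conjI ballI allI impI zero unique box exists converges)
qed

end
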